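(* Let $q\geqslant2$ be a prime power, $A=\mathbb{F}_q[T]$, $k=\mathbb{F}_q(T)$. Let $j_1\neq j_2$ be two Drinfeld singular moduli. Denote by $\mathfrak{c}_1$ and $\mathfrak{c}_2$ the conductors of $\mathcal{O}_{j_1}$ and $\mathcal{O}_{j_2}$ respectively. Suppose that $L$ is a function field (a finite extension of $k$) containing $j_1$ and $j_2$, and let $\mathfrak{P}$ be a finite prime of $L$ above a finite prime $\mathfrak{p}$ of $k$. If $j_1\equiv j_2 \bmod \mathfrak{P}$, then either $K_{j_1}=K_{j_2}$ and $\mathfrak{p}$ divides $\mathfrak{c}_1\mathfrak{c}_2$, or $\mathfrak{p}$ is non-split in both $K_{j_1}$ and $K_{j_2}$ (at least one of the two alternatives holds).
   Context: Let $k_\infty=\mathbb{F}_q((1/T))$ and let $\mathbb{C}_\infty$ be the completion of an algebraic closure of $k_\infty$. Let $\mathbb{C}_\infty\{\tau\}$ be the ring of twisted polynomials, with $\tau c=c^q\tau$ for $c\in\mathbb{C}_\infty$. A Drinfeld $A$-module $\Phi$ of rank $2$ over $\mathbb{C}_\infty$ is given by $\Phi_T=T+g\tau+\Delta\tau^2\in\mathbb{C}_\infty\{\tau\}$ with $\Delta\neq0$. Its endomorphism ring is $\mathrm{End}_{\mathbb{C}_\infty}(\Phi)=\{u\in\mathbb{C}_\infty\{\tau\}\mid u\Phi_T=\Phi_Tu\}$, which is identified with a subring of $\mathbb{C}_\infty$ by taking constant coefficients (this subring contains $A$). Its $j$-invariant is $j(\Phi)=g^{q+1}/\Delta$. $\Phi$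 has complex multiplication (CM) if $\mathrm{End}_{\mathbb{C}_\infty}(\Phi)\neq A$; in that case this ring is an $A$-order in an imaginary quadratic extension of $k$, i.e. a quadratic extension in which the place $\infty=1/T$ does not split. A Drinfeld singular modulus is an element of $\mathbb{C}_\infty$ of the form $j(\Phi)$ with $\Phi$ a rank $2$ Drinfeld module with CM. Drinfeld singular moduli are integral over $A$. For a Drinfeld singular modulus $j$, $\mathcal{O}_j$ denotes the endomorphism ring of any Drinfeld module $\Phi$ with $j(\Phi)=j$ (viewed as an order in $\mathbb{C}_\infty$), and $K_j$ denotes its fraction field. For an order $\mathcal{O}$ in a quadratic extension $K/k$ with maximal $A$-order $\mathcal{O}_K$, the conductor of $\mathcal{O}$ is the unique ideal $\mathfrak{c}$ of $A$ such that $\mathcal{O}=A+\mathfrak{c}\mathcal{O}_K$. Finite primes of $k$ (resp. $L$) are nonzero prime ideals of $A$ (resp. of the integral closure of $A$ in $L$). A prime is non-split in a quadratic extension if it is inert or ramified there. *)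

theory Defs
  imports
    "HOL-Algebra.Algebraic_Closure_Type"
    "HOL-Algebra.Divisibility"
    "HOL-Algebra.Embedded_Algebras"
    "HOL-Algebra.Ideal_Product"
    "HOL-Analysis.Abstract_Metric_Spaces"
    "HOL-Computational_Algebra.Formal_Laurent_Series"
begin

section \<open>The field of complex numbers in characteristic \<open>p\<close>\<close>

text \<open>
  The finite field with \<open>q = CARD('q)\<close> elements is the type \<open>'q\<close>, \<open>A\<close> is the type \<open>'q poly\<close>, and
  the completion of \<open>k\<close> at infinity is \<open>'q fls\<close>, the series variable being \<open>1/T\<close>.
  The locale says that \<open>absv\<close> is a complete non-archimedean absolute value on the field \<open>'c\<close> that
  extends the one on \<open>'q fls\<close>, and that the algebraic closure of \<open>'q fls\<close> is dense in \<open>'c\<close>; this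
  determines \<open>'c\<close> up to isometric isomorphism.
\<close>

locale C_infinity =
  fixes emb :: "('q :: {field, finite}) fls alg_closure \<Rightarrow> 'c :: field"
    and absv :: "'c \<Rightarrow> real"
  assumes emb_hom: "emb \<in> ring_hom ring_of_type_algebra ring_of_type_algebra"
    and absv_nonneg: "absv x \<ge> 0"
    and absv_eq_0_iff: "absv x = 0 \<longleftrightarrow> x = 0"
    and absv_mult: "absv (x * y) = absv x * absv y"
    and absv_ultrametric: "absv (x + y) \<le> max (absv x) (absv y)"
    and absv_emb: "f \<noteq> 0 \<Longrightarrow> absv (emb (to_ac f)) = real CARD('q) powi (- fls_subdegree f)"
    and complete_absv: "Metric_space.mcomplete UNIV (\<lambda>x y. absv (x - y))"
    and dense_range: "Metric_space.mtopology UNIV (\<lambda>x y. absv (x - y)) closure_of range emb = UNIV"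

text \<open>The inclusion of \<open>A\<close>, given by evaluating a polynomial at \<open>T = fls_X_inv\<close>.\<close>

definition A_incl :: "(('q :: {field, finite}) fls alg_closure \<Rightarrow> 'c :: field) \<Rightarrow> 'q poly \<Rightarrow> 'c"
  where "A_incl emb a = emb (to_ac (poly (map_poly fls_const a) fls_X_inv))"


section \<open>Subrings, integral closure and ideals\<close>

text \<open>
  From here on \<open>\<iota>\<close> denotes an inclusion of \<open>A\<close> into a field \<open>'c\<close>, and subrings and subfields of
  \<open>'c\<close> are subsets of \<open>'c\<close>.
\<close>

definition subring_on :: "'c :: field set \<Rightarrow> 'c ring"
  where "subring_on S = ring_of_type_algebra \<lparr>carrier := S\<rparr>"

definition fraction_field :: "'c :: field set \<Rightarrow> 'c set"
  where "fraction_field S = {a / b |a b. a \<in> S \<and> b \<in> S \<and> b \<noteq> 0}"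

definition integral_over_A :: "('q :: {field, finite} poly \<Rightarrow> 'c :: field) \<Rightarrow> 'c \<Rightarrow> bool"
  where "integral_over_A \<iota> x \<longleftrightarrow>
    (\<exists>f :: 'q poly poly. Polynomial.lead_coeff f = 1 \<and> poly (map_poly \<iota> f) x = 0)"

definition integral_closure_in :: "('q :: {field, finite} poly \<Rightarrow> 'c :: field) \<Rightarrow> 'c set \<Rightarrow> 'c set"
  where "integral_closure_in \<iota> K = {x \<in> K. integral_over_A \<iota> x}"

definition extended_ideal ::
    "('q :: {field, finite} poly \<Rightarrow> 'c :: field) \<Rightarrow> 'c set \<Rightarrow> 'q poly set \<Rightarrow> 'c set"
  where "extended_ideal \<iota> K \<cc> = genideal (subring_on (integral_closure_in \<iota> K)) (\<iota> ` \<cc>)"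

definition is_conductor ::
    "('q :: {field, finite} poly \<Rightarrow> 'c :: field) \<Rightarrow> 'c set \<Rightarrow> 'q poly set \<Rightarrow> bool"
  where "is_conductor \<iota> \<O> \<cc> \<longleftrightarrow>
    ideal \<cc> ring_of_type_algebra \<and>
    \<O> = set_add ring_of_type_algebra (range \<iota>) (extended_ideal \<iota> (fraction_field \<O>) \<cc>)"

definition inert_in ::
    "('q :: {field, finite} poly \<Rightarrow> 'c :: field) \<Rightarrow> 'q poly set \<Rightarrow> 'c set \<Rightarrow> bool"
  where "inert_in \<iota> \<pp> K \<longleftrightarrow>
    primeideal (extended_ideal \<iota> K \<pp>) (subring_on (integral_closure_in \<iota> K))"

text \<open>Ramification index two, i.e. ramification in a \<^emph>\<open>quadratic\<close> extension \<open>K\<close> of \<open>k\<close>.\<close>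

definition ramified_in ::
    "('q :: {field, finite} poly \<Rightarrow> 'c :: field) \<Rightarrow> 'q poly set \<Rightarrow> 'c set \<Rightarrow> bool"
  where "ramified_in \<iota> \<pp> K \<longleftrightarrow>
    (\<exists>Q. primeideal Q (subring_on (integral_closure_in \<iota> K)) \<and>
         extended_ideal \<iota> K \<pp> = ideal_prod (subring_on (integral_closure_in \<iota> K)) Q Q)"

definition nonsplit_in ::
    "('q :: {field, finite} poly \<Rightarrow> 'c :: field) \<Rightarrow> 'q poly set \<Rightarrow> 'c set \<Rightarrow> bool"
  where "nonsplit_in \<iota> \<pp> K \<longleftrightarrow> inert_in \<iota> \<pp> K \<or> ramified_in \<iota> \<pp> K"


section \<open>Drinfeld modules of rank two\<close>

text \<open>
  The twisted polynomial \<open>c\<^sub>0 + c\<^sub>1 \<tau> + c\<^sub>2 \<tau>\<^sup>2 + \<dots>\<close> is represented by the ordinary polynomial with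
  the same coefficients; the product below is the one with \<open>\<tau> c = c\<^sup>q \<tau>\<close>.
\<close>

definition twisted_mult :: "nat \<Rightarrow> 'c :: field poly \<Rightarrow> 'c poly \<Rightarrow> 'c poly"
  where "twisted_mult q u v =
    (\<Sum>i\<le>Polynomial.degree u. \<Sum>j\<le>Polynomial.degree v.
       Polynomial.monom (poly.coeff u i * poly.coeff v j ^ (q ^ i)) (i + j))"

definition drinfeld_T :: "('q :: {field, finite} poly \<Rightarrow> 'c :: field) \<Rightarrow> 'c \<Rightarrow> 'c \<Rightarrow> 'c poly"
  where "drinfeld_T \<iota> g \<Delta> = [:\<iota> [:0, 1:], g, \<Delta>:]"

definition drinfeld_j :: "('q :: {field, finite} poly \<Rightarrow> 'c :: field) \<Rightarrow> 'c \<Rightarrow> 'c \<Rightarrow> 'c"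
  where "drinfeld_j \<iota> g \<Delta> = g ^ (CARD('q) + 1) / \<Delta>"

definition drinfeld_End :: "('q :: {field, finite} poly \<Rightarrow> 'c :: field) \<Rightarrow> 'c \<Rightarrow> 'c \<Rightarrow> 'c poly set"
  where "drinfeld_End \<iota> g \<Delta> =
    {u. twisted_mult CARD('q) u (drinfeld_T \<iota> g \<Delta>) = twisted_mult CARD('q) (drinfeld_T \<iota> g \<Delta>) u}"

definition drinfeld_order :: "('q :: {field, finite} poly \<Rightarrow> 'c :: field) \<Rightarrow> 'c \<Rightarrow> 'c \<Rightarrow> 'c set"
  where "drinfeld_order \<iota> g \<Delta> = (\<lambda>u. poly.coeff u 0) ` drinfeld_End \<iota> g \<Delta>"

definition has_CM :: "('q :: {field, finite} poly \<Rightarrow> 'c :: field) \<Rightarrow> 'c \<Rightarrow> 'c \<Rightarrow> bool"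
  where "has_CM \<iota> g \<Delta> \<longleftrightarrow> drinfeld_order \<iota> g \<Delta> \<noteq> range \<iota>"

definition singular_modulus :: "('q :: {field, finite} poly \<Rightarrow> 'c :: field) \<Rightarrow> 'c \<Rightarrow> bool"
  where "singular_modulus \<iota> j \<longleftrightarrow> (\<exists>g \<Delta>. \<Delta> \<noteq> 0 \<and> has_CM \<iota> g \<Delta> \<and> j = drinfeld_j \<iota> g \<Delta>)"

text \<open>Well defined by lemma \<open>modulus_order_eq\<close> below.\<close>

definition modulus_order :: "('q :: {field, finite} poly \<Rightarrow> 'c :: field) \<Rightarrow> 'c \<Rightarrow> 'c set"
  where "modulus_order \<iota> j =
    (THE \<O>. \<exists>g \<Delta>. \<Delta> \<noteq> 0 \<and> j = drinfeld_j \<iota> g \<Delta> \<and> \<O> = drinfeld_order \<iota> g \<Delta>)"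

definition modulus_field :: "('q :: {field, finite} poly \<Rightarrow> 'c :: field) \<Rightarrow> 'c \<Rightarrow> 'c set"
  where "modulus_field \<iota> j = fraction_field (modulus_order \<iota> j)"


section \<open>Independence of the chosen Drinfeld module\<close>

lemma coeff_twisted_mult:
  assumes "q > 0"
  shows "poly.coeff (twisted_mult q u v) n =
    (\<Sum>i\<le>n. poly.coeff u i * poly.coeff v (n - i) ^ (q ^ i))"
proof -
  define h where "h i j = poly.coeff u i * poly.coeff v j ^ (q ^ i)" for i j
  have h0: "h i j = 0" if "i > Polynomial.degree u \<or> j > Polynomial.degree v" for i j
    using that assms by (auto simp: h_def Polynomial.coeff_eq_0)
  have inner: "(\<Sum>j\<le>Polynomial.degree v. poly.coeff (Polynomial.monom (h i j) (i + j)) n) =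
      (if i \<le> n then h i (n - i) else 0)" for i
  proof -
    have "(\<Sum>j\<le>Polynomial.degree v. poly.coeff (Polynomial.monom (h i j) (i + j)) n) =
        (\<Sum>j\<le>Polynomial.degree v. if j = n - i then (if i \<le> n then h i j else 0) else 0)"
      by (intro sum.cong) auto
    also have "\<dots> = (if i \<le> n then h i (n - i) else 0)"
      using h0[of i "n - i"] by (auto simp: sum.delta)
    finally show ?thesis .
  qed
  have "poly.coeff (twisted_mult q u v) n =
      (\<Sum>i\<le>Polynomial.degree u. if i \<le> n then h i (n - i) else 0)"
    unfolding twisted_mult_def h_def[symmetric] Polynomial.coeff_sum inner ..
  also have "\<dots> = (\<Sum>i\<in>{..Polynomial.degree u} \<inter> {..n}. h i (n - i))"
    by (subst sum.inter_restrict) auto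
  also have "\<dots> = (\<Sum>i\<le>n. h i (n - i))"
    by (rule sum.mono_neutral_left) (use h0 not_le in \<open>auto, blast\<close>)
  finally show ?thesis by (simp add: h_def)
qed

text \<open>Conjugation \<open>u \<mapsto> c\<^sup>-\<^sup>1 u c\<close> in the ring of twisted polynomials.\<close>

definition twisted_conj :: "nat \<Rightarrow> 'c :: field \<Rightarrow> 'c poly \<Rightarrow> 'c poly"
  where "twisted_conj q c u =
    (\<Sum>i\<le>Polynomial.degree u. Polynomial.monom (poly.coeff u i * c ^ (q ^ i - 1)) i)"

lemma coeff_twisted_conj: "poly.coeff (twisted_conj q c u) n = poly.coeff u n * c ^ (q ^ n - 1)"
  by (simp add: twisted_conj_def Polynomial.coeff_sum Polynomial.coeff_eq_0)

lemma twisted_conj_mult: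
  assumes "q > 0"
  shows "twisted_conj q c (twisted_mult q u v) =
    twisted_mult q (twisted_conj q c u) (twisted_conj q c v)"
proof (rule poly_eqI)
  fix n
  have key: "poly.coeff u i * c ^ (q ^ i - 1) * (poly.coeff v (n - i) * c ^ (q ^ (n - i) - 1)) ^ (q ^ i) =
      poly.coeff u i * poly.coeff v (n - i) ^ (q ^ i) * c ^ (q ^ n - 1)" if "i \<le> n" for i
  proof -
    have n: "q ^ n = q ^ i * q ^ (n - i)"
      using that by (simp flip: power_add)
    have le: "q ^ i \<le> q ^ i * q ^ (n - i)" "1 \<le> q ^ i"
      using assms by auto
    have "(q ^ i - 1) + (q ^ (n - i) - 1) * q ^ i = q ^ n - 1"
      using le by (simp only: n diff_mult_distrib mult.commute[of "q ^ i"])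
    thus ?thesis
      by (simp add: power_mult_distrib flip: power_mult power_add)
  qed
  show "poly.coeff (twisted_conj q c (twisted_mult q u v)) n =
      poly.coeff (twisted_mult q (twisted_conj q c u) (twisted_conj q c v)) n"
    unfolding coeff_twisted_conj coeff_twisted_mult[OF assms] sum_distrib_right
    by (rule sum.cong[OF refl], rule key[symmetric]) simp
qed

lemma drinfeld_order_conj_subset:
  fixes \<iota> :: "'q :: {field, finite} poly \<Rightarrow> 'c :: field"
  assumes "g' = g * c ^ (CARD('q) - 1)" and "\<Delta>' = \<Delta> * c ^ (CARD('q) ^ 2 - 1)"
  shows "drinfeld_order \<iota> g \<Delta> \<subseteq> drinfeld_order \<iota> g' \<Delta>'"
proof -
  have q: "CARD('q) > 0" by simp
  have \<Phi>: "twisted_conj CARD('q) c (drinfeld_T \<iota> g \<Delta>) = drinfeld_T \<iota> g' \<Delta>'"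
  proof (rule poly_eqI)
    fix n :: nat
    consider "n = 0" | "n = 1" | "n = 2" | "n \<ge> 3" by linarith
    thus "poly.coeff (twisted_conj CARD('q) c (drinfeld_T \<iota> g \<Delta>)) n =
        poly.coeff (drinfeld_T \<iota> g' \<Delta>') n"
      by cases (auto simp: coeff_twisted_conj drinfeld_T_def assms Polynomial.coeff_pCons
          numeral_2_eq_2 split: nat.split)
  qed
  show ?thesis
  proof
    fix x assume "x \<in> drinfeld_order \<iota> g \<Delta>"
    then obtain u where u: "u \<in> drinfeld_End \<iota> g \<Delta>" and x: "x = poly.coeff u 0"
      by (auto simp: drinfeld_order_def)
    have "twisted_conj CARD('q) c u \<in> drinfeld_End \<iota> g' \<Delta>'"
      using u twisted_conj_mult[OF q, of c u "drinfeld_T \<iota> g \<Delta>"]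
        twisted_conj_mult[OF q, of c "drinfeld_T \<iota> g \<Delta>" u]
      by (simp add: drinfeld_End_def \<Phi>)
    moreover have "poly.coeff (twisted_conj CARD('q) c u) 0 = x"
      by (simp add: coeff_twisted_conj x)
    ultimately show "x \<in> drinfeld_order \<iota> g' \<Delta>'"
      unfolding drinfeld_order_def by (metis imageI)
  qed
qed

lemma drinfeld_order_conj:
  fixes \<iota> :: "'q :: {field, finite} poly \<Rightarrow> 'c :: field"
  assumes "c \<noteq> 0" "g' = g * c ^ (CARD('q) - 1)" "\<Delta>' = \<Delta> * c ^ (CARD('q) ^ 2 - 1)"
  shows "drinfeld_order \<iota> g \<Delta> = drinfeld_order \<iota> g' \<Delta>'"
proof (rule antisym)
  show "drinfeld_order \<iota> g \<Delta> \<subseteq> drinfeld_order \<iota> g' \<Delta>'"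
    using assms(2,3) by (rule drinfeld_order_conj_subset)
  show "drinfeld_order \<iota> g' \<Delta>' \<subseteq> drinfeld_order \<iota> g \<Delta>"
    by (rule drinfeld_order_conj_subset[of _ _ "inverse c"])
      (use assms in \<open>simp_all add: mult.assoc flip: power_mult_distrib\<close>)
qed

context C_infinity
begin

sublocale M: Metric_space UNIV "\<lambda>x y. absv (x - y)"
proof
  have absv_1: "absv 1 = 1"
    using absv_mult[of 1 1] absv_eq_0_iff[of 1] by auto
  have "absv (- 1) ^ 2 = 1"
    using absv_mult[of "- 1" "- 1"] absv_1 by (simp add: power2_eq_square)
  hence "absv (- 1) = 1"
    using absv_nonneg[of "- 1"] by (simp add: power2_eq_1_iff)
  hence minus: "absv (- x) = absv x" for x
    using absv_mult[of "- 1" x] by simp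
  fix x y z :: 'c
  show "0 \<le> absv (x - y)" by (rule absv_nonneg)
  show "absv (x - y) = absv (y - x)" using minus[of "x - y"] by simp
  show "absv (x - y) = 0 \<longleftrightarrow> x = y" by (simp add: absv_eq_0_iff)
  show "absv (x - z) \<le> absv (x - y) + absv (y - z)"
    using absv_ultrametric[of "x - y" "y - z"] absv_nonneg[of "x - y"] absv_nonneg[of "y - z"]
    by simp
qed

lemma absv_1: "absv 1 = 1"
  using absv_mult[of 1 1] absv_eq_0_iff[of 1] by auto

lemma absv_power: "absv (x ^ n) = absv x ^ n"
  by (induction n) (auto simp: absv_1 absv_mult)

lemma absv_ultrametric': "absv (x - z) \<le> max (absv (x - y)) (absv (y - z))"
  using absv_ultrametric[of "x - y" "y - z"] by simp

lemma emb_add: "emb (x + y) = emb x + emb y"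
  and emb_mult: "emb (x * y) = emb x * emb y"
  and emb_1: "emb 1 = 1"
  using emb_hom by (auto simp: ring_hom_def ring_of_type_algebra_def)

lemma emb_0: "emb 0 = 0"
  using emb_add[of 0 0] by (metis add_0 add_cancel_right_right)

lemma emb_diff: "emb (x - y) = emb x - emb y"
  using emb_add[of "x - y" y] by simp

lemma emb_power: "emb (x ^ n) = emb x ^ n"
  by (induction n) (auto simp: emb_1 emb_mult)

lemma absv_power_diff:
  assumes "absv x \<le> B" "absv y \<le> B" "1 \<le> B"
  shows "absv (x ^ n - y ^ n) \<le> B ^ n * absv (x - y)"
proof (induction n)
  case 0
  have "absv 0 = 0" by (simp add: absv_eq_0_iff)
  thus ?case by (simp add: absv_nonneg)
next
  case (Suc n)
  have "absv (x ^ Suc n - y ^ Suc n) = absv (x * (x ^ n - y ^ n) + (x - y) * y ^ n)"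
    by (simp add: algebra_simps)
  also have "\<dots> \<le> max (absv x * absv (x ^ n - y ^ n)) (absv (x - y) * absv y ^ n)"
    using absv_ultrametric by (metis absv_mult absv_power)
  also have "\<dots> \<le> B ^ Suc n * absv (x - y)"
  proof (rule max.boundedI)
    show "absv x * absv (x ^ n - y ^ n) \<le> B ^ Suc n * absv (x - y)"
      using mult_mono[OF assms(1) Suc] assms(3) absv_nonneg by (simp add: mult.assoc)
    have "absv y ^ n \<le> B ^ n"
      using assms absv_nonneg by (intro power_mono) auto
    also have "\<dots> \<le> B ^ Suc n"
      using assms(3) by (intro power_increasing) auto
    finally show "absv (x - y) * absv y ^ n \<le> B ^ Suc n * absv (x - y)"
      using absv_nonneg[of "x - y"] by (subst mult.commute) (rule mult_right_mono)
  qed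
  finally show ?case .
qed

lemma close_root:
  assumes "n > 0" "absv (emb c - emb (b ^ n)) < \<epsilon> ^ n" "\<epsilon> > 0"
  obtains b' where "b' ^ n = c" "absv (emb b' - emb b) < \<epsilon>"
proof -
  define f where "f = Polynomial.monom 1 n - [:c:]"
  have deg: "Polynomial.degree f = n"
    unfolding f_def using assms(1)
    by (subst diff_conv_add_uminus, subst Polynomial.degree_add_eq_left) (auto simp: Polynomial.degree_monom_eq)
  have lc: "Polynomial.lead_coeff f = 1"
    unfolding deg using assms(1) by (simp add: f_def Polynomial.coeff_pCons split: nat.split)
  have "f \<noteq> 0" using lc by auto
  from alg_closed_imp_factorization[OF this] obtain R
    where R: "size R = n" "f = (\<Prod>x\<in>#R. [:-x, 1:])"
    using lc deg by auto
  have fx: "poly f x = x ^ n - c" for x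
    by (simp add: f_def Polynomial.poly_monom)
  have fb: "poly f x = (\<Prod>r\<in>#R. x - r)" for x
    unfolding R(2) by (induction R) (auto simp: algebra_simps)
  have root: "r ^ n = c" if "r \<in># R" for r
    proof -
    have "poly f r = 0" unfolding fb using that by (auto simp: prod_mset_zero_iff)
    thus ?thesis using fx[of r] by simp
  qed
  have prod: "absv (emb (\<Prod>r\<in>#S. b - r)) = (\<Prod>r\<in>#S. absv (emb b - emb r))" for S
    by (induction S) (auto simp: emb_1 absv_1 emb_mult absv_mult emb_diff)
  have ge: "(\<Prod>r\<in>#S. absv (emb b - emb r)) \<ge> \<epsilon> ^ size S"
    if "\<And>r. r \<in># S \<Longrightarrow> absv (emb b - emb r) \<ge> \<epsilon>" for S
    using that
  proof (induction S)
    case (add r S)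
    show ?case
      using mult_mono[of \<epsilon> "absv (emb b - emb r)" "\<epsilon> ^ size S" "\<Prod>r\<in>#S. absv (emb b - emb r)"]
        add assms(3) absv_nonneg by simp
  qed auto
  have "\<not> (\<forall>r. r \<in># R \<longrightarrow> absv (emb b - emb r) \<ge> \<epsilon>)"
  proof
    assume "\<forall>r. r \<in># R \<longrightarrow> absv (emb b - emb r) \<ge> \<epsilon>"
    hence "\<epsilon> ^ n \<le> absv (emb (b ^ n - c))"
      using ge[of R] R(1) fx[of b] fb[of b] prod[of R] by simp
    thus False
      using assms(2) M.commute[of "emb c" "emb (b ^ n)"] by (simp add: emb_diff)
  qed
  then obtain r where "r \<in># R" "absv (emb b - emb r) < \<epsilon>" by force
  thus ?thesis using that root M.commute by metis
qed

lemma nth_root_exists_C: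
  assumes n: "n > 0"
  shows "\<exists>b. b ^ n = (a :: 'c)"
proof -
  define e :: "nat \<Rightarrow> real" where "e m = (1 / 2) ^ m" for m
  have e_pos: "e m > 0" for m by (simp add: e_def)
  have e_mono: "e m' \<le> e m" if "m \<le> m'" for m m'
    unfolding e_def using that by (intro power_decreasing) auto
  have "\<exists>c. absv (a - emb c) < r" if "r > 0" for r
  proof -
    have "a \<in> M.mtopology closure_of range emb" using dense_range by simp
    thus ?thesis using that unfolding M.metric_closure_of by auto
  qed
  hence "\<forall>m. \<exists>c. absv (a - emb c) < e m ^ n" using e_pos by simp
  then obtain c where c: "\<And>m. absv (a - emb (c m)) < e m ^ n" by metis
  have cc: "absv (emb (c (Suc m)) - emb (c m)) < e m ^ n" for m
  proof -
    have "absv (emb (c (Suc m)) - a) < e m ^ n"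
      using c[of "Suc m"] M.commute[of a "emb (c (Suc m))"] e_mono[of m "Suc m"] e_pos
        power_mono[of "e (Suc m)" "e m" n] by (metis le_SucI order_refl less_imp_le order.strict_trans2)
    thus ?thesis
      using c[of m] absv_ultrametric'[of "emb (c (Suc m))" "emb (c m)" a] by simp
  qed
  have "\<exists>b. \<forall>m. b m ^ n = c m \<and> absv (emb (b (Suc m)) - emb (b m)) < e m"
  proof (rule dependent_nat_choice)
    show "\<exists>x. x ^ n = c 0" using n by (rule nth_root_exists)
    show "\<exists>y. y ^ n = c (Suc m) \<and> absv (emb y - emb x) < e m" if "x ^ n = c m" for x m
      using close_root[OF n, of "c (Suc m)" x "e m"] cc[of m] e_pos that by metis
  qed
  then obtain b where b: "\<And>m. b m ^ n = c m"
    and bb: "\<And>m. absv (emb (b (Suc m)) - emb (b m)) < e m" by metis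
  have step: "absv (emb (b (m + k)) - emb (b m)) < e m" for m k
  proof (induction k)
    case 0
    have "absv 0 = 0" by (simp add: absv_eq_0_iff)
    thus ?case using e_pos by simp
  next
    case (Suc k)
    have "absv (emb (b (m + Suc k)) - emb (b (m + k))) < e m"
      using bb[of "m + k"] e_mono[of m "m + k"] by simp
    thus ?case
      using Suc absv_ultrametric'[of "emb (b (m + Suc k))" "emb (b m)" "emb (b (m + k))"] by simp
  qed
  have e_small: "\<exists>N. e N < r" if "r > 0" for r
    unfolding e_def using real_arch_pow_inv[OF that] by auto
  have "M.MCauchy (\<lambda>m. emb (b m))"
    unfolding M.MCauchy_def
  proof (intro conjI allI impI)
    fix r :: real assume "r > 0"
    then obtain N where N: "e N < r" using e_small by auto
    show "\<exists>N. \<forall>n n'. N \<le> n \<longrightarrow> N \<le> n' \<longrightarrow> absv (emb (b n) - emb (b n')) < r"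
    proof (intro exI[of _ N] allI impI)
      fix m m' assume "N \<le> m" "N \<le> m'"
      hence "absv (emb (b m) - emb (b N)) < e N" "absv (emb (b m') - emb (b N)) < e N"
        using step[of N "m - N"] step[of N "m' - N"] by auto
      thus "absv (emb (b m) - emb (b m')) < r"
        using N absv_ultrametric'[of "emb (b m)" "emb (b m')" "emb (b N)"]
          M.commute[of "emb (b m')" "emb (b N)"] by simp
    qed
  qed auto
  then obtain x where "limitin M.mtopology (\<lambda>m. emb (b m)) x sequentially"
    using complete_absv unfolding M.mcomplete_def by blast
  hence lim: "\<exists>N. \<forall>m\<ge>N. absv (emb (b m) - x) < r" if "r > 0" for r
    using that unfolding M.limit_metric_sequentially by auto
  define B where "B = max 1 (absv x)"
  have "absv (x ^ n - a) \<le> 0"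
  proof (rule field_le_epsilon)
    fix r :: real assume r: "r > 0"
    have B: "B \<ge> 1" "absv x \<le> B" by (auto simp: B_def)
    define s where "s = min 1 (r / B ^ n)"
    have s: "s > 0" using r B by (simp add: s_def)
    obtain N1 where N1: "\<And>m. m \<ge> N1 \<Longrightarrow> absv (emb (b m) - x) < s" using lim[OF s] by auto
    obtain N2 where N2: "e N2 < min 1 r" using e_small[of "min 1 r"] r by auto
    define m where "m = max N1 N2"
    have near: "absv (emb (b m) - x) < s" using N1[of m] by (simp add: m_def)
    hence "absv (emb (b m)) \<le> B"
      using absv_ultrametric'[of "emb (b m)" 0 x] B by (auto simp: s_def max_def split: if_splits)
    hence "absv (x ^ n - emb (b m) ^ n) \<le> B ^ n * absv (x - emb (b m))"
      using B by (intro absv_power_diff) auto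
    also have "\<dots> \<le> B ^ n * (r / B ^ n)"
      using near B M.commute[of x "emb (b m)"] by (intro mult_left_mono) (auto simp: s_def)
    also have "\<dots> = r" using B by simp
    finally have 1: "absv (x ^ n - emb (c m)) \<le> r"
      by (simp add: b flip: emb_power)
    have em: "e m < 1" "e m < r" using e_mono[of N2 m] N2 by (auto simp: m_def)
    have "e m ^ n \<le> e m" using em e_pos[of m] n power_decreasing[of 1 n "e m"] by simp
    hence 2: "absv (emb (c m) - a) \<le> r"
      using c[of m] em M.commute[of a "emb (c m)"] by simp
    show "absv (x ^ n - a) \<le> 0 + r"
      using 1 2 absv_ultrametric'[of "x ^ n" a "emb (c m)"] by simp
  qed
  hence "x ^ n = a"
    using absv_nonneg[of "x ^ n - a"] absv_eq_0_iff[of "x ^ n - a"] by simp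
  thus ?thesis ..
qed

lemma drinfeld_order_eq:
  fixes \<iota> :: "'q poly \<Rightarrow> 'c"
  assumes "\<Delta> \<noteq> 0" "\<Delta>' \<noteq> 0" "drinfeld_j \<iota> g \<Delta> = drinfeld_j \<iota> g' \<Delta>'"
  shows "drinfeld_order \<iota> g \<Delta> = drinfeld_order \<iota> g' \<Delta>'"
proof -
  let ?q = "CARD('q)"
  have "card {0, 1 :: 'q} \<le> ?q" by (rule card_mono) auto
  hence q: "?q \<ge> 2" by simp
  hence q2: "?q ^ 2 - 1 > 0" using power_increasing[of 1 2 ?q] by simp
  have eq: "g ^ (?q + 1) * \<Delta>' = g' ^ (?q + 1) * \<Delta>"
    using assms by (simp add: drinfeld_j_def field_simps)
  show ?thesis
  proof (cases "g = 0")
    case True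
    hence g': "g' = 0" using eq assms by simp
    obtain c where c: "c ^ (?q ^ 2 - 1) = \<Delta>' / \<Delta>"
      using nth_root_exists_C[OF q2] by blast
    hence "c \<noteq> 0" using assms q2 by (auto simp: power_0_left split: if_splits)
    thus ?thesis
      by (rule drinfeld_order_conj) (use True g' c assms in auto)
  next
    case False
    hence g': "g' \<noteq> 0" using eq assms by auto
    obtain c where c: "c ^ (?q - 1) = g' / g"
      using nth_root_exists_C[of "?q - 1"] q by auto
    hence "c \<noteq> 0" using g' False q by (auto simp: power_0_left split: if_splits)
    moreover have "g' = g * c ^ (?q - 1)" using c False by simp
    moreover have "\<Delta>' = \<Delta> * c ^ (?q ^ 2 - 1)"
    proof -
      have "?q ^ 2 - 1 = (?q - 1) * (?q + 1)"
        by (simp add: power2_eq_square algebra_simps)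
      hence "\<Delta> * c ^ (?q ^ 2 - 1) = \<Delta> * (g' / g) ^ (?q + 1)"
        by (simp only: power_mult c)
      also have "\<dots> = \<Delta> * g' ^ (?q + 1) / g ^ (?q + 1)"
        by (simp add: power_divide)
      also have "\<dots> = \<Delta>'"
        using eq False by (simp add: field_simps)
      finally show ?thesis ..
    qed
    ultimately show ?thesis by (rule drinfeld_order_conj)
  qed
qed

lemma modulus_order_eq:
  fixes \<iota> :: "'q poly \<Rightarrow> 'c"
  assumes "\<Delta> \<noteq> 0"
  shows "modulus_order \<iota> (drinfeld_j \<iota> g \<Delta>) = drinfeld_order \<iota> g \<Delta>"
  unfolding modulus_order_def
proof (rule the_equality)
  show "\<exists>g' \<Delta>'. \<Delta>' \<noteq> 0 \<and> drinfeld_j \<iota> g \<Delta> = drinfeld_j \<iota> g' \<Delta>' \<and>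
      drinfeld_order \<iota> g \<Delta> = drinfeld_order \<iota> g' \<Delta>'"
    using assms by blast
next
  fix \<O>
  assume "\<exists>g' \<Delta>'. \<Delta>' \<noteq> 0 \<and> drinfeld_j \<iota> g \<Delta> = drinfeld_j \<iota> g' \<Delta>' \<and> \<O> = drinfeld_order \<iota> g' \<Delta>'"
  thus "\<O> = drinfeld_order \<iota> g \<Delta>"
    using drinfeld_order_eq[of \<Delta>] assms by metis
qed

end

end

theory Submission
  imports Defs "Jordan_Normal_Form.Char_Poly"
begin

text \<open>
  The proof follows Deuring's reduction theory. A place of the field of complex numbers that lies
  above \<open>\<PP>\<close> is chosen, with residue field algebraic over
  \<open>F\<^sub>q\<close>. Modules with complex multiplication have potentially good reduction
  (\<open>bad_reduction_no_CM\<close>), so \<open>j\<^sub>1\<close> and \<open>j\<^sub>2\<close>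
  have models \<open>T + g\<^sub>i \<tau> + \<tau>\<^sup>2\<close> over the valuation ring. Since
  \<open>j\<^sub>i = g\<^sub>i ^ (q + 1)\<close> and \<open>j\<^sub>1 \<equiv> j\<^sub>2\<close>,
  the coefficient \<open>g\<^sub>2\<close> can be multiplied by a root of unity such that both
  models have the same reduction \<open>\<phi>\<close>. Both orders then act faithfully on
  \<open>\<phi>\<close> (\<open>drinfeld_order_represented\<close>). Let \<open>\<pi>\<close>
  generate \<open>\<pp>\<close>, and let \<open>d\<close> be its degree. The lowest exponent of
  \<open>\<tau>\<close> in \<open>\<phi>\<^sub>\<pi>\<close> is \<open>2 d\<close> or
  \<open>d\<close>.

  In the supersingular case, where it is \<open>2 d\<close>, \<open>\<phi>\<^sub>\<pi>\<close> is
  a monomial in \<open>\<tau>\<close>. The lowest exponent of \<open>\<tau>\<close> in the action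
  of an element defines a valuation on either field \<open>K\<close>, and this valuation turns out
  to be the only one above \<open>\<pi>\<close>: an element of nonnegative valuation becomes
  integral after multiplication by an element of \<open>A\<close> prime to \<open>\<pi>\<close>.
  Hence \<open>\<pp>\<close> is non-split in both fields
  (\<open>supersingular_imp_nonsplit\<close>).

  In the ordinary case, where it is \<open>d\<close>, the image of \<open>A\<close> is
  \<open>\<tau>\<close>-adically dense in the endomorphism ring of \<open>\<phi>\<close>, and a
  counting argument shows that this ring has rank two (\<open>End_dependent\<close>). Both fields
  therefore are its field of fractions, realised by roots of the same quadratic equations, and
  they coincide (\<open>lift_field_subset\<close>). Suppose that \<open>\<pp>\<close> divides
  neither conductor. Then both orders contain a lift of \<open>\<phi>\<^sub>m
  \<tau>\<^sup>n\<close> for some \<open>m\<close> prime to \<open>\<pi>\<close> and some power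
  \<open>\<tau>\<^sup>n\<close> of Frobenius that is an endomorphism of \<open>\<phi>\<close>. If
  these lifts had different constant coefficients, those would be conjugate and both reduce to
  zero, and \<open>\<phi>\<^sub>\<pi>\<close> would divide the square of \<open>\<phi>\<^sub>m
  \<tau>\<^sup>n\<close>, which it does not (\<open>Frobenius_not_divisible\<close>). But a module
  to which such an endomorphism lifts with given constant coefficient is determined by its
  reduction (\<open>ordinary_lift_unique\<close>), so \<open>g\<^sub>1 = g\<^sub>2\<close> and
  \<open>j\<^sub>1 = j\<^sub>2\<close>. Hence \<open>\<pp>\<close> contains one of the conductors,
  and in \<open>A\<close> to contain is to divide.
\<close>

section \<open>Twisted polynomials over a field containing a finite field\<close>

abbreviation (input) tmult :: "'f::field poly \<Rightarrow> nat \<Rightarrow> 'f poly \<Rightarrow> 'f poly"  ("_ \<star>\<^bsub>_\<^esub> _" [71, 0, 70] 70)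
  where "u \<star>\<^bsub>q\<^esub> v \<equiv> twisted_mult q u v"

definition poly_of_coeffs :: "nat \<Rightarrow> (nat \<Rightarrow> 'f::comm_monoid_add) \<Rightarrow> 'f poly"
  where "poly_of_coeffs N h = (\<Sum>i\<le>N. monom (h i) i)"

lemma coeff_poly_of_coeffs: "coeff (poly_of_coeffs N h) n = (if n \<le> N then h n else 0)"
  by (simp add: poly_of_coeffs_def coeff_sum)

lemma finite_field_power_card:
  fixes a :: "'q::{field, finite}"
  shows "a ^ CARD('q) = a"
proof (cases "a = 0")
  case False
  let ?U = "UNIV - {0 :: 'q}"
  have "(\<Prod>x\<in>?U. a * x) = (\<Prod>x\<in>?U. x)"
    by (rule prod.reindex_bij_witness[of _ "\<lambda>x. x / a" "\<lambda>x. a * x"]) (use False in auto)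
  hence "a ^ card ?U * (\<Prod>x\<in>?U. x) = (\<Prod>x\<in>?U. x)"
    by (simp only: prod.distrib prod_constant)
  moreover have "(\<Prod>x\<in>?U. x) \<noteq> 0" by simp
  ultimately have "a ^ card ?U = 1" by (metis mult_cancel_right1)
  moreover have "CARD('q) = Suc (card ?U)" by (intro card_Suc_Diff1[symmetric]) auto
  ultimately show ?thesis by (simp only: power_Suc mult_1_right)
qed (simp add: power_0_left)

lemma card_field_ge_2: "CARD('q::{field, finite}) \<ge> 2"
proof -
  have "card {0, 1 :: 'q} \<le> CARD('q)" by (rule card_mono) auto
  thus ?thesis by simp
qed

text \<open>The polynomial \<open>(X + 1)\<^sup>q - X\<^sup>q - 1\<close> has degree less than \<open>q\<close> and vanishes on all \<open>q\<close> elements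
  of the field, so its coefficients vanish.\<close>

lemma of_nat_card_choose_eq_0:
  assumes "0 < i" "i < CARD('q::{field, finite})"
  shows "of_nat (CARD('q) choose i) = (0 :: 'q)"
proof -
  let ?q = "CARD('q)"
  define D :: "'q poly" where "D = (\<Sum>i\<in>{1..<?q}. monom (of_nat (?q choose i)) i)"
  have D: "coeff D n = (if n \<in> {1..<?q} then of_nat (?q choose n) else 0)" for n
    by (simp add: D_def coeff_sum)
  have root: "poly D x = 0" for x
  proof -
    have "{..?q} = insert 0 (insert ?q {1..<?q})" by auto
    hence "(x + 1) ^ ?q = 1 + (x ^ ?q + (\<Sum>i\<in>{1..<?q}. of_nat (?q choose i) * x ^ i))"
      by (subst binomial_ring) simp
    hence "(\<Sum>i\<in>{1..<?q}. of_nat (?q choose i) * x ^ i) = 0"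
      by (simp add: finite_field_power_card)
    thus ?thesis by (simp add: D_def poly_sum poly_monom)
  qed
  have "degree D \<le> ?q - 1"
    by (rule degree_le) (auto simp: D)
  hence "degree D < ?q" using card_field_ge_2[where 'q = 'q] by simp
  hence "D = 0" by (intro poly_eqI_degree[of UNIV]) (auto simp: root)
  thus ?thesis using D[of i] assms by simp
qed

text \<open>The inclusion \<open>\<kappa>\<close> of \<open>F\<^sub>q\<close> makes \<open>x
  \<mapsto> x\<^sup>q\<close> additive, with \<open>\<kappa>(F\<^sub>q)\<close> as its set of
  fixed points. The ring axioms of twisted polynomials and all arguments with leading and lowest
  coefficients rest on these two facts.\<close>

locale Fq_field =
  fixes q :: nat and \<kappa> :: "'q::{field, finite} \<Rightarrow> 'f::field"
  assumes q_eq: "q = CARD('q)"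
    and kappa_add: "\<kappa> (x + y) = \<kappa> x + \<kappa> y"
    and kappa_mult: "\<kappa> (x * y) = \<kappa> x * \<kappa> y"
    and kappa_1: "\<kappa> 1 = 1"
begin

lemma q_ge_2: "q \<ge> 2"
  using card_field_ge_2[where 'q = 'q] by (simp add: q_eq)

lemma q_pos: "q > 0" using q_ge_2 by simp

lemma kappa_0: "\<kappa> 0 = 0"
  using kappa_add[of 0 0] by (metis add_0 add_cancel_right_right)

lemma kappa_minus: "\<kappa> (- x) = - \<kappa> x"
  by (rule minus_unique[symmetric]) (simp add: kappa_0 flip: kappa_add)

lemma kappa_diff: "\<kappa> (x - y) = \<kappa> x - \<kappa> y"
  using kappa_add[of x "- y"] kappa_minus by simp

lemma kappa_eq_0_iff: "\<kappa> x = 0 \<longleftrightarrow> x = 0"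
proof
  assume "\<kappa> x = 0"
  thus "x = 0" using kappa_mult[of x "inverse x"] kappa_1 by (cases "x = 0") auto
qed (simp add: kappa_0)

lemma kappa_of_nat: "\<kappa> (of_nat n) = of_nat n"
  by (induction n) (auto simp: kappa_0 kappa_1 kappa_add)

lemma kappa_power: "\<kappa> (x ^ n) = \<kappa> x ^ n"
  by (induction n) (auto simp: kappa_1 kappa_mult)

lemma kappa_power_q: "\<kappa> x ^ (q ^ i) = \<kappa> x"
proof (induction i)
  case (Suc i)
  have "\<kappa> x ^ (q ^ Suc i) = (\<kappa> x ^ (q ^ i)) ^ q" by (simp add: mult.commute flip: power_mult)
  also have "\<dots> = \<kappa> x" using Suc finite_field_power_card[of x] by (simp add: q_eq flip: kappa_power)
  finally show ?case .
qed simp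

lemma frob_add: "(x + y :: 'f) ^ q = x ^ q + y ^ q"
proof -
  have "of_nat (q choose i) = (0 :: 'f)" if "i \<in> {1..<q}" for i
    using of_nat_card_choose_eq_0[of i, where 'q = 'q] kappa_of_nat[of "q choose i"] that
    by (simp add: q_eq kappa_0)
  moreover have "{..q} = insert 0 (insert q {1..<q})" by auto
  ultimately show ?thesis
    using q_pos by (subst binomial_ring) (simp add: add.commute)
qed

lemma frob_pow_add: "(x + y :: 'f) ^ (q ^ i) = x ^ (q ^ i) + y ^ (q ^ i)"
proof (induction i)
  case (Suc i)
  have *: "z ^ (q ^ Suc i) = (z ^ (q ^ i)) ^ q" for z :: 'f
    by (simp add: mult.commute flip: power_mult)
  show ?case unfolding * Suc by (rule frob_add)
qed simp

lemma zero_pow_q [simp]: "(0 :: 'f) ^ (q ^ i) = 0"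
  using q_pos by simp

lemma frob_pow_minus: "(- x :: 'f) ^ (q ^ i) = - (x ^ (q ^ i))"
  by (rule minus_unique[symmetric]) (simp flip: frob_pow_add)

lemma frob_pow_diff: "(x - y :: 'f) ^ (q ^ i) = x ^ (q ^ i) - y ^ (q ^ i)"
  using frob_pow_add[of x "- y" i] by (simp add: frob_pow_minus)

lemma frob_pow_sum: "(\<Sum>x\<in>S. h x :: 'f) ^ (q ^ i) = (\<Sum>x\<in>S. h x ^ (q ^ i))"
  by (induction S rule: infinite_finite_induct) (auto simp: frob_pow_add)

lemma frob_pow_inj: "(x :: 'f) ^ (q ^ i) = y ^ (q ^ i) \<Longrightarrow> x = y"
  using frob_pow_diff[of x y i] by simp

lemma fixed_points_finite: 
  assumes "m > 1"
  shows "finite {x :: 'f. x ^ m = x}" "card {x :: 'f. x ^ m = x} \<le> m"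
proof -
  let ?P = "monom 1 m - monom 1 1 :: 'f poly"
  have deg: "degree ?P \<le> m"
    using assms by (intro degree_diff_le) (auto simp: degree_monom_eq)
  have "coeff ?P m = 1" using assms by simp
  hence nz: "?P \<noteq> 0" by (metis coeff_0 zero_neq_one)
  have eq: "{x. poly ?P x = 0} = {x. x ^ m = x}" by (simp add: poly_monom)
  show "finite {x :: 'f. x ^ m = x}" using poly_roots_finite[OF nz] by (simp only: eq)
  show "card {x :: 'f. x ^ m = x} \<le> m"
    using card_poly_roots_bound[OF nz] deg by (simp only: eq)
qed

lemma fixed_points_eq_range: "{x :: 'f. x ^ q = x} = range \<kappa>"
proof -
  have sub: "range \<kappa> \<subseteq> {x. x ^ q = x}" using kappa_power_q[of _ 1] by auto
  have "inj \<kappa>" by (intro injI) (metis kappa_diff kappa_eq_0_iff eq_iff_diff_eq_0)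
  hence "card (range \<kappa>) = q" by (simp add: card_image q_eq)
  thus ?thesis
    using card_seteq[OF fixed_points_finite(1) sub] fixed_points_finite(2)[of q] q_ge_2 by simp
qed

subsection \<open>Twisted polynomials\<close>

lemma coeff_tm: "coeff (u \<star>\<^bsub>q\<^esub> v) n = (\<Sum>i\<le>n. coeff u i * coeff v (n - i) ^ (q ^ i))"
  using q_pos by (rule coeff_twisted_mult)

lemma tm_add_left: "(u + v) \<star>\<^bsub>q\<^esub> w = u \<star>\<^bsub>q\<^esub> w + (v :: 'f poly) \<star>\<^bsub>q\<^esub> w"
  by (rule poly_eqI) (simp add: coeff_tm algebra_simps sum.distrib)

lemma tm_add_right: "w \<star>\<^bsub>q\<^esub> (u + v) = w \<star>\<^bsub>q\<^esub> u + w \<star>\<^bsub>q\<^esub> (v :: 'f poly)"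
  by (rule poly_eqI) (simp add: coeff_tm frob_pow_add algebra_simps sum.distrib)

lemma tm_0_left [simp]: "0 \<star>\<^bsub>q\<^esub> w = (0 :: 'f poly)"
  by (rule poly_eqI) (simp add: coeff_tm)

lemma tm_0_right [simp]: "w \<star>\<^bsub>q\<^esub> 0 = (0 :: 'f poly)"
  by (rule poly_eqI) (simp add: coeff_tm)

lemma tm_minus_left: "(- u) \<star>\<^bsub>q\<^esub> w = - ((u :: 'f poly) \<star>\<^bsub>q\<^esub> w)"
  by (rule minus_unique[symmetric]) (simp flip: tm_add_left)

lemma tm_minus_right: "w \<star>\<^bsub>q\<^esub> (- u) = - (w \<star>\<^bsub>q\<^esub> (u :: 'f poly))"
  by (rule minus_unique[symmetric]) (simp flip: tm_add_right)

lemma tm_diff_left: "(u - v) \<star>\<^bsub>q\<^esub> w = u \<star>\<^bsub>q\<^esub> w - (v :: 'f poly) \<star>\<^bsub>q\<^esub> w"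
  using tm_add_left[of u "- v" w] by (simp add: tm_minus_left)

lemma tm_diff_right: "w \<star>\<^bsub>q\<^esub> (u - v) = w \<star>\<^bsub>q\<^esub> u - w \<star>\<^bsub>q\<^esub> (v :: 'f poly)"
  using tm_add_right[of w u "- v"] by (simp add: tm_minus_right)

lemma tm_const_left: "[:c:] \<star>\<^bsub>q\<^esub> u = smult c (u :: 'f poly)"
proof (rule poly_eqI)
  fix n
  have "coeff ([:c:] \<star>\<^bsub>q\<^esub> u) n = (\<Sum>i\<in>{0}. coeff [:c:] i * coeff u (n - i) ^ (q ^ i))"
    unfolding coeff_tm by (rule sum.mono_neutral_right) (auto simp: coeff_pCons split: nat.splits)
  thus "coeff ([:c:] \<star>\<^bsub>q\<^esub> u) n = coeff (smult c u) n" by simp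
qed

lemma coeff_tm_monom_right:
  "coeff ((u :: 'f poly) \<star>\<^bsub>q\<^esub> monom c k) n = (if k \<le> n then coeff u (n - k) * c ^ (q ^ (n - k)) else 0)"
proof (cases "k \<le> n")
  case True
  have "coeff (u \<star>\<^bsub>q\<^esub> monom c k) n = (\<Sum>i\<in>{n - k}. coeff u i * coeff (monom c k) (n - i) ^ (q ^ i))"
    unfolding coeff_tm using True q_pos by (intro sum.mono_neutral_right) (auto simp: coeff_monom)
  thus ?thesis using True by simp
next
  case False
  have "coeff (u \<star>\<^bsub>q\<^esub> monom c k) n = 0"
    unfolding coeff_tm using False q_pos by (intro sum.neutral) (auto simp: coeff_monom)
  thus ?thesis using False by simp
qed

lemma tm_const_right: "coeff ((u :: 'f poly) \<star>\<^bsub>q\<^esub> [:c:]) n = coeff u n * c ^ (q ^ n)"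
  using coeff_tm_monom_right[of u c 0 n] by (simp add: monom_0)

lemma tm_kappa_commute: "(u :: 'f poly) \<star>\<^bsub>q\<^esub> [:\<kappa> c:] = [:\<kappa> c:] \<star>\<^bsub>q\<^esub> u"
  by (rule poly_eqI) (simp add: tm_const_right tm_const_left kappa_power_q)

lemma tm_1_left [simp]: "1 \<star>\<^bsub>q\<^esub> u = (u :: 'f poly)"
  unfolding one_pCons by (subst tm_const_left) simp

lemma tm_1_right [simp]: "u \<star>\<^bsub>q\<^esub> 1 = (u :: 'f poly)"
  using tm_kappa_commute[of u 1] tm_1_left[of u] unfolding kappa_1 one_pCons by simp

lemma tm_assoc: "((u :: 'f poly) \<star>\<^bsub>q\<^esub> v) \<star>\<^bsub>q\<^esub> w = u \<star>\<^bsub>q\<^esub> (v \<star>\<^bsub>q\<^esub> w)"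
proof (rule poly_eqI)
  fix n
  define t where "t i j = coeff u j * coeff v (i - j) ^ (q ^ j) * coeff w (n - i) ^ (q ^ i)" for i j
  have "coeff ((u \<star>\<^bsub>q\<^esub> v) \<star>\<^bsub>q\<^esub> w) n = (\<Sum>i\<le>n. \<Sum>j\<le>i. t i j)"
    unfolding coeff_tm t_def sum_distrib_right ..
  also have "\<dots> = (\<Sum>(i, j)\<in>(SIGMA i:{..n}. {..i}). t i j)"
    by (rule sum.Sigma) auto
  also have "\<dots> = (\<Sum>(j, i)\<in>(SIGMA j:{..n}. {..n - j}). t (i + j) j)"
    by (rule sum.reindex_bij_witness[of _ "\<lambda>(j, i). (i + j, j)" "\<lambda>(i, j). (j, i - j)"]) auto
  also have "\<dots> = (\<Sum>j\<le>n. \<Sum>i\<le>n - j. t (i + j) j)"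
    by (rule sum.Sigma[symmetric]) auto
  also have "\<dots> = (\<Sum>j\<le>n. coeff u j * (\<Sum>i\<le>n - j. coeff v i * coeff w (n - j - i) ^ (q ^ i)) ^ (q ^ j))"
    unfolding t_def frob_pow_sum sum_distrib_left
    by (intro sum.cong refl) (auto simp: power_mult_distrib power_add ac_simps simp flip: power_mult)
  also have "\<dots> = coeff (u \<star>\<^bsub>q\<^esub> (v \<star>\<^bsub>q\<^esub> w)) n"
    unfolding coeff_tm ..
  finally show "coeff ((u \<star>\<^bsub>q\<^esub> v) \<star>\<^bsub>q\<^esub> w) n = coeff (u \<star>\<^bsub>q\<^esub> (v \<star>\<^bsub>q\<^esub> w)) n" .
qed

text \<open>Divisibility by \<open>\<tau>\<^sup>k\<close> is a predicate of its own, besides the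
  order \<open>tord\<close>, because the order of the zero polynomial is an arbitrary
  number.\<close>

definition low :: "nat \<Rightarrow> 'f poly \<Rightarrow> bool"
  where "low k u \<longleftrightarrow> (\<forall>i<k. coeff u i = 0)"

definition tord :: "'f poly \<Rightarrow> nat"
  where "tord u = (LEAST n. coeff u n \<noteq> 0)"

lemma low_add: "low k u \<Longrightarrow> low k v \<Longrightarrow> low k (u + v)"
  by (simp add: low_def)

lemma low_diff: "low k u \<Longrightarrow> low k v \<Longrightarrow> low k (u - v)"
  by (simp add: low_def)

lemma low_0 [simp]: "low 0 u" "low k 0"
  by (simp_all add: low_def)

lemma low_mono: "low k u \<Longrightarrow> l \<le> k \<Longrightarrow> low l u"
  by (simp add: low_def)

lemma low_Suc: "low (Suc k) u \<longleftrightarrow> low k u \<and> coeff u k = 0"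
  by (auto simp: low_def less_Suc_eq)

lemma coeff_tord: "u \<noteq> 0 \<Longrightarrow> coeff u (tord u) \<noteq> 0"
  unfolding tord_def by (rule LeastI_ex) (metis leading_coeff_0_iff)

lemma low_tord: "low (tord u) u"
  unfolding low_def tord_def using not_less_Least by blast

lemma low_le_tord: "u \<noteq> 0 \<Longrightarrow> low k u \<Longrightarrow> k \<le> tord u"
  using coeff_tord[of u] unfolding low_def by (meson not_le)

lemma tord_eqI: "low k u \<Longrightarrow> coeff u k \<noteq> 0 \<Longrightarrow> tord u = k"
  unfolding tord_def low_def by (intro Least_equality) (auto intro: leI)

lemma tord_le_degree: "u \<noteq> 0 \<Longrightarrow> tord u \<le> degree u"
  using coeff_tord[of u] by (rule le_degree)

lemma low_gt_degree: "low k u \<Longrightarrow> degree u < k \<Longrightarrow> u = 0"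
  unfolding low_def by (metis leading_coeff_0_iff)

lemma coeff_tm_low:
  assumes "low a u" "low b v"
  shows "low (a + b) (u \<star>\<^bsub>q\<^esub> v)" and "coeff (u \<star>\<^bsub>q\<^esub> v) (a + b) = coeff u a * coeff v b ^ (q ^ a)"
proof -
  show "low (a + b) (u \<star>\<^bsub>q\<^esub> v)"
    unfolding low_def
  proof (intro allI impI)
    fix n assume n: "n < a + b"
    have "coeff u i * coeff v (n - i) ^ (q ^ i) = 0" if "i \<le> n" for i
    proof (cases "i < a")
      case False
      hence "n - i < b" using n that by linarith
      thus ?thesis using assms(2) by (simp add: low_def)
    qed (use assms(1) in \<open>simp add: low_def\<close>)
    thus "coeff (u \<star>\<^bsub>q\<^esub> v) n = 0" unfolding coeff_tm by (intro sum.neutral ballI) (simp only: atMost_iff)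
  qed
  have "coeff (u \<star>\<^bsub>q\<^esub> v) (a + b) = (\<Sum>i\<in>{a}. coeff u i * coeff v (a + b - i) ^ (q ^ i))"
    unfolding coeff_tm
  proof (rule sum.mono_neutral_right)
    show "\<forall>i\<in>{..a + b} - {a}. coeff u i * coeff v (a + b - i) ^ (q ^ i) = 0"
    proof
      fix i assume i: "i \<in> {..a + b} - {a}"
      show "coeff u i * coeff v (a + b - i) ^ (q ^ i) = 0"
      proof (cases "i < a")
        case False
        hence "a + b - i < b" using i by auto
        thus ?thesis using assms(2) by (simp add: low_def)
      qed (use assms(1) in \<open>simp add: low_def\<close>)
    qed
  qed auto
  thus "coeff (u \<star>\<^bsub>q\<^esub> v) (a + b) = coeff u a * coeff v b ^ (q ^ a)" by simp
qed

lemma coeff_tm_high: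
  assumes "degree u \<le> a" "degree v \<le> b"
  shows "degree (u \<star>\<^bsub>q\<^esub> v) \<le> a + b" and "coeff (u \<star>\<^bsub>q\<^esub> v) (a + b) = coeff u a * (coeff v b :: 'f) ^ (q ^ a)"
proof -
  show "degree (u \<star>\<^bsub>q\<^esub> v) \<le> a + b"
  proof (rule degree_le, intro allI impI)
    fix n assume n: "a + b < n"
    have "coeff u i * coeff v (n - i) ^ (q ^ i) = 0" if "i \<le> n" for i
    proof (cases "i > a")
      case False
      hence "n - i > b" using n that by linarith
      thus ?thesis using assms(2) by (simp add: coeff_eq_0)
    qed (use assms(1) in \<open>simp add: coeff_eq_0\<close>)
    thus "coeff (u \<star>\<^bsub>q\<^esub> v) n = 0" unfolding coeff_tm by (intro sum.neutral ballI) (simp only: atMost_iff)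
  qed
  have "coeff (u \<star>\<^bsub>q\<^esub> v) (a + b) = (\<Sum>i\<in>{a}. coeff u i * coeff v (a + b - i) ^ (q ^ i))"
    unfolding coeff_tm
  proof (rule sum.mono_neutral_right)
    show "\<forall>i\<in>{..a + b} - {a}. coeff u i * coeff v (a + b - i) ^ (q ^ i) = 0"
    proof
      fix i assume i: "i \<in> {..a + b} - {a}"
      show "coeff u i * coeff v (a + b - i) ^ (q ^ i) = 0"
      proof (cases "i > a")
        case False
        hence "a + b - i > b" using i by auto
        thus ?thesis using assms(2) by (simp add: coeff_eq_0)
      qed (use assms(1) in \<open>simp add: coeff_eq_0\<close>)
    qed
  qed auto
  thus "coeff (u \<star>\<^bsub>q\<^esub> v) (a + b) = coeff u a * coeff v b ^ (q ^ a)" by simp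
qed

lemma tm_nonzero:
  assumes "u \<noteq> 0" "v \<noteq> (0 :: 'f poly)"
  shows "u \<star>\<^bsub>q\<^esub> v \<noteq> 0" "degree (u \<star>\<^bsub>q\<^esub> v) = degree u + degree v"
    "lead_coeff (u \<star>\<^bsub>q\<^esub> v) = lead_coeff u * lead_coeff v ^ (q ^ degree u)"
    "tord (u \<star>\<^bsub>q\<^esub> v) = tord u + tord v"
proof -
  note H = coeff_tm_high[of u "degree u" v "degree v"]
  have nz: "coeff (u \<star>\<^bsub>q\<^esub> v) (degree u + degree v) \<noteq> 0" using H assms by simp
  show 1: "u \<star>\<^bsub>q\<^esub> v \<noteq> 0" using nz by (metis coeff_0)
  show deg: "degree (u \<star>\<^bsub>q\<^esub> v) = degree u + degree v"
    using H(1) le_degree[OF nz] by simp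
  show "lead_coeff (u \<star>\<^bsub>q\<^esub> v) = lead_coeff u * lead_coeff v ^ (q ^ degree u)"
    using H(2) by (simp add: deg)
  show "tord (u \<star>\<^bsub>q\<^esub> v) = tord u + tord v"
    using coeff_tm_low[OF low_tord[of u] low_tord[of v]] coeff_tord assms by (intro tord_eqI) auto
qed

lemma tm_eq_0_iff: "u \<star>\<^bsub>q\<^esub> v = 0 \<longleftrightarrow> u = 0 \<or> v = (0 :: 'f poly)"
  using tm_nonzero(1) by auto

lemma tm_right_cancel: "u \<star>\<^bsub>q\<^esub> w = v \<star>\<^bsub>q\<^esub> w \<Longrightarrow> w \<noteq> 0 \<Longrightarrow> u = (v :: 'f poly)"
  using tm_eq_0_iff[of "u - v" w] by (simp add: tm_diff_left)

text \<open>A right factor \<open>\<tau>\<^sup>k\<close> can be split off by shifting the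
  coefficients; only a left factor would need \<open>q\<close>-th roots. This is what makes order
  of vanishing control divisibility.\<close>

lemma tm_monom_divides:
  assumes "low k u" "c \<noteq> 0"
  obtains y where "u = y \<star>\<^bsub>q\<^esub> monom c k"
proof
  define y where "y = poly_of_coeffs (degree u) (\<lambda>i. coeff u (i + k) / c ^ (q ^ i))"
  show "u = y \<star>\<^bsub>q\<^esub> monom c k"
  proof (rule poly_eqI)
    fix n
    show "coeff u n = coeff (y \<star>\<^bsub>q\<^esub> monom c k) n"
      using assms by (auto simp: coeff_tm_monom_right y_def coeff_poly_of_coeffs low_def not_le coeff_eq_0)
  qed
qed

subsection \<open>The module structure defined by the image of \<open>T\<close>\<close>

text \<open>Horner's scheme for the ring homomorphism from \<open>A\<close> to twisted polynomials
  with \<open>T \<mapsto> \<phi>\<close>, that is, for the Drinfeld module defined by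
  \<open>\<phi>\<close>.\<close>

definition dmod :: "'f poly \<Rightarrow> 'q poly \<Rightarrow> 'f poly"
  where "dmod \<phi> a = fold_coeffs (\<lambda>c u. [:\<kappa> c:] + \<phi> \<star>\<^bsub>q\<^esub> u) a 0"

lemma dmod_0 [simp]: "dmod \<phi> 0 = 0"
  by (simp add: dmod_def)

lemma dmod_pCons: "dmod \<phi> (pCons c a) = [:\<kappa> c:] + \<phi> \<star>\<^bsub>q\<^esub> dmod \<phi> a"
  by (cases "c = 0 \<and> a = 0") (auto simp: dmod_def kappa_0)

lemma dmod_const: "dmod \<phi> [:c:] = [:\<kappa> c:]"
  by (simp add: dmod_pCons)

lemma dmod_1 [simp]: "dmod \<phi> 1 = 1"
  using dmod_const[of \<phi> 1] unfolding kappa_1 one_pCons .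

lemma dmod_add: "dmod \<phi> (a + b) = dmod \<phi> a + dmod \<phi> b"
proof (induction a b rule: poly_induct2)
  case (pCons c a d b)
  thus ?case by (simp add: dmod_pCons kappa_add tm_add_right)
qed simp

lemma dmod_minus: "dmod \<phi> (- a) = - dmod \<phi> a"
  by (rule minus_unique[symmetric]) (simp flip: dmod_add)

lemma dmod_diff: "dmod \<phi> (a - b) = dmod \<phi> a - dmod \<phi> b"
  using dmod_add[of \<phi> a "- b"] by (simp add: dmod_minus)

lemma dmod_commute:
  assumes "u \<star>\<^bsub>q\<^esub> \<phi> = \<phi> \<star>\<^bsub>q\<^esub> u"
  shows "u \<star>\<^bsub>q\<^esub> dmod \<phi> a = dmod \<phi> a \<star>\<^bsub>q\<^esub> u"
proof (induction a)
  case (pCons c a)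
  have "u \<star>\<^bsub>q\<^esub> dmod \<phi> (pCons c a) = [:\<kappa> c:] \<star>\<^bsub>q\<^esub> u + (u \<star>\<^bsub>q\<^esub> \<phi>) \<star>\<^bsub>q\<^esub> dmod \<phi> a"
    by (simp add: dmod_pCons tm_add_right tm_kappa_commute tm_assoc)
  also have "\<dots> = dmod \<phi> (pCons c a) \<star>\<^bsub>q\<^esub> u"
    by (simp add: assms dmod_pCons tm_add_left tm_assoc pCons(2))
  finally show ?case .
qed simp

lemma dmod_commute_self: "\<phi> \<star>\<^bsub>q\<^esub> dmod \<phi> a = dmod \<phi> a \<star>\<^bsub>q\<^esub> \<phi>"
  by (rule dmod_commute) simp

lemma dmod_smult: "dmod \<phi> (smult c a) = [:\<kappa> c:] \<star>\<^bsub>q\<^esub> dmod \<phi> a"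
proof (induction a)
  case (pCons d a)
  have "\<phi> \<star>\<^bsub>q\<^esub> ([:\<kappa> c:] \<star>\<^bsub>q\<^esub> dmod \<phi> a) = [:\<kappa> c:] \<star>\<^bsub>q\<^esub> (\<phi> \<star>\<^bsub>q\<^esub> dmod \<phi> a)"
    by (metis tm_assoc tm_kappa_commute)
  thus ?case by (simp add: dmod_pCons pCons tm_add_right) (simp add: tm_const_left kappa_mult)
qed simp

lemma dmod_mult: "dmod \<phi> (a * b) = dmod \<phi> a \<star>\<^bsub>q\<^esub> dmod \<phi> b"
proof (induction a)
  case (pCons c a)
  have "dmod \<phi> (pCons c a * b) = dmod \<phi> (smult c b + pCons 0 (a * b))" by simp
  also have "\<dots> = dmod \<phi> (pCons c a) \<star>\<^bsub>q\<^esub> dmod \<phi> b"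
    by (simp only: dmod_add dmod_pCons dmod_smult pCons kappa_0 tm_add_left tm_assoc) simp
  finally show ?case .
qed simp

lemma coeff_tm_0: "coeff (u \<star>\<^bsub>q\<^esub> v) 0 = coeff u 0 * (coeff v 0 :: 'f)"
  by (simp add: coeff_tm)

lemma coeff_dmod_0: "coeff (dmod \<phi> a) 0 = poly (map_poly \<kappa> a) (coeff \<phi> 0)"
  by (induction a) (simp_all add: dmod_pCons coeff_tm_0 map_poly_pCons kappa_0)

lemma dmod_degree:
  assumes "degree \<phi> > 0" "lead_coeff \<phi> = 1" "a \<noteq> 0"
  shows "dmod \<phi> a \<noteq> 0 \<and> degree (dmod \<phi> a) = degree \<phi> * degree a \<and> lead_coeff (dmod \<phi> a) = \<kappa> (lead_coeff a)"
  using assms(3)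
proof (induction a)
  case (pCons c a)
  have phi: "\<phi> \<noteq> 0" using assms(1) by auto
  show ?case
  proof (cases "a = 0")
    case True
    thus ?thesis using pCons by (simp add: dmod_pCons kappa_eq_0_iff)
  next
    case False
    hence IH: "dmod \<phi> a \<noteq> 0" "degree (dmod \<phi> a) = degree \<phi> * degree a" "lead_coeff (dmod \<phi> a) = \<kappa> (lead_coeff a)"
      using pCons by auto
    have H: "degree (\<phi> \<star>\<^bsub>q\<^esub> dmod \<phi> a) = degree \<phi> + degree (dmod \<phi> a)"
      "lead_coeff (\<phi> \<star>\<^bsub>q\<^esub> dmod \<phi> a) = \<kappa> (lead_coeff a)"
      using tm_nonzero[OF phi IH(1)] IH assms(2) by (simp_all add: kappa_power_q)
    have lt: "degree [:\<kappa> c:] < degree (\<phi> \<star>\<^bsub>q\<^esub> dmod \<phi> a)"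
      using H(1) assms(1) by simp
    have "degree (dmod \<phi> (pCons c a)) = degree (\<phi> \<star>\<^bsub>q\<^esub> dmod \<phi> a)"
      "lead_coeff (dmod \<phi> (pCons c a)) = lead_coeff (\<phi> \<star>\<^bsub>q\<^esub> dmod \<phi> a)"
      unfolding dmod_pCons using degree_add_eq_right[OF lt] lead_coeff_add_le[OF lt] by auto
    moreover have "degree (dmod \<phi> (pCons c a)) > 0" using calculation H(1) assms(1) by simp
    ultimately show ?thesis using H IH False by auto
  qed
qed simp

end

section \<open>Extension of homomorphisms to places\<close>

locale partial_hom =
  fixes V :: "'c::field set" and f :: "'c \<Rightarrow> 'r::field"
  assumes V_1: "1 \<in> V"
    and V_diff: "x \<in> V \<Longrightarrow> y \<in> V \<Longrightarrow> x - y \<in> V"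
    and V_mult: "x \<in> V \<Longrightarrow> y \<in> V \<Longrightarrow> x * y \<in> V"
    and f_1: "f 1 = 1"
    and f_diff: "x \<in> V \<Longrightarrow> y \<in> V \<Longrightarrow> f (x - y) = f x - f y"
    and f_mult: "x \<in> V \<Longrightarrow> y \<in> V \<Longrightarrow> f (x * y) = f x * f y"
begin

lemma V_0: "0 \<in> V" using V_diff[OF V_1 V_1] by simp

lemma f_0: "f 0 = 0" using f_diff[OF V_1 V_1] by simp

lemma V_minus: "x \<in> V \<Longrightarrow> - x \<in> V" using V_diff[OF V_0] by fastforce

lemma f_minus: "x \<in> V \<Longrightarrow> f (- x) = - f x" using f_diff[OF V_0, of x] by (simp add: f_0)

lemma V_add: "x \<in> V \<Longrightarrow> y \<in> V \<Longrightarrow> x + y \<in> V" using V_diff[of x "- y"] V_minus by simp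

lemma f_add: "x \<in> V \<Longrightarrow> y \<in> V \<Longrightarrow> f (x + y) = f x + f y"
  using f_diff[of x "- y"] V_minus f_minus by simp

lemma V_sum: "(\<And>i. i \<in> I \<Longrightarrow> h i \<in> V) \<Longrightarrow> sum h I \<in> V"
  by (induction I rule: infinite_finite_induct) (auto simp: V_0 V_add)

lemma f_sum: "(\<And>i. i \<in> I \<Longrightarrow> h i \<in> V) \<Longrightarrow> f (sum h I) = (\<Sum>i\<in>I. f (h i))"
  by (induction I rule: infinite_finite_induct) (auto simp: f_0 f_add V_sum)

lemma V_power: "x \<in> V \<Longrightarrow> x ^ n \<in> V"
  by (induction n) (auto simp: V_1 V_mult)

lemma f_power: "x \<in> V \<Longrightarrow> f (x ^ n) = f x ^ n"
  by (induction n) (auto simp: f_1 f_mult V_power)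

lemma f_nonzero: "f x \<noteq> 0 \<Longrightarrow> x \<noteq> 0"
  using f_0 by auto

definition VX :: "'c poly set"
  where "VX = {P. \<forall>i. coeff P i \<in> V}"

lemma VX_coeff: "P \<in> VX \<Longrightarrow> coeff P i \<in> V" by (simp add: VX_def)

lemma VX_0: "0 \<in> VX" by (simp add: VX_def V_0)

lemma VX_pCons: "pCons a P \<in> VX \<longleftrightarrow> a \<in> V \<and> P \<in> VX"
  by (force simp: VX_def coeff_pCons split: nat.splits)

lemma VX_add: "P \<in> VX \<Longrightarrow> Q \<in> VX \<Longrightarrow> P + Q \<in> VX"
  and VX_diff: "P \<in> VX \<Longrightarrow> Q \<in> VX \<Longrightarrow> P - Q \<in> VX"
  by (simp_all add: VX_def V_add V_diff)

lemma VX_mult: "P \<in> VX \<Longrightarrow> Q \<in> VX \<Longrightarrow> P * Q \<in> VX"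
  by (simp add: VX_def coeff_mult V_sum V_mult)

lemma VX_monom: "a \<in> V \<Longrightarrow> monom a n \<in> VX"
  by (simp add: VX_def V_0)

abbreviation red :: "'c poly \<Rightarrow> 'r poly" where "red \<equiv> map_poly f"

lemma coeff_red: "coeff (red P) i = f (coeff P i)"
  by (simp add: coeff_map_poly f_0)

lemma red_add: "P \<in> VX \<Longrightarrow> Q \<in> VX \<Longrightarrow> red (P + Q) = red P + red Q"
  and red_diff: "P \<in> VX \<Longrightarrow> Q \<in> VX \<Longrightarrow> red (P - Q) = red P - red Q"
  by (rule poly_eqI; simp add: coeff_red VX_def f_add f_diff)+

lemma red_mult: "P \<in> VX \<Longrightarrow> Q \<in> VX \<Longrightarrow> red (P * Q) = red P * red Q"
  by (rule poly_eqI) (simp add: coeff_red coeff_mult VX_def f_sum f_mult V_mult)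

lemma red_monom: "red (monom a n) = monom (f a) n"
  by (rule poly_eqI) (simp add: coeff_red f_0)

lemma red_pCons: "red (pCons a P) = pCons (f a) (red P)"
  by (rule poly_eqI) (simp add: coeff_red coeff_pCons split: nat.splits)

text \<open>Any possible image of \<open>x\<close> under an extension of \<open>f\<close> is a
  common zero of these polynomials.\<close>

definition relations :: "'c \<Rightarrow> 'r poly set"
  where "relations x = {red P |P. P \<in> VX \<and> poly P x = 0}"

text \<open>Division by \<open>G\<close> needs the inverse of its leading coefficient inside the
  residue ring; this inverse is a power of the coefficient, which is a root of unity.\<close>

lemma relations_principal:
  assumes unity: "\<And>a :: 'r. a \<noteq> 0 \<Longrightarrow> \<exists>N>0. a ^ N = 1"
    and G: "G \<in> relations x" "G \<noteq> 0" and min: "\<And>H. H \<in> relations x \<Longrightarrow> H \<noteq> 0 \<Longrightarrow> degree G \<le> degree H"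
    and H: "H \<in> relations x"
  shows "G dvd H"
  using H
proof (induction "degree H" arbitrary: H rule: less_induct)
  case (less H)
  show ?case
  proof (cases "H = 0")
    case False
    obtain P where P: "P \<in> VX" "poly P x = 0" "G = red P" using G(1) by (auto simp: relations_def)
    obtain Q where Q: "Q \<in> VX" "poly Q x = 0" "H = red Q" using less.prems by (auto simp: relations_def)
    let ?c = "lead_coeff H" and ?b = "lead_coeff G"
    obtain N where N: "N > 0" "?b ^ N = 1" using unity[of ?b] G(2) by auto
    define v where "v = coeff Q (degree H) * coeff P (degree G) ^ (N - 1)"
    have V: "coeff Q i \<in> V" "coeff P i \<in> V" for i using P Q by (auto simp: VX_def)
    have v: "v \<in> V" by (auto simp: v_def V_mult V_power V)
    have "f v = ?c * ?b ^ (N - 1)"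
      by (simp add: v_def f_mult f_power V V_power P(3) Q(3) coeff_red)
    hence fv: "f v * ?b = ?c" using N by (simp add: mult.assoc flip: power_Suc2)
    define n where "n = degree H - degree G"
    have n: "degree H = n + degree G" using min[OF less.prems False] by (simp add: n_def)
    define H' where "H' = H - monom (f v) n * G"
    have "H' = red (Q - monom v n * P)"
      using P Q v by (simp add: H'_def red_diff red_mult red_monom VX_mult VX_monom)
    hence H': "H' \<in> relations x"
      using P Q v unfolding relations_def
      by (intro CollectI exI[of _ "Q - monom v n * P"]) (simp add: VX_diff VX_mult VX_monom poly_monom)
    have "G dvd H'"
    proof (cases "H' = 0")
      case False
      have fv0: "f v \<noteq> 0" using fv \<open>H \<noteq> 0\<close> by auto
      have "coeff H' (degree H) = 0"
        using fv by (simp add: H'_def coeff_monom_mult n)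
      moreover have "degree H' \<le> degree H"
        unfolding H'_def using fv0 G(2)
        by (intro degree_diff_le) (auto simp: degree_mult_eq degree_monom_eq n)
      ultimately have "degree H' < degree H"
        using False by (metis le_neq_implies_less leading_coeff_0_iff)
      thus ?thesis using less.hyps H' by blast
    qed auto
    moreover have "H = H' + monom (f v) n * G" by (simp add: H'_def)
    ultimately show ?thesis by simp
  qed auto
qed

end

text \<open>Partial homomorphisms are represented by their graphs, so that extension is inclusion
  and Zorn's lemma applies. The last condition makes the graph single-valued.\<close>

definition hom_graph :: "('c::field \<times> 'r::field) set \<Rightarrow> bool"
  where "hom_graph G \<longleftrightarrow> (1, 1) \<in> G \<and>
    (\<forall>x a y b. (x, a) \<in> G \<longrightarrow> (y, b) \<in> G \<longrightarrow> (x - y, a - b) \<in> G \<and> (x * y, a * b) \<in> G) \<and>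
    (\<forall>a. (0, a) \<in> G \<longrightarrow> a = 0)"

lemma hom_graph_unique: "hom_graph G \<Longrightarrow> (x, a) \<in> G \<Longrightarrow> (x, b) \<in> G \<Longrightarrow> a = b"
  unfolding hom_graph_def by (metis eq_iff_diff_eq_0)

definition graph_hom :: "('c \<times> 'r) set \<Rightarrow> 'c \<Rightarrow> 'r"
  where "graph_hom G x = (THE a. (x, a) \<in> G)"

lemma hom_graph_partial_hom:
  fixes f
  assumes "hom_graph G"
  defines "f \<equiv> graph_hom G"
  shows "partial_hom (fst ` G) f" and "\<And>x. x \<in> fst ` G \<Longrightarrow> (x, f x) \<in> G"
    and "\<And>x a. (x, a) \<in> G \<Longrightarrow> f x = a"
proof -
  show f: "f x = a" if "(x, a) \<in> G" for x a
    unfolding f_def graph_hom_def using that hom_graph_unique[OF assms(1)] by blast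
  show in_G: "(x, f x) \<in> G" if "x \<in> fst ` G" for x
    using that f by force
  have D: "(x - y, f x - f y) \<in> G" "(x * y, f x * f y) \<in> G" if "x \<in> fst ` G" "y \<in> fst ` G" for x y
    using in_G[OF that(1)] in_G[OF that(2)] assms(1) by (auto simp: hom_graph_def)
  have 1: "(1, 1) \<in> G" using assms(1) by (simp add: hom_graph_def)
  show "partial_hom (fst ` G) f"
  proof
    fix x y assume xy: "x \<in> fst ` G" "y \<in> fst ` G"
    show "x - y \<in> fst ` G" "x * y \<in> fst ` G" using D[OF xy] by force+
    show "f (x - y) = f x - f y" "f (x * y) = f x * f y" using D[OF xy] f by blast+
  qed (use 1 f in force)+
qed

text \<open>A place in the sense of valuation theory: \<open>V\<close> is a valuation ring whose
  maximal ideal is the kernel of \<open>f\<close>.\<close>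

locale place = partial_hom +
  assumes inverse_unit: "x \<in> V \<Longrightarrow> f x \<noteq> 0 \<Longrightarrow> inverse x \<in> V"
    and not_in_V: "x \<notin> V \<Longrightarrow> inverse x \<in> V \<and> f (inverse x) = 0"

text \<open>When the relations contain no nonzero constant, a root \<open>\<xi>\<close> of a
  relation of least degree, which divides all the others, is a common zero, and \<open>x \<mapsto>
  \<xi>\<close> extends the homomorphism.\<close>

lemma maximal_hom_graph_contains:
  fixes G :: "('c::field \<times> 'r::alg_closed_field) set"
  assumes G: "hom_graph G" and max: "\<And>G'. hom_graph G' \<Longrightarrow> G \<subseteq> G' \<Longrightarrow> G' = G"
    and unity: "\<And>a :: 'r. a \<noteq> 0 \<Longrightarrow> \<exists>N>0. a ^ N = 1"
    and const: "\<And>H. H \<in> partial_hom.relations (fst ` G) (graph_hom G) x \<Longrightarrow> degree H = 0 \<Longrightarrow> H = 0"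
  shows "x \<in> fst ` G"
proof -
  define f where "f = graph_hom G"
  interpret partial_hom "fst ` G" f
    unfolding f_def by (rule hom_graph_partial_hom) (rule G)
  note GF = hom_graph_partial_hom[OF G, folded f_def]
  note const' = const[folded f_def]
  have "\<exists>\<xi>. \<forall>H\<in>relations x. poly H \<xi> = 0"
  proof (cases "\<exists>H\<in>relations x. H \<noteq> 0")
    case True
    then obtain G1 where "G1 \<in> relations x \<and> G1 \<noteq> 0" by blast
    from ex_has_least_nat[of "\<lambda>H. H \<in> relations x \<and> H \<noteq> 0", OF this, of degree] obtain G0 where
      G0: "G0 \<in> relations x" "G0 \<noteq> 0" "\<And>H. H \<in> relations x \<Longrightarrow> H \<noteq> 0 \<Longrightarrow> degree G0 \<le> degree H"
      by blast
    have "degree G0 > 0" using const'[of G0] G0 by auto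
    then obtain \<xi> where "poly G0 \<xi> = 0" using alg_closed_imp_poly_has_root by blast
    thus ?thesis using relations_principal[OF unity G0] by (metis dvd_def mult_zero_left poly_mult)
  next
    case False
    thus ?thesis by (intro exI[of _ 0] ballI) auto
  qed
  then obtain \<xi> where \<xi>: "\<And>P. P \<in> VX \<Longrightarrow> poly P x = 0 \<Longrightarrow> poly (red P) \<xi> = 0"
    unfolding relations_def by blast
  define G' where "G' = {(poly P x, poly (red P) \<xi>) |P. P \<in> VX}"
  have "hom_graph G'"
    unfolding hom_graph_def
  proof (intro conjI allI impI)
    show "(1, 1) \<in> G'"
      unfolding G'_def by (intro CollectI exI[of _ "[:1:]"]) (simp add: VX_pCons V_1 VX_0 red_pCons f_1)
    fix y a z b assume "(y, a) \<in> G'" "(z, b) \<in> G'"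
    then obtain P Q where P: "P \<in> VX" "y = poly P x" "a = poly (red P) \<xi>"
      and Q: "Q \<in> VX" "z = poly Q x" "b = poly (red Q) \<xi>" unfolding G'_def by blast
    show "(y - z, a - b) \<in> G'"
      unfolding G'_def using P Q by (intro CollectI exI[of _ "P - Q"]) (simp add: VX_diff red_diff)
    show "(y * z, a * b) \<in> G'"
      unfolding G'_def using P Q by (intro CollectI exI[of _ "P * Q"]) (simp add: VX_mult red_mult)
  qed (auto simp: G'_def \<xi>)
  moreover have "G \<subseteq> G'"
  proof clarify
    fix y a assume "(y, a) \<in> G"
    hence "f y = a" "y \<in> fst ` G" using GF by force+
    thus "(y, a) \<in> G'"
      unfolding G'_def by (intro CollectI exI[of _ "[:y:]"]) (simp add: VX_pCons VX_0 red_pCons)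
  qed
  ultimately have "G' = G" using max by blast
  moreover have "(x, \<xi>) \<in> G'"
    unfolding G'_def by (intro CollectI exI[of _ "[:0, 1:]"]) (simp add: VX_pCons V_1 V_0 VX_0 red_pCons f_1 f_0)
  ultimately show ?thesis by force
qed

context partial_hom
begin

text \<open>The only obstruction to extending \<open>f\<close> to \<open>x\<close> is that
  \<open>1\<close> is such a combination.\<close>

definition small_combinations :: "'c \<Rightarrow> nat \<Rightarrow> 'c set"
  where "small_combinations x n = {\<Sum>i\<le>n. a i * x ^ i |a. \<forall>i. a i \<in> V \<and> f (a i) = 0}"

lemma small_combinations_add:
  "y \<in> small_combinations x n \<Longrightarrow> z \<in> small_combinations x n \<Longrightarrow> y + z \<in> small_combinations x n"
proof -
  assume "y \<in> small_combinations x n" "z \<in> small_combinations x n"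
  then obtain a b where "y = (\<Sum>i\<le>n. a i * x ^ i)" "z = (\<Sum>i\<le>n. b i * x ^ i)"
    "\<forall>i. a i \<in> V \<and> f (a i) = 0" "\<forall>i. b i \<in> V \<and> f (b i) = 0"
    unfolding small_combinations_def by blast
  thus ?thesis unfolding small_combinations_def
    by (intro CollectI exI[of _ "\<lambda>i. a i + b i"]) (simp add: sum.distrib distrib_right V_add f_add)
qed

lemma small_combinations_single:
  "a \<in> V \<Longrightarrow> f a = 0 \<Longrightarrow> i \<le> n \<Longrightarrow> a * x ^ i \<in> small_combinations x n"
  unfolding small_combinations_def
  by (intro CollectI exI[of _ "\<lambda>j. if j = i then a else 0"])
    (auto simp: V_0 f_0 if_distrib[of "\<lambda>y. y * _"] cong: if_cong)

lemma small_combinations_sum: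
  "(\<And>i. i \<in> I \<Longrightarrow> h i \<in> small_combinations x n) \<Longrightarrow> sum h I \<in> small_combinations x n"
proof (induction I rule: infinite_finite_induct)
  case empty
  show ?case using small_combinations_single[OF V_0 f_0, of 0 n x] by simp
next
  case (infinite A)
  show ?case using infinite small_combinations_single[OF V_0 f_0, of 0 n x] by simp
qed (auto intro: small_combinations_add)

text \<open>The exchange step of Chevalley's argument: in the relation for \<open>1/x\<close> the
  coefficient \<open>1 - b 0\<close> is a unit, so this relation expresses the top power of
  \<open>x\<close> by lower ones.\<close>

lemma small_combinations_descend:
  assumes inv: "\<And>y. y \<in> V \<Longrightarrow> f y \<noteq> 0 \<Longrightarrow> inverse y \<in> V"
    and "x \<noteq> 0" "1 \<in> small_combinations x n" "1 \<in> small_combinations (inverse x) m" "m \<le> n" "n > 0"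
  shows "1 \<in> small_combinations x (n - 1)"
proof -
  obtain a where a: "1 = (\<Sum>i\<le>n. a i * x ^ i)" "\<And>i. a i \<in> V" "\<And>i. f (a i) = 0"
    using assms(3) unfolding small_combinations_def by blast
  obtain b where b: "1 = (\<Sum>i\<le>m. b i * inverse x ^ i)" "\<And>i. b i \<in> V" "\<And>i. f (b i) = 0"
    using assms(4) unfolding small_combinations_def by blast
  define u where "u = inverse (1 - b 0)"
  have unit: "1 - b 0 \<in> V" "f (1 - b 0) = 1" using b by (simp_all add: V_diff V_1 f_diff f_1)
  have u: "u \<in> V" using inv[OF unit(1)] unit(2) by (simp add: u_def)
  have "u * (1 - b 0) = 1" using f_nonzero[of "1 - b 0"] unit(2) by (simp add: u_def)
  moreover have "1 - b 0 = (\<Sum>j\<in>{1..m}. b j * inverse x ^ j)"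
  proof -
    have "{..m} = insert 0 {1..m}" by auto
    hence "(\<Sum>i\<le>m. b i * inverse x ^ i) = b 0 + (\<Sum>j\<in>{1..m}. b j * inverse x ^ j)" by simp
    thus ?thesis using b(1) by (metis add_diff_cancel_left')
  qed
  ultimately have "1 = (\<Sum>j\<in>{1..m}. u * b j * inverse x ^ j)"
    by (simp add: sum_distrib_left mult.assoc)
  hence "a n * x ^ n = (\<Sum>j\<in>{1..m}. a n * x ^ n * (u * b j * inverse x ^ j))"
    by (metis mult_1_right sum_distrib_left)
  also have "\<dots> = (\<Sum>j\<in>{1..m}. (a n * u * b j) * x ^ (n - j))"
    using assms(2,5) by (intro sum.cong refl) (simp add: power_diff divide_inverse power_inverse)
  also have "\<dots> \<in> small_combinations x (n - 1)"
    using a b u by (intro small_combinations_sum small_combinations_single) (auto simp: V_mult f_mult)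
  finally have "a n * x ^ n \<in> small_combinations x (n - 1)" .
  moreover have "(\<Sum>i<n. a i * x ^ i) \<in> small_combinations x (n - 1)"
    using a by (intro small_combinations_sum small_combinations_single) auto
  moreover have "1 = (\<Sum>i<n. a i * x ^ i) + a n * x ^ n"
    unfolding a(1) by (simp only: lessThan_Suc_atMost[symmetric] sum.lessThan_Suc)
  ultimately show ?thesis using small_combinations_add by metis
qed

text \<open>With both degrees minimal, the previous step lowers the larger of the two.\<close>

lemma small_combinations_contradiction:
  assumes inv: "\<And>y. y \<in> V \<Longrightarrow> f y \<noteq> 0 \<Longrightarrow> inverse y \<in> V"
    and x: "x \<noteq> 0" "1 \<in> small_combinations x n" "1 \<in> small_combinations (inverse x) m"
  shows False
proof -
  define n0 where "n0 = (LEAST n. 1 \<in> small_combinations x n)"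
  define m0 where "m0 = (LEAST m. 1 \<in> small_combinations (inverse x) m)"
  have n0: "1 \<in> small_combinations x n0" unfolding n0_def by (rule LeastI) (rule x)
  have m0: "1 \<in> small_combinations (inverse x) m0" unfolding m0_def by (rule LeastI) (rule x)
  have pos: "k > 0" if "1 \<in> small_combinations y k" for y k
  proof (rule ccontr)
    assume "\<not> k > 0"
    hence "k = 0" by simp
    then obtain a :: "nat \<Rightarrow> 'c" where a: "1 = (\<Sum>i\<le>0. a i * y ^ i)" "f (a 0) = 0"
      using \<open>1 \<in> small_combinations y k\<close> unfolding small_combinations_def by blast
    hence "a 0 = 1" by simp
    thus False using f_1 a(2) by simp
  qed
  show False
  proof (cases "m0 \<le> n0")
    case True
    hence "1 \<in> small_combinations x (n0 - 1)"
      using small_combinations_descend[OF inv x(1) n0 m0] pos[OF n0] by blast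
    hence "n0 \<le> n0 - 1" unfolding n0_def by (rule Least_le)
    thus False using pos[OF n0] by simp
  next
    case False
    hence "1 \<in> small_combinations (inverse x) (m0 - 1)"
      using small_combinations_descend[OF inv _ m0, of n0] n0 x(1) pos[OF m0] by simp
    hence "m0 \<le> m0 - 1" unfolding m0_def by (rule Least_le)
    thus False using pos[OF m0] by simp
  qed
qed

lemma constant_relation_imp_small_combination:
  assumes inv: "\<And>y. y \<in> V \<Longrightarrow> f y \<noteq> 0 \<Longrightarrow> inverse y \<in> V"
    and H: "H \<in> relations x" "degree H = 0" "H \<noteq> 0"
  obtains n where "1 \<in> small_combinations x n"
proof -
  obtain P where P: "P \<in> VX" "poly P x = 0" "H = red P" using H by (auto simp: relations_def)
  have f0: "f (coeff P i) = 0" if "i > 0" for i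
    using H(2) that coeff_eq_0[of H i] by (simp add: P coeff_red)
  have f1: "f (coeff P 0) \<noteq> 0"
    using H(2,3) by (metis P(3) coeff_red leading_coeff_0_iff)
  define u where "u = inverse (coeff P 0)"
  have u: "u \<in> V" "coeff P 0 \<noteq> 0"
    using inv[of "coeff P 0"] f1 P(1) f_nonzero by (auto simp: u_def VX_def)
  define n where "n = degree P"
  have "{..n} = insert 0 {1..n}" by auto
  hence "0 = coeff P 0 + (\<Sum>i\<in>{1..n}. coeff P i * x ^ i)"
    using P(2) by (simp add: poly_altdef n_def)
  hence "- coeff P 0 = (\<Sum>i\<in>{1..n}. coeff P i * x ^ i)"
    using minus_unique by metis
  hence "(- u) * (- coeff P 0) = (\<Sum>i\<in>{1..n}. (- u * coeff P i) * x ^ i)"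
    by (simp only: sum_distrib_left mult.assoc)
  hence "1 = (\<Sum>i\<in>{1..n}. (- u * coeff P i) * x ^ i)"
    using u by (simp add: u_def)
  also have "\<dots> \<in> small_combinations x n"
    using u P f0 by (intro small_combinations_sum small_combinations_single)
      (auto simp: V_mult V_minus f_mult f_minus VX_def)
  finally show ?thesis using that by blast
qed

text \<open>A unit causes no obstruction: multiplying a constant relation for \<open>1/x\<close>
  by a power of \<open>x\<close> would give a product of nonzero residues equal to zero.\<close>

lemma no_constant_relation_inverse:
  assumes x: "x \<in> V" "f x \<noteq> 0" and H: "H \<in> relations (inverse x)" "degree H = 0"
  shows "H = 0"
proof (rule ccontr)
  assume nz: "H \<noteq> 0"
  obtain P where P: "P \<in> VX" "poly P (inverse x) = 0" "H = red P" using H by (auto simp: relations_def)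
  define n where "n = degree P"
  have f0: "f (coeff P i) = 0" if "i > 0" for i
    using H(2) that coeff_eq_0[of H i] by (simp add: P coeff_red)
  have f1: "f (coeff P 0) \<noteq> 0"
    using H(2) nz by (metis P(3) coeff_red leading_coeff_0_iff)
  have x0: "x \<noteq> 0" using f_nonzero x by blast
  have "0 = x ^ n * poly P (inverse x)" using P by simp
  also have "\<dots> = (\<Sum>i\<le>n. coeff P i * x ^ (n - i))"
    unfolding poly_altdef n_def sum_distrib_left using x0
    by (intro sum.cong refl) (simp add: power_diff divide_inverse power_inverse)
  finally have "f 0 = f (\<Sum>i\<le>n. coeff P i * x ^ (n - i))" by (rule arg_cong)
  also have "\<dots> = (\<Sum>i\<le>n. f (coeff P i) * f x ^ (n - i))"
    using P(1) x by (subst f_sum) (auto simp: f_mult f_power V_mult V_power VX_def)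
  also have "\<dots> = (\<Sum>i\<in>{0}. f (coeff P i) * f x ^ (n - i))"
    by (rule sum.mono_neutral_right) (auto simp: f0)
  finally show False using f1 x by (simp add: f_0)
qed

end

text \<open>Chevalley's extension theorem. A maximal extension exists by Zorn's lemma, and every
  \<open>x\<close> or its inverse is in its domain because the obstructions for \<open>x\<close>
  and \<open>1/x\<close> exclude each other.\<close>

theorem place_extension:
  fixes G0 :: "('c::field \<times> 'r::alg_closed_field) set"
  assumes G0: "hom_graph G0" and unity: "\<And>a :: 'r. a \<noteq> 0 \<Longrightarrow> \<exists>N>0. a ^ N = 1"
  obtains V :: "'c set" and f :: "'c \<Rightarrow> 'r" where "place V f" "\<And>x a. (x, a) \<in> G0 \<Longrightarrow> x \<in> V \<and> f x = a"
proof -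
  define \<A> where "\<A> = {G :: ('c \<times> 'r) set. hom_graph G \<and> G0 \<subseteq> G}"
  have "\<exists>G\<in>\<A>. \<forall>Z\<in>\<A>. G \<subseteq> Z \<longrightarrow> Z = G"
  proof (rule subset_Zorn_nonempty)
    have "G0 \<in> \<A>" using G0 by (simp add: \<A>_def)
    thus "\<A> \<noteq> {}" by blast
    fix \<C> assume \<C>: "\<C> \<noteq> {}" "subset.chain \<A> \<C>"
    have sub: "\<C> \<subseteq> \<A>" and lin: "\<And>Z Z'. Z \<in> \<C> \<Longrightarrow> Z' \<in> \<C> \<Longrightarrow> Z \<subseteq> Z' \<or> Z' \<subseteq> Z"
      using \<C>(2) by (auto simp: subset_chain_def)
    have "hom_graph (\<Union>\<C>)"
      unfolding hom_graph_def
    proof (intro conjI allI impI)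
      obtain Z where "Z \<in> \<C>" using \<C>(1) by blast
      moreover from this have "(1, 1) \<in> Z" using sub by (auto simp: \<A>_def hom_graph_def)
      ultimately show "(1, 1) \<in> \<Union>\<C>" by blast
      fix x a y b assume "(x, a) \<in> \<Union>\<C>" "(y, b) \<in> \<Union>\<C>"
      then obtain Z where "Z \<in> \<C>" "(x, a) \<in> Z" "(y, b) \<in> Z" using lin by blast
      moreover from this have "hom_graph Z" using sub by (auto simp: \<A>_def)
      ultimately have "(x - y, a - b) \<in> Z" "(x * y, a * b) \<in> Z"
        by (simp_all add: hom_graph_def)
      thus "(x - y, a - b) \<in> \<Union>\<C>" "(x * y, a * b) \<in> \<Union>\<C>"
        using \<open>Z \<in> \<C>\<close> by blast+
    next
      fix a assume "(0, a) \<in> \<Union>\<C>"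
      then obtain Z where "Z \<in> \<C>" "(0, a) \<in> Z" by blast
      moreover from this have "hom_graph Z" using sub by (auto simp: \<A>_def)
      ultimately show "a = 0" by (simp add: hom_graph_def)
    qed
    moreover have "G0 \<subseteq> \<Union>\<C>" using \<C>(1) sub by (auto simp: \<A>_def)
    ultimately show "\<Union>\<C> \<in> \<A>" by (simp add: \<A>_def)
  qed
  then obtain G where "G \<in> \<A>" and G_max: "\<forall>Z\<in>\<A>. G \<subseteq> Z \<longrightarrow> Z = G" by blast
  hence G: "hom_graph G" "G0 \<subseteq> G" by (simp_all add: \<A>_def)
  have max: "Z = G" if "hom_graph Z" "G \<subseteq> Z" for Z
    using G_max G that by (simp add: \<A>_def)
  define f where "f = graph_hom G"
  interpret partial_hom "fst ` G" f
    unfolding f_def by (rule hom_graph_partial_hom) (rule G)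
  note GF = hom_graph_partial_hom[OF G(1), folded f_def]
  have contains: "x \<in> fst ` G" if "\<And>H. H \<in> relations x \<Longrightarrow> degree H = 0 \<Longrightarrow> H = 0" for x
  proof (rule maximal_hom_graph_contains[OF G(1)])
    show "G' = G" if "hom_graph G'" "G \<subseteq> G'" for G' using that by (rule max)
    show "\<exists>N>0. a ^ N = 1" if "a \<noteq> 0" for a :: 'r using that by (rule unity)
    show "H = 0" if "H \<in> partial_hom.relations (fst ` G) (graph_hom G) x" "degree H = 0" for H
      using that \<open>\<And>H. H \<in> relations x \<Longrightarrow> degree H = 0 \<Longrightarrow> H = 0\<close> unfolding f_def by blast
  qed
  have inv: "inverse x \<in> fst ` G" if "x \<in> fst ` G" "f x \<noteq> 0" for x
    by (rule contains) (rule no_constant_relation_inverse[OF that])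
  have small: "\<exists>n. 1 \<in> small_combinations x n" if x: "x \<notin> fst ` G" for x
  proof -
    obtain H where "H \<in> relations x" "degree H = 0" "H \<noteq> 0" using contains[of x] x by blast
    from constant_relation_imp_small_combination[OF inv this] show ?thesis by blast
  qed
  have place: "place (fst ` G) f"
  proof
    fix x assume x: "x \<notin> fst ` G"
    have x0: "x \<noteq> 0"
    proof
      assume "x = 0"
      thus False using x V_0 by blast
    qed
    have "inverse x \<in> fst ` G"
    proof (rule ccontr)
      assume "inverse x \<notin> fst ` G"
      then obtain n m where "1 \<in> small_combinations x n" "1 \<in> small_combinations (inverse x) m"
        using small x by blast
      thus False using small_combinations_contradiction[OF inv x0] by blast
    qed
    moreover from this have "f (inverse x) = 0" using inv[of "inverse x"] x by auto
    ultimately show "inverse x \<in> fst ` G \<and> f (inverse x) = 0" by blast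
  next
    show "inverse x \<in> fst ` G" if "x \<in> fst ` G" "f x \<noteq> 0" for x using that by (rule inv)
  qed
  have ext: "x \<in> fst ` G \<and> f x = a" if "(x, a) \<in> G0" for x a
    using that G(2) GF(3)[of x a] by (metis fst_conv image_eqI subsetD)
  show ?thesis using place ext by (rule that)
qed

section \<open>The residue field of a prime of A\<close>

lemma card_polys_bounded:
  "finite {a :: 'q::{field, finite} poly. \<forall>i\<ge>n. coeff a i = 0}"
  "card {a :: 'q poly. \<forall>i\<ge>n. coeff a i = 0} = CARD('q) ^ n"
proof (induction n)
  case 0
  have "{a :: 'q poly. \<forall>i\<ge>0. coeff a i = 0} = {0}" by (auto intro: poly_eqI)
  thus "finite {a :: 'q poly. \<forall>i\<ge>0. coeff a i = 0}"
    "card {a :: 'q poly. \<forall>i\<ge>0. coeff a i = 0} = CARD('q) ^ 0" by simp_all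
next
  case (Suc n)
  let ?P = "\<lambda>n. {a :: 'q poly. \<forall>i\<ge>n. coeff a i = 0}"
  have eq: "?P (Suc n) = (\<lambda>(c, a). pCons c a) ` (UNIV \<times> ?P n)"
  proof (intro equalityI subsetI)
    fix a assume a: "a \<in> ?P (Suc n)"
    obtain c b where ab: "a = pCons c b" by (cases a)
    have "coeff b i = 0" if "i \<ge> n" for i
      using a that spec[of "\<lambda>i. i \<ge> Suc n \<longrightarrow> coeff a i = 0" "Suc i"] by (simp add: ab)
    thus "a \<in> (\<lambda>(c, a). pCons c a) ` (UNIV \<times> ?P n)" using ab by auto
  next
    fix a assume "a \<in> (\<lambda>(c, a). pCons c a) ` (UNIV \<times> ?P n)"
    then obtain c b where "a = pCons c b" "\<forall>i\<ge>n. coeff b i = 0" by auto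
    thus "a \<in> ?P (Suc n)" by (auto simp: coeff_pCons split: nat.splits)
  qed
  have inj: "inj_on (\<lambda>(c, a). pCons c a) (UNIV \<times> ?P n)" by (auto intro!: inj_onI)
  show "finite (?P (Suc n))" unfolding eq using Suc(1) by simp
  show "card (?P (Suc n)) = CARD('q) ^ Suc n"
    unfolding eq card_image[OF inj] using Suc by (simp add: card_cartesian_product)
qed

text \<open>The prime \<open>\<pi>\<close> is given by the residue \<open>\<theta>\<close> of
  \<open>T\<close>, through the kernel of evaluation at \<open>\<theta>\<close>. Periodicity of
  Frobenius says that the residue field is algebraic over \<open>F\<^sub>q\<close>. The parameter
  \<open>g\<close> is the middle coefficient of the module \<open>\<theta> + g \<tau> +
  \<tau>\<^sup>2\<close>.\<close>

locale reduced_module = Fq_field q \<kappa>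
  for q :: nat and \<kappa> :: "'q::{field, finite} \<Rightarrow> 'f::field" +
  fixes \<theta> g :: 'f and \<pi> :: "'q poly"
  assumes pi_nz: "\<pi> \<noteq> 0"
    and eval_eq_0_iff: "poly (map_poly \<kappa> a) \<theta> = 0 \<longleftrightarrow> \<pi> dvd a"
    and frob_periodic: "\<exists>n>0. (x :: 'f) ^ (q ^ n) = x"
begin

abbreviation ev :: "'q poly \<Rightarrow> 'f" where "ev a \<equiv> poly (map_poly \<kappa> a) \<theta>"

definition d :: nat where "d = degree \<pi>"

lemma ev_add: "ev (a + b) = ev a + ev b"
proof -
  have "map_poly \<kappa> (a + b) = map_poly \<kappa> a + map_poly \<kappa> b"
    by (rule poly_eqI) (simp add: coeff_map_poly kappa_0 kappa_add)
  thus ?thesis by simp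
qed

lemma ev_pCons: "ev (pCons c a) = \<kappa> c + \<theta> * ev a"
  by (simp add: Polynomial.map_poly_pCons kappa_0)

lemma ev_smult: "ev (smult c a) = \<kappa> c * ev a"
  by (induction a) (simp_all add: ev_pCons kappa_mult algebra_simps)

lemma ev_mult: "ev (a * b) = ev a * ev b"
  by (induction a) (simp_all add: ev_pCons ev_add ev_smult kappa_0 algebra_simps)

lemma ev_1: "ev 1 = 1"
  using ev_pCons[of 1 0] by (simp add: kappa_1)

lemma ev_minus: "ev (- a) = - ev a"
  by (rule minus_unique[symmetric]) (simp flip: ev_add)

lemma ev_diff: "ev (a - b) = ev a - ev b"
  using ev_add[of a "- b"] by (simp add: ev_minus)

lemma ev_power_q: "ev a ^ (q ^ k) = poly (map_poly \<kappa> a) (\<theta> ^ (q ^ k))"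
  by (induction a) (simp_all add: map_poly_pCons kappa_0 frob_pow_add power_mult_distrib kappa_power_q)

lemma pi_prime: "\<pi> dvd a * b \<longleftrightarrow> \<pi> dvd a \<or> \<pi> dvd b"
  unfolding eval_eq_0_iff[symmetric] ev_mult by simp

lemma not_pi_dvd_1: "\<not> \<pi> dvd 1"
  unfolding eval_eq_0_iff[symmetric] ev_1 by simp

lemma d_pos: "d > 0"
proof (rule ccontr)
  assume "\<not> d > 0"
  hence "is_unit \<pi>" using pi_nz by (simp add: d_def is_unit_iff_degree)
  thus False using not_pi_dvd_1 by simp
qed

lemma bezout:
  assumes "\<not> \<pi> dvd a"
  obtains x y where "x * a + y * \<pi> = 1"
proof -
  define I where "I = {e. e \<noteq> 0 \<and> (\<exists>x y. e = x * a + y * \<pi>)}"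
  have II: "x * a + y * \<pi> \<in> I" if "x * a + y * \<pi> \<noteq> 0" for x y
    using that unfolding I_def mem_Collect_eq by (intro conjI exI[of _ x] exI[of _ y]) simp_all
  have "\<pi> \<in> I" using II[of 0 1] pi_nz by simp
  from ex_has_least_nat[of "\<lambda>e. e \<in> I", OF this, of degree] obtain e where
    e: "e \<in> I" and min: "\<And>e'. e' \<in> I \<Longrightarrow> degree e \<le> degree e'" by blast
  obtain x y where xy: "e = x * a + y * \<pi>" and e0: "e \<noteq> 0" using e by (auto simp: I_def)
  have dvd: "e dvd u * a + v * \<pi>" for u v
  proof (rule ccontr)
    assume not: "\<not> e dvd u * a + v * \<pi>"
    define r where "r = (u * a + v * \<pi>) mod e"
    define s where "s = (u * a + v * \<pi>) div e"
    have r0: "r \<noteq> 0" using not by (simp add: r_def dvd_eq_mod_eq_0)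
    have "r = u * a + v * \<pi> - s * e" by (simp add: r_def s_def minus_div_mult_eq_mod)
    also have "\<dots> = (u - s * x) * a + (v - s * y) * \<pi>" by (simp add: xy algebra_simps)
    finally have "r \<in> I" using r0 II by simp
    hence "degree e \<le> degree r" by (rule min)
    moreover have "degree r < degree e"
      using degree_mod_less[OF e0, of "u * a + v * \<pi>"] r0 by (simp add: r_def)
    ultimately show False by simp
  qed
  have "e dvd a" using dvd[of 1 0] by simp
  have "e dvd \<pi>" using dvd[of 0 1] by simp
  then obtain z where z: "\<pi> = e * z" by blast
  have "\<not> \<pi> dvd e" using \<open>e dvd a\<close> assms dvd_trans by blast
  moreover have "\<pi> dvd e * z" by (simp add: z)
  ultimately have "\<pi> dvd z" using pi_prime by blast
  moreover have z0: "z \<noteq> 0" using z pi_nz by auto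
  ultimately have "degree \<pi> \<le> degree z" by (intro dvd_imp_degree_le)
  moreover have "degree \<pi> = degree e + degree z" unfolding z by (rule degree_mult_eq) (use e0 z0 in auto)
  ultimately have "degree e = 0" by simp
  then obtain c where c: "e = [:c:]" by (rule degree_eq_zeroE)
  have c0: "c \<noteq> 0" using e0 c by simp
  have "smult (inverse c) x * a + smult (inverse c) y * \<pi> = smult (inverse c) e"
    by (simp add: xy smult_add_right)
  also have "\<dots> = 1" using c c0 by simp
  finally show ?thesis using that by blast
qed

subsection \<open>The finite field generated by the image of \<open>T\<close>\<close>

definition residues :: "'f set" where "residues = range ev"

lemma card_residues: "finite residues" "card residues = q ^ d"
proof -
  let ?P = "{a :: 'q poly. \<forall>i\<ge>d. coeff a i = 0}"
  have "residues = ev ` ?P"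
  proof
    show "residues \<subseteq> ev ` ?P"
      unfolding residues_def
    proof clarify
      fix a
      have "degree (a mod \<pi>) < d \<or> a mod \<pi> = 0"
        using degree_mod_less[OF pi_nz, of a] by (auto simp: d_def)
      hence "a mod \<pi> \<in> ?P" by (auto intro: coeff_eq_0)
      moreover have "ev a = ev (a mod \<pi>)"
      proof -
        have "\<pi> dvd a - a mod \<pi>" by (simp add: minus_mod_eq_mult_div)
        hence "ev (a - a mod \<pi>) = 0" by (simp only: eval_eq_0_iff)
        thus ?thesis by (simp only: ev_diff right_minus_eq)
      qed
      ultimately show "ev a \<in> ev ` ?P" by simp
    qed
  qed (auto simp: residues_def)
  moreover have "inj_on ev ?P"
  proof (rule inj_onI)
    fix a b assume a: "a \<in> ?P" and b: "b \<in> ?P" and eq: "ev a = ev b"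
    have "ev (a - b) = 0" using eq by (simp only: ev_diff right_minus_eq)
    hence "\<pi> dvd a - b" by (simp only: eval_eq_0_iff)
    moreover have "degree (a - b) < degree \<pi> \<or> a - b = 0"
    proof (rule ccontr)
      assume "\<not> (degree (a - b) < degree \<pi> \<or> a - b = 0)"
      hence "coeff (a - b) (degree (a - b)) \<noteq> 0" "d \<le> degree (a - b)"
        by (simp_all only: d_def leading_coeff_0_iff not_less de_Morgan_disj simp_thms)
      thus False using a b by simp
    qed
    ultimately have "a - b = 0" using dvd_imp_degree_le[of \<pi> "a - b"] by linarith
    thus "a = b" by simp
  qed
  ultimately show "finite residues" "card residues = q ^ d"
    using card_polys_bounded[of d, where 'q = 'q] by (simp_all add: card_image q_eq)
qed

text \<open>The residue \<open>\<theta>\<close> of \<open>T\<close> generates the field with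
  \<open>q\<^sup>d\<close> elements, so it is fixed exactly by those powers of Frobenius whose
  exponent is a multiple of \<open>d\<close>.\<close>

lemma theta_period_d: "\<theta> ^ (q ^ d) = \<theta>"
  and theta_period: "\<theta> ^ (q ^ k) = \<theta> \<Longrightarrow> d dvd k"
proof -
  define r where "r = (LEAST r. r > 0 \<and> \<theta> ^ (q ^ r) = \<theta>)"
  have "\<exists>r. r > 0 \<and> \<theta> ^ (q ^ r) = \<theta>" using frob_periodic[of \<theta>] by blast
  hence "r > 0 \<and> \<theta> ^ (q ^ r) = \<theta>" unfolding r_def by (rule LeastI_ex)
  hence r: "r > 0" "\<theta> ^ (q ^ r) = \<theta>" by auto
  have min: "s = 0 \<or> r \<le> s" if "\<theta> ^ (q ^ s) = \<theta>" for s
    unfolding r_def using that by (cases "s = 0") (auto intro: Least_le)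
  have q1: "q ^ r > 1" using q_ge_2 r(1) by (intro one_less_power) auto
  have "residues \<subseteq> {x. x ^ (q ^ r) = x}"
    unfolding residues_def using ev_power_q[of _ r] r by auto
  hence "card residues \<le> card {x :: 'f. x ^ (q ^ r) = x}"
    by (rule card_mono[OF fixed_points_finite(1)[OF q1]])
  also have "\<dots> \<le> q ^ r" by (rule fixed_points_finite(2)[OF q1])
  finally have "q ^ d \<le> q ^ r" by (simp only: card_residues)
  hence "d \<le> r" using q_ge_2 by (simp add: power_increasing_iff)
  moreover have "r \<le> d"
  proof -
    have inj: "inj_on (\<lambda>i. \<theta> ^ (q ^ i)) {..<r}"
    proof (rule linorder_inj_onI)
      fix i j assume "i < j" "i \<in> {..<r}" "j \<in> {..<r}"
      moreover from this have "\<theta> ^ (q ^ j) = (\<theta> ^ (q ^ (j - i))) ^ (q ^ i)"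
        by (simp flip: power_mult power_add)
      ultimately show "\<theta> ^ (q ^ i) \<noteq> \<theta> ^ (q ^ j)"
        using frob_pow_inj[of \<theta> i "\<theta> ^ (q ^ (j - i))"] min[of "j - i"] by force
    qed auto
    have mp: "map_poly \<kappa> \<pi> \<noteq> 0" "degree (map_poly \<kappa> \<pi>) = d"
    proof -
      have deg: "degree (map_poly \<kappa> \<pi>) = degree \<pi>"
        by (rule degree_map_poly) (use pi_nz in \<open>auto simp: kappa_eq_0_iff\<close>)
      thus "degree (map_poly \<kappa> \<pi>) = d" by (simp add: d_def)
      thus "map_poly \<kappa> \<pi> \<noteq> 0" using d_pos by auto
    qed
    have "ev \<pi> = 0" by (simp add: eval_eq_0_iff)
    hence "poly (map_poly \<kappa> \<pi>) (\<theta> ^ (q ^ i)) = 0" for i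
      using ev_power_q[of \<pi> i] by simp
    hence "(\<lambda>i. \<theta> ^ (q ^ i)) ` {..<r} \<subseteq> {x. poly (map_poly \<kappa> \<pi>) x = 0}" by auto
    hence "card ((\<lambda>i. \<theta> ^ (q ^ i)) ` {..<r}) \<le> card {x. poly (map_poly \<kappa> \<pi>) x = 0}"
      by (rule card_mono[OF poly_roots_finite[OF mp(1)]])
    also have "\<dots> \<le> d" using card_poly_roots_bound[OF mp(1)] mp(2) by simp
    finally show "r \<le> d" by (simp add: card_image[OF inj])
  qed
  ultimately have rd: "r = d" by simp
  have step: "\<theta> ^ (q ^ (m * r + s)) = \<theta> ^ (q ^ s)" for m s
  proof (induction m)
    case (Suc m)
    have "\<theta> ^ (q ^ (Suc m * r + s)) = (\<theta> ^ (q ^ r)) ^ (q ^ (m * r + s))"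
      by (simp add: power_add mult.assoc flip: power_mult)
    thus ?case using Suc r by simp
  qed simp
  show "\<theta> ^ (q ^ d) = \<theta>" using r(2) rd by simp
  assume "\<theta> ^ (q ^ k) = \<theta>"
  hence "\<theta> ^ (q ^ (k mod r)) = \<theta>"
    using step[of "k div r" "k mod r"] by simp
  hence "k mod r = 0" using min[of "k mod r"] mod_less_divisor[OF r(1), of k] by linarith
  thus "d dvd k" using rd by auto
qed

text \<open>The residues are \<open>q\<^sup>d\<close> roots of \<open>x ^ (q ^ d) = x\<close>,
  hence all of them.\<close>

lemma fixed_imp_residue:
  assumes "x ^ (q ^ d) = x"
  obtains a where "x = ev a"
proof -
  have q1: "q ^ d > 1" using q_ge_2 d_pos by (intro one_less_power) auto
  have sub: "residues \<subseteq> {x. x ^ (q ^ d) = x}"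
    unfolding residues_def using ev_power_q[of _ d] theta_period_d by auto
  have "residues = {x. x ^ (q ^ d) = x}"
    by (rule card_seteq[OF fixed_points_finite(1)[OF q1] sub])
      (simp only: card_residues fixed_points_finite(2)[OF q1])
  thus ?thesis using assms that unfolding residues_def by blast
qed

end

section \<open>Endomorphisms of a reduced Drinfeld module\<close>

context reduced_module
begin

definition \<phi> :: "'f poly" where "\<phi> = [:\<theta>, g, 1:]"

definition End :: "'f poly set" where "End = {u. u \<star>\<^bsub>q\<^esub> \<phi> = \<phi> \<star>\<^bsub>q\<^esub> u}"

abbreviation \<Phi> :: "'q poly \<Rightarrow> 'f poly" where "\<Phi> \<equiv> dmod \<phi>"

lemma phi_degree: "degree \<phi> = 2" "lead_coeff \<phi> = 1" "\<phi> \<noteq> 0" "coeff \<phi> 0 = \<theta>"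
  by (simp_all add: \<phi>_def)

lemma Phi_degree:
  assumes "a \<noteq> 0"
  shows "\<Phi> a \<noteq> 0" "degree (\<Phi> a) = 2 * degree a" "lead_coeff (\<Phi> a) = \<kappa> (lead_coeff a)"
proof -
  have "degree \<phi> > 0" by (simp add: phi_degree)
  from dmod_degree[OF this phi_degree(2) assms]
  show "\<Phi> a \<noteq> 0" "degree (\<Phi> a) = 2 * degree a" "lead_coeff (\<Phi> a) = \<kappa> (lead_coeff a)"
    unfolding phi_degree(1) by blast+
qed

lemma Phi_eq_0_iff: "\<Phi> a = 0 \<longleftrightarrow> a = 0"
  using Phi_degree(1) by auto

lemma coeff_Phi_0: "coeff (\<Phi> a) 0 = ev a"
  by (simp add: coeff_dmod_0 phi_degree)

lemma End_diff: "u \<in> End \<Longrightarrow> v \<in> End \<Longrightarrow> u - v \<in> End"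
  by (simp add: End_def tm_diff_left tm_diff_right)

lemma End_add: "u \<in> End \<Longrightarrow> v \<in> End \<Longrightarrow> u + v \<in> End"
  by (simp add: End_def tm_add_left tm_add_right)

lemma End_mult: "u \<in> End \<Longrightarrow> v \<in> End \<Longrightarrow> u \<star>\<^bsub>q\<^esub> v \<in> End"
proof -
  assume u: "u \<in> End" and v: "v \<in> End"
  have "(u \<star>\<^bsub>q\<^esub> v) \<star>\<^bsub>q\<^esub> \<phi> = (u \<star>\<^bsub>q\<^esub> \<phi>) \<star>\<^bsub>q\<^esub> v"
    using v by (simp add: End_def tm_assoc)
  also have "\<dots> = \<phi> \<star>\<^bsub>q\<^esub> (u \<star>\<^bsub>q\<^esub> v)" using u by (simp add: End_def tm_assoc)
  finally show ?thesis by (simp add: End_def)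
qed

lemma End_Phi: "\<Phi> a \<in> End"
  by (simp add: End_def dmod_commute_self)

lemma End_commute: "u \<in> End \<Longrightarrow> u \<star>\<^bsub>q\<^esub> \<Phi> a = \<Phi> a \<star>\<^bsub>q\<^esub> u"
  by (rule dmod_commute) (simp add: End_def)

lemma End_right_quotient:
  assumes "y \<star>\<^bsub>q\<^esub> \<Phi> a \<in> End" "a \<noteq> 0"
  shows "y \<in> End"
proof -
  have "(y \<star>\<^bsub>q\<^esub> \<phi>) \<star>\<^bsub>q\<^esub> \<Phi> a = (y \<star>\<^bsub>q\<^esub> \<Phi> a) \<star>\<^bsub>q\<^esub> \<phi>"
    by (simp only: tm_assoc dmod_commute_self)
  also have "\<dots> = (\<phi> \<star>\<^bsub>q\<^esub> y) \<star>\<^bsub>q\<^esub> \<Phi> a"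
    using assms(1) by (simp add: End_def tm_assoc)
  finally show ?thesis
    using tm_right_cancel Phi_degree(1)[OF assms(2)] by (auto simp: End_def)
qed

lemma End_lead_coeff:
  assumes "u \<in> End" "u \<noteq> 0"
  shows "lead_coeff u ^ (q ^ 2) = lead_coeff u"
proof -
  have "lead_coeff (u \<star>\<^bsub>q\<^esub> \<phi>) = lead_coeff (\<phi> \<star>\<^bsub>q\<^esub> u)" using assms by (simp add: End_def)
  thus ?thesis using tm_nonzero(3)[of u \<phi>] tm_nonzero(3)[of \<phi> u] assms phi_degree by simp
qed

text \<open>The lowest terms of \<open>u \<phi> = \<phi> u\<close> show that
  \<open>\<theta>\<close> is fixed by the power of Frobenius with exponent \<open>tord
  u\<close>.\<close>

lemma End_tord_dvd:
  assumes "u \<in> End" "u \<noteq> 0"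
  shows "d dvd tord u"
proof (rule theta_period)
  have "coeff (u \<star>\<^bsub>q\<^esub> \<phi>) (tord u + 0) = coeff u (tord u) * \<theta> ^ (q ^ tord u)"
    using coeff_tm_low(2)[OF low_tord[of u] low_0(1)[of \<phi>]] phi_degree by simp
  moreover have "coeff (\<phi> \<star>\<^bsub>q\<^esub> u) (0 + tord u) = \<theta> * coeff u (tord u)"
    using coeff_tm_low(2)[OF low_0(1)[of \<phi>] low_tord[of u]] phi_degree by simp
  ultimately show "\<theta> ^ (q ^ tord u) = \<theta>"
    using assms coeff_tord[of u] by (simp add: End_def)
qed

lemma Phi_tord_0:
  assumes "\<not> \<pi> dvd a"
  shows "tord (\<Phi> a) = 0"
  by (rule tord_eqI) (use assms in \<open>simp_all add: coeff_Phi_0 eval_eq_0_iff\<close>)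

text \<open>This is the dichotomy between ordinary and supersingular reduction: the order is a
  positive multiple of \<open>d\<close> and at most the degree \<open>2 d\<close>.\<close>

lemma Phi_pi_tord: "tord (\<Phi> \<pi>) = d \<or> tord (\<Phi> \<pi>) = 2 * d"
proof -
  have nz: "\<Phi> \<pi> \<noteq> 0" using Phi_degree pi_nz by blast
  have "coeff (\<Phi> \<pi>) 0 = 0" by (simp add: coeff_Phi_0 eval_eq_0_iff)
  hence "low 1 (\<Phi> \<pi>)" by (simp add: low_def)
  hence "tord (\<Phi> \<pi>) \<ge> 1" by (rule low_le_tord[OF nz])
  moreover have "tord (\<Phi> \<pi>) \<le> 2 * d"
    using tord_le_degree[OF nz] Phi_degree(2)[OF pi_nz] by (simp add: d_def)
  moreover obtain m where m: "tord (\<Phi> \<pi>) = d * m" using End_tord_dvd[OF End_Phi nz] by blast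
  ultimately have "m \<ge> 1" "d * m \<le> d * 2" by (cases m; simp)+
  hence "m = 1 \<or> m = 2" using d_pos by auto
  thus ?thesis using m by auto
qed

lemma Phi_pi_power:
  "tord (\<Phi> (\<pi> ^ h)) = h * tord (\<Phi> \<pi>)"
proof (induction h)
  case 0
  have "coeff (1 :: 'f poly) 0 \<noteq> 0" by simp
  thus ?case using tord_eqI[of 0 "1 :: 'f poly"] by simp
next
  case (Suc h)
  have "\<Phi> \<pi> \<noteq> 0" "\<Phi> (\<pi> ^ h) \<noteq> 0" using Phi_eq_0_iff pi_nz by simp_all
  thus ?case using Suc tm_nonzero(4)[of "\<Phi> \<pi>" "\<Phi> (\<pi> ^ h)"] by (simp add: dmod_mult)
qed

lemma pi_power_decomp:
  assumes "a \<noteq> 0"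
  shows "\<exists>h b. a = \<pi> ^ h * b \<and> \<not> \<pi> dvd b"
  using assms
proof (induction "degree a" arbitrary: a rule: less_induct)
  case (less a)
  show ?case
  proof (cases "\<pi> dvd a")
    case False
    thus ?thesis by (intro exI[of _ 0] exI[of _ a]) simp
  next
    case True
    then obtain a' where a': "a = \<pi> * a'" by blast
    have nz: "a' \<noteq> 0" using less.prems a' by auto
    have "degree a = degree \<pi> + degree a'" unfolding a' by (rule degree_mult_eq[OF pi_nz nz])
    hence "degree a' < degree a" using d_pos by (simp add: d_def)
    then obtain h b where "a' = \<pi> ^ h * b" "\<not> \<pi> dvd b" using less.hyps nz by blast
    thus ?thesis using a' by (intro exI[of _ "Suc h"] exI[of _ b]) (simp add: mult.assoc)
  qed
qed

end

subsection \<open>Ordinary reduction\<close>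

lemma not_inj_onE:
  assumes "\<not> inj_on f A"
  obtains x y where "x \<in> A" "y \<in> A" "x \<noteq> y" "f x = f y"
  using assms unfolding inj_on_def by blast

text \<open>In the ordinary case \<open>\<Phi> \<pi>\<close> has an inseparable and a separable
  part, each of degree \<open>d\<close> in \<open>\<tau>\<close>.\<close>

locale ordinary_module = reduced_module q \<kappa> \<theta> g \<pi>
  for q :: nat and \<kappa> :: "'q::{field, finite} \<Rightarrow> 'f::field" and \<theta> g \<pi> +
  assumes ordinary: "tord (\<Phi> \<pi>) = d"
begin

lemma tord_pi_power: "tord (\<Phi> (\<pi> ^ h)) = d * h"
  by (simp add: Phi_pi_power ordinary)

text \<open>Commuting with \<open>\<Phi> \<pi>\<close> gives the same equation for the coefficient
  of \<open>\<tau>\<^bsup>d h\<^esup>\<close> in \<open>u\<close> and in \<open>\<Phi> (\<pi> ^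
  h)\<close>. Their quotient is thus fixed by the \<open>d\<close>-th power of Frobenius, so it is
  the residue of some \<open>c\<close>.\<close>

lemma End_approx_step:
  assumes u: "u \<in> End" and low: "low (d * h) u"
  obtains c where "low (d * Suc h) (u - \<Phi> (c * \<pi> ^ h))"
proof -
  define L where "L = coeff (\<Phi> (\<pi> ^ h)) (d * h)"
  define H where "H = coeff (\<Phi> \<pi>) d"
  have nz: "\<Phi> \<pi> \<noteq> 0" "\<Phi> (\<pi> ^ h) \<noteq> 0" using Phi_eq_0_iff pi_nz by simp_all
  have L0: "L \<noteq> 0" using coeff_tord[OF nz(2)] by (simp add: L_def tord_pi_power)
  have H0: "H \<noteq> 0" using coeff_tord[OF nz(1)] by (simp add: H_def ordinary)
  have lowpi: "low d (\<Phi> \<pi>)" using low_tord[of "\<Phi> \<pi>"] by (simp add: ordinary)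
  have lowh: "low (d * h) (\<Phi> (\<pi> ^ h))" using low_tord[of "\<Phi> (\<pi> ^ h)"] by (simp add: tord_pi_power)
  have key: "coeff v (d * h) * H ^ (q ^ (d * h)) = H * coeff v (d * h) ^ (q ^ d)"
    if v: "v \<in> End" "low (d * h) v" for v
  proof -
    have "coeff (v \<star>\<^bsub>q\<^esub> \<Phi> \<pi>) (d * h + d) = coeff v (d * h) * H ^ (q ^ (d * h))"
      unfolding H_def by (rule coeff_tm_low(2)[OF v(2) lowpi])
    moreover have "coeff (\<Phi> \<pi> \<star>\<^bsub>q\<^esub> v) (d + d * h) = H * coeff v (d * h) ^ (q ^ d)"
      unfolding H_def by (rule coeff_tm_low(2)[OF lowpi v(2)])
    ultimately show ?thesis using End_commute[OF v(1), of \<pi>] by (simp add: add.commute)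
  qed
  define x where "x = coeff u (d * h) / L"
  have "x ^ (q ^ d) = x"
  proof -
    have 1: "coeff u (d * h) * H ^ (q ^ (d * h)) = H * coeff u (d * h) ^ (q ^ d)"
      by (rule key[OF u low])
    have 2: "L * H ^ (q ^ (d * h)) = H * L ^ (q ^ d)"
      unfolding L_def by (rule key[OF End_Phi lowh])
    have u: "coeff u (d * h) = x * L" using L0 by (simp add: x_def)
    have "x * (L * H ^ (q ^ (d * h))) = H * (x * L) ^ (q ^ d)" using 1 unfolding u by (simp only: mult.assoc)
    hence "x * (H * L ^ (q ^ d)) = H * (x ^ (q ^ d) * L ^ (q ^ d))" unfolding 2 power_mult_distrib .
    hence "x * (H * L ^ (q ^ d)) = x ^ (q ^ d) * (H * L ^ (q ^ d))" by (simp only: mult.left_commute)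
    thus ?thesis using H0 L0 by simp
  qed
  then obtain c where c: "x = ev c" by (rule fixed_imp_residue)
  define w where "w = u - \<Phi> (c * \<pi> ^ h)"
  have lowc: "low (d * h) (\<Phi> (c * \<pi> ^ h))"
    using coeff_tm_low(1)[OF low_0(1)[of "\<Phi> c"] lowh] by (simp add: dmod_mult)
  have "coeff (\<Phi> (c * \<pi> ^ h)) (0 + d * h) = ev c * L"
    unfolding dmod_mult coeff_tm_low(2)[OF low_0(1)[of "\<Phi> c"] lowh] by (simp add: coeff_Phi_0 L_def)
  hence "coeff (\<Phi> (c * \<pi> ^ h)) (d * h) = x * L" by (simp only: c add_0)
  also have "x * L = coeff u (d * h)" using L0 by (simp add: x_def)
  finally have w0: "coeff w (d * h) = 0" by (simp add: w_def)
  have loww: "low (Suc (d * h)) w"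
    unfolding low_Suc using w0 low_diff[OF low lowc] by (simp add: w_def)
  have "low (d * Suc h) w"
  proof (cases "w = 0")
    case False
    have w: "w \<in> End" unfolding w_def by (intro End_diff u End_Phi)
    obtain m where m: "tord w = d * m" using End_tord_dvd[OF w False] by blast
    have "d * h < d * m" using low_le_tord[OF False loww] by (simp only: m Suc_le_eq)
    hence "d * Suc h \<le> tord w" unfolding m by (intro mult_le_mono2) simp
    thus ?thesis using low_tord low_mono by blast
  qed simp
  thus ?thesis using that w_def by blast
qed

lemma End_approx:
  assumes "u \<in> End"
  shows "\<exists>a. low (d * h) (u - \<Phi> a)"
proof (induction h)
  case 0
  show ?case by simp
next
  case (Suc h)
  then obtain a where a: "low (d * h) (u - \<Phi> a)" by blast
  obtain c where "low (d * Suc h) (u - \<Phi> a - \<Phi> (c * \<pi> ^ h))"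
    using End_approx_step[OF End_diff[OF assms End_Phi] a] by blast
  hence "low (d * Suc h) (u - \<Phi> (a + c * \<pi> ^ h))" by (simp add: dmod_add algebra_simps)
  thus ?case by blast
qed

text \<open>In the ordinary case \<open>A\<close> is dense in \<open>End\<close> for the
  \<open>\<tau>\<close>-adic topology; the degree bound leaves only finitely many
  approximations.\<close>

lemma End_approx_bounded:
  assumes "u \<in> End"
  shows "\<exists>a. (\<forall>i\<ge>d * h. coeff a i = 0) \<and> low (d * h) (u - \<Phi> a)"
proof -
  obtain a where a: "low (d * h) (u - \<Phi> a)" using End_approx[OF assms] by blast
  have p: "\<pi> ^ h \<noteq> 0" using pi_nz by simp
  define b where "b = a mod \<pi> ^ h"
  define c where "c = a div \<pi> ^ h"
  have abc: "a = c * \<pi> ^ h + b" by (simp only: b_def c_def div_mult_mod_eq)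
  have lowc: "low (d * h) (\<Phi> (c * \<pi> ^ h))"
    using coeff_tm_low(1)[OF low_0(1)[of "\<Phi> c"] low_tord[of "\<Phi> (\<pi> ^ h)"]]
    by (simp add: dmod_mult tord_pi_power)
  have "\<Phi> a = \<Phi> (c * \<pi> ^ h) + \<Phi> b" by (subst abc) (rule dmod_add)
  hence "(u - \<Phi> a) + \<Phi> (c * \<pi> ^ h) = u - \<Phi> b" by simp
  hence "low (d * h) (u - \<Phi> b)" using low_add[OF a lowc] by (simp only:)
  moreover have "coeff b i = 0" if "i \<ge> d * h" for i
  proof -
    have "degree (\<pi> ^ h) = d * h" by (simp add: d_def degree_power_eq pi_nz mult.commute)
    hence "b = 0 \<or> degree b < d * h"
      using degree_mod_less[OF p, of a] by (auto simp: b_def)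
    thus ?thesis using that by (auto intro: coeff_eq_0)
  qed
  ultimately show ?thesis by blast
qed

text \<open>Counting shows that \<open>End\<close> has rank at most two. Triples of polynomials of
  degree less than \<open>N\<close> produce endomorphisms of degree at most \<open>2 N +
  D\<close>, while their approximations modulo \<open>\<tau>\<^bsup>d h\<^esup>\<close> take fewer
  than \<open>q\<^bsup>3 N\<^esup>\<close> values. The difference of two triples with the same
  approximation gives an endomorphism whose order exceeds its degree, so it is zero.\<close>

lemma End_dependent:
  assumes x: "x1 \<in> End" "x2 \<in> End" "x3 \<in> End"
  obtains a b c where "(a, b, c) \<noteq> (0, 0, 0)"
    "\<Phi> a \<star>\<^bsub>q\<^esub> x1 + \<Phi> b \<star>\<^bsub>q\<^esub> x2 + \<Phi> c \<star>\<^bsub>q\<^esub> x3 = 0"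
proof -
  define D where "D = degree x1 + degree x2 + degree x3"
  \<comment> \<open>Chosen so that \<open>3 N > d h > 2 N + D\<close>: more triples than
    approximations, and an order beyond the degree.\<close>
  define N where "N = D + d + 1"
  define h where "h = Suc ((2 * N + D) div d)"
  let ?P = "{a :: 'q poly. \<forall>i\<ge>N. coeff a i = 0}" and ?R = "{a :: 'q poly. \<forall>i\<ge>d * h. coeff a i = 0}"
  define F where "F = (\<lambda>(a, b, c). \<Phi> a \<star>\<^bsub>q\<^esub> x1 + \<Phi> b \<star>\<^bsub>q\<^esub> x2 + \<Phi> c \<star>\<^bsub>q\<^esub> x3)"
  define r where "r u = (SOME a. a \<in> ?R \<and> low (d * h) (u - \<Phi> a))" for u
  have r: "r u \<in> ?R" "low (d * h) (u - \<Phi> (r u))" if "u \<in> End" for u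
  proof -
    have "\<exists>a. a \<in> ?R \<and> low (d * h) (u - \<Phi> a)" using End_approx_bounded[OF that, of h] by simp
    hence "r u \<in> ?R \<and> low (d * h) (u - \<Phi> (r u))" unfolding r_def by (rule someI_ex)
    thus "r u \<in> ?R" "low (d * h) (u - \<Phi> (r u))" by blast+
  qed
  have dh: "2 * N + D < d * h" "d * h \<le> 2 * N + D + d"
  proof -
    have "2 * N + D = d * ((2 * N + D) div d) + (2 * N + D) mod d" by simp
    moreover have "(2 * N + D) mod d < d" using d_pos by simp
    ultimately show "2 * N + D < d * h" "d * h \<le> 2 * N + D + d" unfolding h_def mult_Suc_right by linarith+
  qed
  have F_End: "F t \<in> End" for t
    unfolding F_def using x by (auto intro!: End_add End_mult End_Phi split: prod.splits)
  have degP: "degree (\<Phi> a \<star>\<^bsub>q\<^esub> y) \<le> 2 * N + D" if "a \<in> ?P" "degree y \<le> D" for a y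
  proof (cases "a = 0")
    case False
    have "degree a < N"
    proof (rule ccontr)
      assume "\<not> degree a < N"
      hence "coeff a (degree a) = 0" using that(1) by simp
      thus False using False by simp
    qed
    hence "degree (\<Phi> a) \<le> 2 * N" using Phi_degree(2)[OF False] by simp
    thus ?thesis using coeff_tm_high(1) that(2) by blast
  qed simp
  have F_deg: "degree (F t) \<le> 2 * N + D" if "t \<in> ?P \<times> ?P \<times> ?P" for t
  proof -
    obtain a b c where t: "t = (a, b, c)" by (cases t)
    show ?thesis using that unfolding t F_def prod.case
      by (intro degree_add_le degP) (auto simp: D_def)
  qed
  have card_R: "finite ?R" "card ?R = q ^ (d * h)"
    using card_polys_bounded[where 'q = 'q] by (simp_all add: q_eq)
  have card_P: "finite ?P" "card ?P = q ^ N"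
    using card_polys_bounded[where 'q = 'q] by (simp_all add: q_eq)
  have "\<not> inj_on (\<lambda>t. r (F t)) (?P \<times> ?P \<times> ?P)"
  proof
    assume "inj_on (\<lambda>t. r (F t)) (?P \<times> ?P \<times> ?P)"
    hence "card (?P \<times> ?P \<times> ?P) \<le> card ?R"
      by (rule card_inj_on_le) (use r F_End card_R in auto)
    hence "q ^ N * (q ^ N * q ^ N) \<le> q ^ (d * h)"
      by (simp only: card_cartesian_product card_P card_R)
    hence "q ^ (N + (N + N)) \<le> q ^ (d * h)" by (simp only: power_add)
    hence "N + (N + N) \<le> d * h" using q_ge_2 by (simp only: power_increasing_iff)
    hence "N + (N + N) \<le> 2 * N + D + d" using dh(2) by (rule order_trans)
    thus False by (simp add: N_def)
  qed
  then obtain s t where st: "s \<in> ?P \<times> ?P \<times> ?P" "t \<in> ?P \<times> ?P \<times> ?P" "s \<noteq> t" "r (F s) = r (F t)"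
    by (rule not_inj_onE)
  have "low (d * h) ((F s - \<Phi> (r (F s))) - (F t - \<Phi> (r (F t))))"
    by (intro low_diff r F_End)
  hence "low (d * h) (F s - F t)" by (simp add: st(4))
  moreover have "degree (F s - F t) < d * h"
    using degree_diff_le[OF F_deg[OF st(1)] F_deg[OF st(2)]] dh(1) by linarith
  ultimately have "F s - F t = 0" by (rule low_gt_degree)
  obtain a b c where s: "s = (a, b, c)" by (cases s)
  obtain a' b' c' where t: "t = (a', b', c')" by (cases t)
  show ?thesis
  proof (rule that[of "a - a'" "b - b'" "c - c'"])
    show "(a - a', b - b', c - c') \<noteq> (0, 0, 0)" using st(3) s t by auto
    show "\<Phi> (a - a') \<star>\<^bsub>q\<^esub> x1 + \<Phi> (b - b') \<star>\<^bsub>q\<^esub> x2 + \<Phi> (c - c') \<star>\<^bsub>q\<^esub> x3 = 0"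
      using \<open>F s - F t = 0\<close> unfolding s t F_def prod.case
      by (simp add: dmod_diff tm_diff_left algebra_simps)
  qed
qed

end

section \<open>Subsets of a field as rings\<close>

lemma subring_on_simps [simp]:
  "carrier (subring_on S) = S"
  "x \<otimes>\<^bsub>subring_on S\<^esub> y = x * y"
  "x \<oplus>\<^bsub>subring_on S\<^esub> y = x + y"
  "\<one>\<^bsub>subring_on S\<^esub> = 1"
  "\<zero>\<^bsub>subring_on S\<^esub> = 0"
  by (simp_all add: subring_on_def ring_of_type_algebra_def)

lemma cring_subring_on:
  fixes S :: "'c::field set"
  assumes "1 \<in> S" and diff: "\<And>x y. x \<in> S \<Longrightarrow> y \<in> S \<Longrightarrow> x - y \<in> S"
    and mult: "\<And>x y. x \<in> S \<Longrightarrow> y \<in> S \<Longrightarrow> x * y \<in> S"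
  shows "cring (subring_on S)"
proof -
  have 0: "0 \<in> S" using diff[OF assms(1) assms(1)] by simp
  have minus: "- x \<in> S" if "x \<in> S" for x using diff[OF 0 that] by simp
  have add: "x + y \<in> S" if "x \<in> S" "y \<in> S" for x y using diff[OF that(1) minus[OF that(2)]] by simp
  show ?thesis
  proof (rule cringI)
    show "abelian_group (subring_on S)"
    proof (rule abelian_groupI)
      fix x assume x: "x \<in> carrier (subring_on S)"
      show "\<exists>y\<in>carrier (subring_on S). y \<oplus>\<^bsub>subring_on S\<^esub> x = \<zero>\<^bsub>subring_on S\<^esub>"
        using minus[of x] x by (intro bexI[of _ "- x"]) simp_all
    qed (use 0 add in \<open>simp_all add: ac_simps\<close>)
    show "comm_monoid (subring_on S)"
      by (rule comm_monoidI) (use assms in \<open>simp_all add: ac_simps\<close>)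
  qed (simp add: algebra_simps)
qed

lemma ideal_subring_onI:
  fixes S :: "'c::field set"
  assumes R: "cring (subring_on S)" and "I \<subseteq> S" "0 \<in> I"
    and diff: "\<And>x y. x \<in> I \<Longrightarrow> y \<in> I \<Longrightarrow> x - y \<in> I"
    and mult: "\<And>x y. x \<in> S \<Longrightarrow> y \<in> I \<Longrightarrow> x * y \<in> I"
  shows "ideal I (subring_on S)"
proof -
  interpret cring "subring_on S" by (rule R)
  have minus: "- x \<in> I" if "x \<in> I" for x using diff[OF assms(3) that] by simp
  have add: "x + y \<in> I" if "x \<in> I" "y \<in> I" for x y using diff[OF that(1) minus[OF that(2)]] by simp
  show ?thesis
  proof (rule idealI)
    show "ring (subring_on S)" by (rule ring_axioms)
    show "subgroup I (add_monoid (subring_on S))"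
    proof (rule add.subgroupI)
      show "I \<subseteq> carrier (subring_on S)" using assms by simp
      show "I \<noteq> {}" using assms by blast
      fix a assume a: "a \<in> I"
      have "\<ominus>\<^bsub>subring_on S\<^esub> a = - a"
        by (rule minus_equality) (use a minus assms in \<open>auto simp: subset_iff\<close>)
      thus "\<ominus>\<^bsub>subring_on S\<^esub> a \<in> I" using minus[OF a] by simp
      fix b assume b: "b \<in> I"
      show "a \<oplus>\<^bsub>subring_on S\<^esub> b \<in> I" using add[OF a b] by simp
    qed
  next
    fix a x assume ax: "a \<in> I" "x \<in> carrier (subring_on S)"
    show "x \<otimes>\<^bsub>subring_on S\<^esub> a \<in> I" using mult ax by simp
    show "a \<otimes>\<^bsub>subring_on S\<^esub> x \<in> I" using mult[of x a] ax by (simp add: mult.commute)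
  qed
qed

section \<open>Integral elements\<close>

locale A_algebra =
  fixes \<iota> :: "'q::{field, finite} poly \<Rightarrow> 'c::field"
  assumes iota_add: "\<iota> (a + b) = \<iota> a + \<iota> b"
    and iota_mult: "\<iota> (a * b) = \<iota> a * \<iota> b"
    and iota_1: "\<iota> 1 = 1"
    and iota_eq_0: "\<iota> a = 0 \<Longrightarrow> a = 0"
begin

lemma iota_0: "\<iota> 0 = 0"
  using iota_add[of 0 0] by (metis add_0 add_cancel_right_right)

lemma iota_eq_0_iff: "\<iota> a = 0 \<longleftrightarrow> a = 0"
  using iota_eq_0 iota_0 by auto

lemma iota_minus: "\<iota> (- a) = - \<iota> a"
  by (rule minus_unique[symmetric]) (simp add: iota_0 flip: iota_add)

lemma iota_diff: "\<iota> (a - b) = \<iota> a - \<iota> b"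
  using iota_add[of a "- b"] by (simp add: iota_minus)

lemma iota_power: "\<iota> (a ^ n) = \<iota> a ^ n"
  by (induction n) (simp_all add: iota_1 iota_mult)

definition ev_A :: "'q poly poly \<Rightarrow> 'c \<Rightarrow> 'c" where "ev_A p x = poly (map_poly \<iota> p) x"

lemma ev_A_add: "ev_A (p + r) x = ev_A p x + ev_A r x"
  and ev_A_diff: "ev_A (p - r) x = ev_A p x - ev_A r x"
proof -
  have "map_poly \<iota> (p + r) = map_poly \<iota> p + map_poly \<iota> r"
    "map_poly \<iota> (p - r) = map_poly \<iota> p - map_poly \<iota> r"
    by (rule poly_eqI; simp add: coeff_map_poly iota_0 iota_add iota_diff)+
  thus "ev_A (p + r) x = ev_A p x + ev_A r x" "ev_A (p - r) x = ev_A p x - ev_A r x"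
    by (simp_all add: ev_A_def)
qed

lemma ev_A_0 [simp]: "ev_A 0 x = 0"
  by (simp add: ev_A_def)

lemma ev_A_pCons: "ev_A (pCons a p) x = \<iota> a + x * ev_A p x"
  by (simp add: ev_A_def Polynomial.map_poly_pCons iota_0)

lemma ev_A_smult: "ev_A (smult a p) x = \<iota> a * ev_A p x"
  by (induction p) (simp_all add: ev_A_pCons iota_mult algebra_simps)

lemma ev_A_monom: "ev_A (monom a n) x = \<iota> a * x ^ n"
proof -
  have "map_poly \<iota> (monom a n) = monom (\<iota> a) n"
    by (rule poly_eqI) (simp add: coeff_map_poly iota_0)
  thus ?thesis by (simp add: ev_A_def poly_monom)
qed

lemma ev_A_altdef: "ev_A p x = (\<Sum>i\<le>degree p. \<iota> (coeff p i) * x ^ i)"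
proof -
  have "degree (map_poly \<iota> p) = degree p"
    by (rule Ring_Hom_Poly.degree_map_poly) (simp add: iota_eq_0_iff)
  thus ?thesis by (simp add: ev_A_def poly_altdef coeff_map_poly iota_0)
qed

lemma integral_over_A_iff: "integral_over_A \<iota> x \<longleftrightarrow> (\<exists>p. lead_coeff p = 1 \<and> ev_A p x = 0)"
  by (simp add: integral_over_A_def ev_A_def)

lemma integral_iota: "integral_over_A \<iota> (\<iota> a)"
  unfolding integral_over_A_iff by (intro exI[of _ "[:- a, 1:]"]) (simp add: ev_A_pCons iota_minus iota_1)

definition A_span :: "nat \<Rightarrow> (nat \<Rightarrow> 'c) \<Rightarrow> 'c set"
  where "A_span n b = {\<Sum>i<n. \<iota> (c i) * b i |c. True}"

lemma A_spanI: "x = (\<Sum>i<n. \<iota> (c i) * b i) \<Longrightarrow> x \<in> A_span n b"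
  unfolding A_span_def mem_Collect_eq by (intro exI[of _ c] conjI TrueI)

lemma A_span_add: "x \<in> A_span n b \<Longrightarrow> y \<in> A_span n b \<Longrightarrow> x + y \<in> A_span n b"
proof -
  assume "x \<in> A_span n b" "y \<in> A_span n b"
  then obtain c c' where "x = (\<Sum>i<n. \<iota> (c i) * b i)" "y = (\<Sum>i<n. \<iota> (c' i) * b i)"
    by (auto simp: A_span_def)
  hence "x + y = (\<Sum>i<n. \<iota> (c i + c' i) * b i)" by (simp add: iota_add distrib_right sum.distrib)
  thus ?thesis by (rule A_spanI)
qed

lemma A_span_smult: "x \<in> A_span n b \<Longrightarrow> \<iota> a * x \<in> A_span n b"
proof -
  assume "x \<in> A_span n b"
  then obtain c where "x = (\<Sum>i<n. \<iota> (c i) * b i)" by (auto simp: A_span_def)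
  hence "\<iota> a * x = (\<Sum>i<n. \<iota> (a * c i) * b i)" by (simp add: iota_mult sum_distrib_left mult.assoc)
  thus ?thesis by (rule A_spanI)
qed

lemma A_span_0: "0 \<in> A_span n b"
proof -
  have "0 = (\<Sum>i<n. \<iota> 0 * b i)" by (simp add: iota_0)
  thus ?thesis by (rule A_spanI)
qed

lemma A_span_sum: "(\<And>i. i \<in> I \<Longrightarrow> h i \<in> A_span n b) \<Longrightarrow> sum h I \<in> A_span n b"
  by (induction I rule: infinite_finite_induct) (auto simp: A_span_0 A_span_add)

lemma A_span_base:
  assumes "k < n" shows "b k \<in> A_span n b"
proof -
  have "(\<Sum>i<n. \<iota> (if i = k then 1 else 0) * b i) = (\<Sum>i<n. if i = k then b i else 0)"
    by (intro sum.cong) (simp_all add: iota_1 iota_0)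
  also have "\<dots> = b k" using assms by simp
  finally have "b k = (\<Sum>i<n. \<iota> (if i = k then 1 else 0) * b i)" by simp
  thus ?thesis by (rule A_spanI)
qed

lemma A_span_mult_closed:
  assumes "\<And>k. k < n \<Longrightarrow> z * b k \<in> A_span n b" "x \<in> A_span n b"
  shows "z * x \<in> A_span n b"
proof -
  obtain c where "x = (\<Sum>i<n. \<iota> (c i) * b i)" using assms(2) by (auto simp: A_span_def)
  hence "z * x = (\<Sum>i<n. \<iota> (c i) * (z * b i))" by (simp add: sum_distrib_left mult.left_commute)
  also have "\<dots> \<in> A_span n b" using assms(1) by (intro A_span_sum A_span_smult) simp
  finally show ?thesis .
qed

text \<open>If \<open>z\<close> acts on a finitely generated \<open>A\<close>-module inside a field, then it is an eigenvalue of
  a matrix over \<open>A\<close>, hence a root of its characteristic polynomial.\<close>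

lemma integral_if_acts:
  assumes act: "\<And>k. k < n \<Longrightarrow> z * b k \<in> A_span n b" and "k0 < n" "b k0 \<noteq> 0"
  shows "integral_over_A \<iota> z"
proof -
  have "\<forall>k. \<exists>c. k < n \<longrightarrow> z * b k = (\<Sum>i<n. \<iota> (c i) * b i)"
    using act unfolding A_span_def by blast
  then obtain c where c: "\<And>k. k < n \<Longrightarrow> z * b k = (\<Sum>i<n. \<iota> (c k i) * b i)" by metis
  define M where "M = mat n n (\<lambda>(k, i). c k i)"
  have M: "M \<in> carrier_mat n n" by (simp add: M_def)
  define v where "v = vec n b"
  have "eigenvector (map_mat \<iota> M) v z"
    unfolding eigenvector_def
  proof (intro conjI)
    show "v \<in> carrier_vec (dim_row (map_mat \<iota> M))" by (simp add: v_def M_def)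
    show "v \<noteq> 0\<^sub>v (dim_row (map_mat \<iota> M))"
    proof
      assume "v = 0\<^sub>v (dim_row (map_mat \<iota> M))"
      hence "v $ k0 = 0" using assms(2) by (simp add: M_def)
      thus False using assms(2,3) by (simp add: v_def)
    qed
    show "map_mat \<iota> M *\<^sub>v v = z \<cdot>\<^sub>v v"
    proof (rule eq_vecI)
      fix k assume "k < dim_vec (z \<cdot>\<^sub>v v)"
      hence k: "k < n" by (simp add: v_def)
      have "(map_mat \<iota> M *\<^sub>v v) $ k = (\<Sum>i<n. \<iota> (c k i) * b i)"
        using k by (simp add: M_def v_def scalar_prod_def row_def lessThan_atLeast0)
      thus "(map_mat \<iota> M *\<^sub>v v) $ k = (z \<cdot>\<^sub>v v) $ k" using c[OF k] k by (simp add: v_def)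
    qed (simp add: M_def v_def)
  qed
  hence "eigenvalue (map_mat \<iota> M) z" by (auto simp: eigenvalue_def)
  hence "poly (char_poly (map_mat \<iota> M)) z = 0"
    by (subst (asm) eigenvalue_root_char_poly[of _ n]) (simp_all add: M_def)
  moreover have "comm_ring_hom \<iota>"
    by unfold_locales (simp_all add: iota_0 iota_1 iota_add iota_mult)
  ultimately have "ev_A (char_poly M) z = 0"
    by (simp add: ev_A_def comm_ring_hom.char_poly_hom[OF _ M])
  thus ?thesis
    unfolding integral_over_A_iff using degree_monic_char_poly[OF M]
    by (intro exI[of _ "char_poly M"]) simp
qed

lemma integral_power_reduce:
  assumes "lead_coeff p = 1" "ev_A p x = 0"
  shows "degree p > 0" "x ^ degree p = (\<Sum>i<degree p. \<iota> (- coeff p i) * x ^ i)"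
proof -
  have "ev_A p x = (\<Sum>i<degree p. \<iota> (coeff p i) * x ^ i) + x ^ degree p"
    using assms(1) by (simp add: ev_A_altdef lessThan_Suc_atMost[symmetric] iota_1)
  hence eq: "(\<Sum>i<degree p. \<iota> (coeff p i) * x ^ i) + x ^ degree p = 0" using assms(2) by simp
  hence "x ^ degree p = - (\<Sum>i<degree p. \<iota> (coeff p i) * x ^ i)" using minus_unique by metis
  thus "x ^ degree p = (\<Sum>i<degree p. \<iota> (- coeff p i) * x ^ i)"
    by (simp add: iota_minus sum_negf)
  show "degree p > 0" using eq by (cases "degree p = 0") auto
qed

text \<open>Differences and products act on the \<open>A\<close>-module spanned by finitely many
  monomials \<open>x\<^sup>i y\<^sup>j\<close>.\<close>

lemma integral_closed:
  assumes "integral_over_A \<iota> x" "integral_over_A \<iota> y"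
  shows "integral_over_A \<iota> (x - y)" "integral_over_A \<iota> (x * y)"
proof -
  obtain p where p: "lead_coeff p = 1" "ev_A p x = 0" using assms(1) unfolding integral_over_A_iff by blast
  obtain r where r: "lead_coeff r = 1" "ev_A r y = 0" using assms(2) unfolding integral_over_A_iff by blast
  note P = integral_power_reduce[OF p] and R = integral_power_reduce[OF r]
  define n where "n = degree p"
  define m where "m = degree r"
  define b where "b k = x ^ (k div m) * y ^ (k mod m)" for k
  let ?W = "A_span (n * m) b"
  have m: "m > 0" and n: "n > 0" using P(1) R(1) by (simp_all add: m_def n_def)
  have base: "x ^ i * y ^ j \<in> ?W" if "i < n" "j < m" for i j
  proof -
    have "i * m + j < Suc i * m" using that by simp
    also have "\<dots> \<le> n * m" using that by (intro mult_le_mono1) simp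
    finally have "b (i * m + j) \<in> ?W" by (rule A_span_base)
    thus ?thesis using that by (simp add: b_def)
  qed
  have bk: "b k = x ^ (k div m) * y ^ (k mod m)" "k div m < n" "k mod m < m" if "k < n * m" for k
    using that m by (simp_all add: b_def less_mult_imp_div_less)
  have x: "x * b k \<in> ?W" if k: "k < n * m" for k
  proof (cases "Suc (k div m) < n")
    case True
    thus ?thesis using base[OF True bk(3)[OF k]] by (simp add: b_def mult.assoc)
  next
    case False
    hence eq: "Suc (k div m) = n" using bk(2)[OF k] by simp
    have "x * b k = x ^ n * y ^ (k mod m)" by (simp add: b_def mult.assoc flip: eq)
    also have "\<dots> = (\<Sum>i<n. \<iota> (- coeff p i) * (x ^ i * y ^ (k mod m)))"
      unfolding n_def P(2) sum_distrib_right by (simp only: mult.assoc)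
    also have "\<dots> \<in> ?W" by (intro A_span_sum A_span_smult base bk(3)[OF k]) simp
    finally show ?thesis .
  qed
  have y: "y * b k \<in> ?W" if k: "k < n * m" for k
  proof (cases "Suc (k mod m) < m")
    case True
    thus ?thesis using base[OF bk(2)[OF k] True] by (simp add: b_def mult.left_commute)
  next
    case False
    hence eq: "Suc (k mod m) = m" using bk(3)[OF k] by simp
    have "y * b k = x ^ (k div m) * y ^ Suc (k mod m)" by (simp add: b_def mult.left_commute)
    also have "\<dots> = (\<Sum>i<m. \<iota> (- coeff r i) * (x ^ (k div m) * y ^ i))"
      unfolding eq unfolding m_def R(2) sum_distrib_left by (simp only: mult.left_commute)
    also have "\<dots> \<in> ?W" by (intro A_span_sum A_span_smult base bk(2)[OF k]) simp
    finally show ?thesis .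
  qed
  have nm: "0 < n * m" and b0: "b 0 \<noteq> 0" using m n by (simp_all add: b_def)
  show "integral_over_A \<iota> (x - y)"
  proof (rule integral_if_acts[of "n * m" _ b 0, OF _ nm b0])
    fix k assume k: "k < n * m"
    have "x * b k + \<iota> (- 1) * (y * b k) \<in> ?W" by (intro A_span_add A_span_smult x y k)
    thus "(x - y) * b k \<in> ?W" by (simp add: iota_minus iota_1 left_diff_distrib)
  qed
  show "integral_over_A \<iota> (x * y)"
  proof (rule integral_if_acts[of "n * m" _ b 0, OF _ nm b0])
    fix k assume k: "k < n * m"
    show "x * y * b k \<in> ?W"
      using A_span_mult_closed[OF x y[OF k]] by (simp only: mult.assoc)
  qed
qed

text \<open>Induction on the polynomial: a vanishing constant coefficient allows division by
  \<open>x\<close>.\<close>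

lemma algebraic_multiple:
  assumes "x \<noteq> 0" "p \<noteq> 0" "ev_A p x = 0"
  shows "\<exists>r a. a \<noteq> 0 \<and> x * ev_A r x = \<iota> a"
  using assms(2,3)
proof (induction p)
  case (pCons a p)
  show ?case
  proof (cases "a = 0")
    case True
    hence "p \<noteq> 0" "ev_A p x = 0" using pCons.prems assms(1) by (auto simp: ev_A_pCons iota_0)
    thus ?thesis by (rule pCons.IH)
  next
    case False
    have "\<iota> a + x * ev_A p x = 0" using pCons.prems by (simp add: ev_A_pCons)
    hence "\<iota> a + x * ev_A p x - \<iota> a = 0 - \<iota> a" by (rule arg_cong)
    hence "x * ev_A p x = \<iota> (- a)" by (simp add: iota_minus)
    thus ?thesis using False by (intro exI[of _ p] exI[of _ "- a"]) simp
  qed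
qed simp

end

section \<open>Orders acting on a reduced Drinfeld module\<close>

lemma same_parity_diff: "u mod 2 = w mod 2 \<Longrightarrow> u \<le> w \<Longrightarrow> w = u + 2 * ((w - u) div 2)" for u w :: nat
proof -
  assume "u mod 2 = w mod 2" and le: "u \<le> w"
  hence "2 dvd w - u" using mod_eq_dvd_iff_nat[OF le, of 2] by simp
  hence "2 * ((w - u) div 2) = w - u" by (rule dvd_mult_div_cancel)
  thus ?thesis using le by simp
qed

text \<open>The abstract situation after reduction: an order \<open>S\<close> in the large field
  acts faithfully on the reduced module by \<open>\<rho>\<close>, compatibly with the action of
  \<open>A\<close>.\<close>

locale represented = reduced_module q \<kappa> \<theta> g \<pi> + A_algebra \<iota>
  for q :: nat and \<kappa> :: "'q::{field, finite} \<Rightarrow> 'f::field" and \<theta> g \<pi>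
    and \<iota> :: "'q poly \<Rightarrow> 'c::field" +
  fixes S :: "'c set" and \<rho> :: "'c \<Rightarrow> 'f poly"
  assumes S_iota: "\<iota> a \<in> S"
    and S_diff: "x \<in> S \<Longrightarrow> y \<in> S \<Longrightarrow> x - y \<in> S"
    and S_mult: "x \<in> S \<Longrightarrow> y \<in> S \<Longrightarrow> x * y \<in> S"
    and rho_diff: "x \<in> S \<Longrightarrow> y \<in> S \<Longrightarrow> \<rho> (x - y) = \<rho> x - \<rho> y"
    and rho_mult: "x \<in> S \<Longrightarrow> y \<in> S \<Longrightarrow> \<rho> (x * y) = \<rho> x \<star>\<^bsub>q\<^esub> \<rho> y"
    and rho_iota: "\<rho> (\<iota> a) = \<Phi> a"
    and rho_End: "x \<in> S \<Longrightarrow> \<rho> x \<in> End"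
    and rho_eq_0: "x \<in> S \<Longrightarrow> \<rho> x = 0 \<Longrightarrow> x = 0"
begin

lemma S_0: "0 \<in> S" using S_iota[of 0] by (simp add: iota_0)

lemma S_1: "1 \<in> S" using S_iota[of 1] by (simp add: iota_1)

lemma S_minus: "x \<in> S \<Longrightarrow> - x \<in> S" using S_diff[OF S_0, of x] by simp

lemma S_add: "x \<in> S \<Longrightarrow> y \<in> S \<Longrightarrow> x + y \<in> S" using S_diff[OF _ S_minus, of x y] by simp

lemma S_power: "x \<in> S \<Longrightarrow> x ^ n \<in> S" by (induction n) (simp_all add: S_1 S_mult)

lemma S_sum: "(\<And>i. i \<in> I \<Longrightarrow> h i \<in> S) \<Longrightarrow> sum h I \<in> S"
  by (induction I rule: infinite_finite_induct) (simp_all add: S_0 S_add)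

lemma S_ev_A: "x \<in> S \<Longrightarrow> ev_A p x \<in> S"
  by (induction p) (simp_all add: ev_A_pCons S_0 S_add S_mult S_iota)

lemma rho_0: "\<rho> 0 = 0" using rho_iota[of 0] by (simp add: iota_0)

lemma rho_1: "\<rho> 1 = 1" using rho_iota[of 1] by (simp add: iota_1)

lemma rho_minus: "x \<in> S \<Longrightarrow> \<rho> (- x) = - \<rho> x" using rho_diff[OF S_0, of x] by (simp add: rho_0)

lemma rho_add: "x \<in> S \<Longrightarrow> y \<in> S \<Longrightarrow> \<rho> (x + y) = \<rho> x + \<rho> y"
  using rho_diff[OF _ S_minus, of x y] by (simp add: rho_minus)

lemma rho_eq_0_iff: "x \<in> S \<Longrightarrow> \<rho> x = 0 \<longleftrightarrow> x = 0"
  using rho_eq_0 rho_0 by auto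

lemma rho_sum: "(\<And>i. i \<in> I \<Longrightarrow> h i \<in> S) \<Longrightarrow> \<rho> (sum h I) = (\<Sum>i\<in>I. \<rho> (h i))"
  by (induction I rule: infinite_finite_induct) (simp_all add: rho_0 rho_add S_sum)

lemma rho_iota_mult: "x \<in> S \<Longrightarrow> \<rho> (\<iota> a * x) = \<Phi> a \<star>\<^bsub>q\<^esub> \<rho> x"
  by (simp add: rho_mult S_iota rho_iota)

lemma rho_iota_mult': "x \<in> S \<Longrightarrow> \<rho> (\<iota> a * x) = \<rho> x \<star>\<^bsub>q\<^esub> \<Phi> a"
  by (simp add: rho_iota_mult End_commute rho_End)

text \<open>Among the values \<open>p(x)\<close> of polynomials over \<open>A\<close>, the degree
  of the image modulo two and its leading coefficient take only finitely many values. Subtracting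
  \<open>T\<^sup>m\<close> times an element of least degree with the same data lowers the degree,
  so \<open>A[x]\<close> is a finitely generated \<open>A\<close>-module.\<close>

lemma integral_S:
  assumes x: "x \<in> S"
  shows "integral_over_A \<iota> x"
proof -
  define key where "key w = (degree (\<rho> w) mod 2, lead_coeff (\<rho> w))" for w
  define W where "W = range (\<lambda>p. ev_A p x) - {0}"
  have W_S: "w \<in> S" if "w \<in> W" for w using that S_ev_A[OF x] by (auto simp: W_def)
  have rho_nz: "\<rho> w \<noteq> 0" if "w \<in> W" for w
    using rho_eq_0_iff[OF W_S[OF that]] that by (auto simp: W_def)
  have q2: "q ^ 2 > 1" using q_ge_2 by (intro one_less_power) auto
  have "key ` W \<subseteq> {0, 1} \<times> {c. c ^ (q ^ 2) = c}"
  proof (rule image_subsetI)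
    fix w assume w: "w \<in> W"
    have "degree (\<rho> w) mod 2 \<in> {0, 1}" by auto
    thus "key w \<in> {0, 1} \<times> {c. c ^ (q ^ 2) = c}"
      using End_lead_coeff[OF rho_End[OF W_S[OF w]] rho_nz[OF w]] by (simp add: key_def)
  qed
  hence fin: "finite (key ` W)"
    by (rule finite_subset) (use fixed_points_finite(1)[OF q2] in simp)
  have "\<exists>p. ev_A p x \<in> W \<and> key (ev_A p x) = k \<and>
      (\<forall>w\<in>W. key w = k \<longrightarrow> degree (\<rho> (ev_A p x)) \<le> degree (\<rho> w))" if k: "k \<in> key ` W" for k
  proof -
    obtain w0 where w0: "w0 \<in> W \<and> key w0 = k" using k by blast
    from ex_has_least_nat[of "\<lambda>w. w \<in> W \<and> key w = k", OF w0, of "\<lambda>w. degree (\<rho> w)"] obtain w1 where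
      w1: "w1 \<in> W" "key w1 = k" and min: "\<And>w. w \<in> W \<and> key w = k \<Longrightarrow> degree (\<rho> w1) \<le> degree (\<rho> w)" by blast
    obtain p where "w1 = ev_A p x" using w1(1) by (auto simp: W_def)
    thus ?thesis using w1 min by (intro exI[of _ p]) auto
  qed
  note ex = this
  define P where "P k = (SOME p. ev_A p x \<in> W \<and> key (ev_A p x) = k \<and>
      (\<forall>w\<in>W. key w = k \<longrightarrow> degree (\<rho> (ev_A p x)) \<le> degree (\<rho> w)))" for k
  have P: "ev_A (P k) x \<in> W \<and> key (ev_A (P k) x) = k \<and>
      (\<forall>w\<in>W. key w = k \<longrightarrow> degree (\<rho> (ev_A (P k) x)) \<le> degree (\<rho> w))" if "k \<in> key ` W" for k
    unfolding P_def by (rule someI_ex) (rule ex[OF that])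
  define D where "D = Max (insert 0 ((\<lambda>k. degree (P k)) ` key ` W))"
  have D: "degree (P k) \<le> D" if "k \<in> key ` W" for k
    unfolding D_def using fin that by (intro Max_ge) auto
  have span: "\<exists>p. degree p \<le> D \<and> w = ev_A p x" if "w \<in> W" for w
    using that
  proof (induction "degree (\<rho> w)" arbitrary: w rule: less_induct)
    case (less w)
    define k where "k = key w"
    have k: "k \<in> key ` W" using less.prems by (simp add: k_def)
    define s where "s = ev_A (P k) x"
    have s: "s \<in> W" "key s = k" "degree (\<rho> s) \<le> degree (\<rho> w)"
      using P[OF k] less.prems by (auto simp: s_def k_def)
    define m where "m = (degree (\<rho> w) - degree (\<rho> s)) div 2"
    have "degree (\<rho> s) mod 2 = degree (\<rho> w) mod 2" using s(2) by (simp add: key_def k_def)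
    hence m: "degree (\<rho> w) = degree (\<rho> s) + 2 * m" 
      unfolding m_def by (rule same_parity_diff) (rule s(3))
    define T where "T = (monom 1 m :: 'q poly)"
    have T: "T \<noteq> 0" "degree T = m" "lead_coeff T = 1" by (simp_all add: T_def degree_monom_eq monom_eq_0_iff)
    have sS: "s \<in> S" "w \<in> S" "\<iota> T * s \<in> S" using W_S s less.prems by (simp_all add: S_mult S_iota)
    have rs: "\<rho> (\<iota> T * s) = \<rho> s \<star>\<^bsub>q\<^esub> \<Phi> T" by (rule rho_iota_mult'[OF sS(1)])
    note N = tm_nonzero[OF rho_nz[OF s(1)] Phi_degree(1)[OF T(1)]]
    have lead: "coeff (\<rho> (\<iota> T * s)) (degree (\<rho> w)) = lead_coeff (\<rho> w)"
    proof -
      have "degree (\<rho> (\<iota> T * s)) = degree (\<rho> w)"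
        unfolding rs using N(2) Phi_degree(2)[OF T(1)] m T(2) by simp
      moreover have "lead_coeff (\<rho> (\<iota> T * s)) = lead_coeff (\<rho> s)"
        unfolding rs using N(3) Phi_degree(3)[OF T(1)] T(3) by (simp add: kappa_1)
      moreover have "lead_coeff (\<rho> s) = lead_coeff (\<rho> w)" using s(2) by (simp add: key_def k_def)
      ultimately show ?thesis by simp
    qed
    have deg: "degree (\<rho> (\<iota> T * s)) = degree (\<rho> w)"
      unfolding rs using N(2) Phi_degree(2)[OF T(1)] m T(2) by simp
    define w' where "w' = w - \<iota> T * s"
    have w'S: "w' \<in> S" unfolding w'_def by (intro S_diff sS)
    have rw': "\<rho> w' = \<rho> w - \<rho> (\<iota> T * s)" unfolding w'_def by (intro rho_diff sS)
    obtain r where r: "w = ev_A r x" using less.prems by (auto simp: W_def)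
    have w'_ev: "w' = ev_A (r - smult T (P k)) x"
      by (simp add: w'_def r s_def ev_A_diff ev_A_smult)
    have "\<exists>p. degree p \<le> D \<and> w' = ev_A p x"
    proof (cases "w' = 0")
      case True
      thus ?thesis by (intro exI[of _ 0]) simp
    next
      case False
      have "w' \<in> W" using False w'_ev by (auto simp: W_def)
      moreover have "degree (\<rho> w') < degree (\<rho> w)"
      proof -
        have "degree (\<rho> w') \<le> degree (\<rho> w)"
          unfolding rw' by (rule degree_diff_le) (simp_all add: deg)
        moreover have "coeff (\<rho> w') (degree (\<rho> w)) = 0" unfolding rw' using lead by simp
        moreover have "\<rho> w' \<noteq> 0" using rho_eq_0_iff[OF w'S] False by simp
        ultimately show ?thesis by (metis le_neq_implies_less leading_coeff_0_iff)
      qed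
      ultimately show ?thesis using less.hyps by blast
    qed
    then obtain p where p: "degree p \<le> D" "w' = ev_A p x" by blast
    have "degree (p + smult T (P k)) \<le> D"
      using p(1) D[OF k] by (intro degree_add_le) (auto intro: order_trans[OF degree_smult_le])
    moreover have "w = ev_A (p + smult T (P k)) x"
      using p(2) unfolding w'_def diff_eq_eq by (simp add: ev_A_add ev_A_smult s_def)
    ultimately show ?case by blast
  qed
  have "\<exists>p. degree p \<le> D \<and> x ^ Suc D = ev_A p x"
  proof (cases "x ^ Suc D = 0")
    case True
    thus ?thesis by (intro exI[of _ 0]) simp
  next
    case False
    have "x ^ Suc D = ev_A (monom 1 (Suc D)) x" by (simp add: ev_A_monom iota_1)
    hence "x ^ Suc D \<in> W" using False by (auto simp: W_def)
    thus ?thesis by (rule span)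
  qed
  then obtain p where p: "degree p \<le> D" "x ^ Suc D = ev_A p x" by blast
  define f where "f = monom 1 (Suc D) - p"
  have c: "coeff f (Suc D) = 1" using p(1) by (simp add: f_def coeff_eq_0)
  have "degree f \<le> Suc D" unfolding f_def using p(1) by (intro degree_diff_le) (auto simp: degree_monom_eq)
  moreover have "Suc D \<le> degree f" using c by (intro le_degree) simp
  ultimately have "degree f = Suc D" by simp
  hence "lead_coeff f = 1" using c by simp
  moreover have "ev_A f x = 0" using p(2) by (simp add: f_def ev_A_diff ev_A_monom iota_1)
  ultimately show ?thesis unfolding integral_over_A_iff by blast
qed

lemma S_divides_iota:
  assumes "x \<in> S" "x \<noteq> 0"
  obtains t a where "t \<in> S" "a \<noteq> 0" "x * t = \<iota> a"
proof -
  obtain p where p: "lead_coeff p = 1" "ev_A p x = 0"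
    using integral_S[OF assms(1)] unfolding integral_over_A_iff by blast
  have "p \<noteq> 0" using p(1) by auto
  then obtain r a where r: "a \<noteq> 0" "x * ev_A r x = \<iota> a" using algebraic_multiple[OF assms(2) _ p(2)] by blast
  show ?thesis by (rule that[OF S_ev_A[OF assms(1)] r])
qed

definition K :: "'c set" where "K = fraction_field S"

lemma KE:
  assumes "x \<in> K"
  obtains s a where "s \<in> S" "a \<noteq> 0" "x = s / \<iota> a"
proof -
  obtain u w where uw: "u \<in> S" "w \<in> S" "w \<noteq> 0" "x = u / w"
    using assms by (auto simp: K_def fraction_field_def)
  obtain t a where t: "t \<in> S" "a \<noteq> 0" "w * t = \<iota> a" using S_divides_iota[OF uw(2,3)] .
  have "t \<noteq> 0"
  proof
    assume "t = 0"
    hence "\<iota> a = 0" using t(3) by simp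
    thus False using iota_eq_0 t(2) by blast
  qed
  hence "x = (u * t) / \<iota> a" using uw by (simp flip: t(3))
  thus ?thesis by (rule that[OF S_mult[OF uw(1) t(1)] t(2)])
qed

lemma KI: "s \<in> S \<Longrightarrow> a \<noteq> 0 \<Longrightarrow> s / \<iota> a \<in> K"
  using S_iota[of a] iota_eq_0_iff[of a] unfolding K_def fraction_field_def mem_Collect_eq
  by (intro exI[of _ s] exI[of _ "\<iota> a"]) simp

lemma S_sub_K: "S \<subseteq> K"
proof
  fix x assume "x \<in> S"
  thus "x \<in> K" using KI[of x 1] by (simp add: iota_1)
qed

lemma K_diff: "x \<in> K \<Longrightarrow> y \<in> K \<Longrightarrow> x - y \<in> K"
proof -
  assume x: "x \<in> K" and y: "y \<in> K"
  obtain s a where s: "s \<in> S" "a \<noteq> 0" "x = s / \<iota> a" by (rule KE[OF x])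
  obtain t b where t: "t \<in> S" "b \<noteq> 0" "y = t / \<iota> b" by (rule KE[OF y])
  have nz: "\<iota> a \<noteq> 0" "\<iota> b \<noteq> 0" using s t by (simp_all add: iota_eq_0_iff)
  have "x - y = (\<iota> b * s - \<iota> a * t) / \<iota> (a * b)"
    unfolding s(3) t(3) iota_mult diff_frac_eq[OF nz] by (simp only: mult.commute)
  thus ?thesis using KI[of "\<iota> b * s - \<iota> a * t" "a * b"] s t S_diff S_mult S_iota by simp
qed

lemma K_mult: "x \<in> K \<Longrightarrow> y \<in> K \<Longrightarrow> x * y \<in> K"
proof -
  assume x: "x \<in> K" and y: "y \<in> K"
  obtain s a where s: "s \<in> S" "a \<noteq> 0" "x = s / \<iota> a" by (rule KE[OF x])
  obtain t b where t: "t \<in> S" "b \<noteq> 0" "y = t / \<iota> b" by (rule KE[OF y])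
  have "x * y = (s * t) / \<iota> (a * b)"
    using s t by (simp add: iota_mult)
  moreover have "(s * t) / \<iota> (a * b) \<in> K" by (rule KI) (use s t S_mult in simp_all)
  ultimately show ?thesis by (simp only:)
qed

lemma K_inverse: "x \<in> K \<Longrightarrow> inverse x \<in> K"
proof -
  assume "x \<in> K"
  then obtain s a where s: "s \<in> S" "a \<noteq> 0" "x = s / \<iota> a" by (rule KE)
  show ?thesis
  proof (cases "s = 0")
    case True
    thus ?thesis using s S_0 S_sub_K by auto
  next
    case False
    have "inverse x = \<iota> a / s" using s by simp
    thus ?thesis using False s(1) S_iota[of a] unfolding K_def fraction_field_def mem_Collect_eq
      by (intro exI[of _ "\<iota> a"] exI[of _ s]) simp
  qed
qed

lemma K_divide: "x \<in> K \<Longrightarrow> y \<in> K \<Longrightarrow> x / y \<in> K"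
  by (simp add: divide_inverse K_mult K_inverse)

end

text \<open>The order is as large as its action permits, so that divisibility by elements of
  \<open>A\<close> can be tested after reduction.\<close>

locale saturated = represented q \<kappa> \<theta> g \<pi> \<iota> S \<rho>
  for q :: nat and \<kappa> :: "'q::{field, finite} \<Rightarrow> 'f::field" and \<theta> g \<pi>
    and \<iota> :: "'q poly \<Rightarrow> 'c::field" and S \<rho> +
  assumes saturated: "a \<noteq> 0 \<Longrightarrow> \<iota> a * x \<in> S \<Longrightarrow> \<rho> (\<iota> a * x) = y \<star>\<^bsub>q\<^esub> \<Phi> a \<Longrightarrow> x \<in> S"
begin

lemma saturated_rho:
  assumes "a \<noteq> 0" "\<iota> a * x \<in> S" "\<rho> (\<iota> a * x) = y \<star>\<^bsub>q\<^esub> \<Phi> a"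
  shows "x \<in> S" "\<rho> x = y"
proof -
  show x: "x \<in> S" by (rule saturated[OF assms])
  show "\<rho> x = y"
    using assms(3) tm_right_cancel[OF _ Phi_degree(1)[OF assms(1)]] by (simp add: rho_iota_mult'[OF x])
qed

end

context represented
begin

text \<open>The fractions of \<open>S\<close> whose image is an endomorphism and not only a
  fraction of one. This enlargement replaces the maximal order, which need not act on the reduced
  module.\<close>

definition S_sat :: "'c set"
  where "S_sat = {x. \<exists>a y. a \<noteq> 0 \<and> \<iota> a * x \<in> S \<and> \<rho> (\<iota> a * x) = y \<star>\<^bsub>q\<^esub> \<Phi> a}"

definition rho_sat :: "'c \<Rightarrow> 'f poly"
  where "rho_sat x = (THE y. \<exists>a. a \<noteq> 0 \<and> \<iota> a * x \<in> S \<and> \<rho> (\<iota> a * x) = y \<star>\<^bsub>q\<^esub> \<Phi> a)"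

lemma sat_End:
  assumes "a \<noteq> 0" "\<iota> a * x \<in> S" "\<rho> (\<iota> a * x) = y \<star>\<^bsub>q\<^esub> \<Phi> a"
  shows "y \<in> End"
  using End_right_quotient[of y a] rho_End[OF assms(2)] assms by simp

lemma sat_unique:
  assumes "a \<noteq> 0" "\<iota> a * x \<in> S" "\<rho> (\<iota> a * x) = y \<star>\<^bsub>q\<^esub> \<Phi> a"
    and "b \<noteq> 0" "\<iota> b * x \<in> S" "\<rho> (\<iota> b * x) = z \<star>\<^bsub>q\<^esub> \<Phi> b"
  shows "y = z"
proof -
  have "y \<star>\<^bsub>q\<^esub> \<Phi> (a * b) = \<rho> (\<iota> b * (\<iota> a * x))"
    unfolding rho_iota_mult'[OF assms(2)] assms(3) dmod_mult by (rule tm_assoc[symmetric])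
  also have "\<iota> b * (\<iota> a * x) = \<iota> a * (\<iota> b * x)" by (rule mult.left_commute)
  also have "\<rho> (\<iota> a * (\<iota> b * x)) = z \<star>\<^bsub>q\<^esub> \<Phi> (b * a)"
    unfolding rho_iota_mult'[OF assms(5)] assms(6) dmod_mult by (rule tm_assoc)
  finally show ?thesis
    using tm_right_cancel[OF _ Phi_degree(1), of y "a * b" z] assms(1,4) by (simp add: mult.commute)
qed

lemma rho_sat_eq:
  assumes "a \<noteq> 0" "\<iota> a * x \<in> S" "\<rho> (\<iota> a * x) = y \<star>\<^bsub>q\<^esub> \<Phi> a"
  shows "x \<in> S_sat" "rho_sat x = y"
proof -
  show "x \<in> S_sat" using assms unfolding S_sat_def by blast
  show "rho_sat x = y"
    unfolding rho_sat_def
  proof (rule the_equality)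
    show "\<exists>a. a \<noteq> 0 \<and> \<iota> a * x \<in> S \<and> \<rho> (\<iota> a * x) = y \<star>\<^bsub>q\<^esub> \<Phi> a" using assms by blast
    fix z assume "\<exists>a. a \<noteq> 0 \<and> \<iota> a * x \<in> S \<and> \<rho> (\<iota> a * x) = z \<star>\<^bsub>q\<^esub> \<Phi> a"
    then obtain b where "b \<noteq> 0" "\<iota> b * x \<in> S" "\<rho> (\<iota> b * x) = z \<star>\<^bsub>q\<^esub> \<Phi> b" by blast
    from sat_unique[OF this assms] show "z = y" .
  qed
qed

lemma S_satE:
  assumes "x \<in> S_sat"
  obtains a where "a \<noteq> 0" "\<iota> a * x \<in> S" "\<rho> (\<iota> a * x) = rho_sat x \<star>\<^bsub>q\<^esub> \<Phi> a"
proof -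
  obtain a y where a: "a \<noteq> 0" "\<iota> a * x \<in> S" "\<rho> (\<iota> a * x) = y \<star>\<^bsub>q\<^esub> \<Phi> a"
    using assms unfolding S_sat_def by blast
  thus ?thesis using that rho_sat_eq(2)[OF a] by simp
qed

lemma sat_S: "x \<in> S \<Longrightarrow> x \<in> S_sat \<and> rho_sat x = \<rho> x"
  using rho_sat_eq[of 1 x "\<rho> x"] by (simp add: iota_1)

lemma saturation: "saturated q \<kappa> \<theta> g \<pi> \<iota> S_sat rho_sat"
proof (intro saturated.intro represented.intro represented_axioms.intro saturated_axioms.intro)
  show "reduced_module q \<kappa> \<theta> \<pi>" by (rule reduced_module_axioms)
  show "A_algebra \<iota>" by (rule A_algebra_axioms)
next
  show "\<iota> a \<in> S_sat" "rho_sat (\<iota> a) = \<Phi> a" for a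
    using sat_S[OF S_iota[of a]] by (simp_all add: rho_iota)
  fix x assume x: "x \<in> S_sat"
  obtain a where a: "a \<noteq> 0" "\<iota> a * x \<in> S" "\<rho> (\<iota> a * x) = rho_sat x \<star>\<^bsub>q\<^esub> \<Phi> a" by (rule S_satE[OF x])
  show x_End: "rho_sat x \<in> End" by (rule sat_End[OF a])
  show "x = 0" if "rho_sat x = 0"
    using rho_eq_0[OF a(2)] a(1,3) that by (simp add: iota_eq_0_iff)
  fix y assume y: "y \<in> S_sat"
  obtain b where b: "b \<noteq> 0" "\<iota> b * y \<in> S" "\<rho> (\<iota> b * y) = rho_sat y \<star>\<^bsub>q\<^esub> \<Phi> b" by (rule S_satE[OF y])
  have y_End: "rho_sat y \<in> End" by (rule sat_End[OF b])
  have ab: "a * b \<noteq> 0" using a b by simp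
  have eq: "\<iota> (a * b) * (x - y) = \<iota> b * (\<iota> a * x) - \<iota> a * (\<iota> b * y)"
    by (simp add: iota_mult algebra_simps)
  have in_S: "\<iota> b * (\<iota> a * x) \<in> S" "\<iota> a * (\<iota> b * y) \<in> S" using a b S_mult S_iota by blast+
  have "\<rho> (\<iota> b * (\<iota> a * x)) = rho_sat x \<star>\<^bsub>q\<^esub> \<Phi> (a * b)"
    unfolding rho_iota_mult'[OF a(2)] a(3) dmod_mult by (rule tm_assoc)
  moreover have "\<rho> (\<iota> a * (\<iota> b * y)) = rho_sat y \<star>\<^bsub>q\<^esub> \<Phi> (a * b)"
    unfolding rho_iota_mult'[OF b(2)] b(3) mult.commute[of a b] dmod_mult by (rule tm_assoc)
  ultimately have D: "\<rho> (\<iota> (a * b) * (x - y)) = (rho_sat x - rho_sat y) \<star>\<^bsub>q\<^esub> \<Phi> (a * b)"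
    unfolding eq rho_diff[OF in_S] by (simp only: tm_diff_left)
  have DS: "\<iota> (a * b) * (x - y) \<in> S" unfolding eq by (intro S_diff in_S)
  show "x - y \<in> S_sat" "rho_sat (x - y) = rho_sat x - rho_sat y" by (rule rho_sat_eq[OF ab DS D])+
  have eq': "\<iota> (a * b) * (x * y) = (\<iota> a * x) * (\<iota> b * y)" by (simp add: iota_mult)
  have MS: "\<iota> (a * b) * (x * y) \<in> S" unfolding eq' by (intro S_mult a b)
  have "\<rho> ((\<iota> a * x) * (\<iota> b * y)) = (rho_sat x \<star>\<^bsub>q\<^esub> \<Phi> a) \<star>\<^bsub>q\<^esub> (rho_sat y \<star>\<^bsub>q\<^esub> \<Phi> b)"
    unfolding rho_mult[OF a(2) b(2)] a(3) b(3) ..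
  also have "\<dots> = rho_sat x \<star>\<^bsub>q\<^esub> ((\<Phi> a \<star>\<^bsub>q\<^esub> rho_sat y) \<star>\<^bsub>q\<^esub> \<Phi> b)" by (simp only: tm_assoc)
  also have "\<dots> = (rho_sat x \<star>\<^bsub>q\<^esub> rho_sat y) \<star>\<^bsub>q\<^esub> \<Phi> (a * b)"
    unfolding End_commute[OF y_End, symmetric] by (simp only: dmod_mult tm_assoc)
  finally have M: "\<rho> (\<iota> (a * b) * (x * y)) = (rho_sat x \<star>\<^bsub>q\<^esub> rho_sat y) \<star>\<^bsub>q\<^esub> \<Phi> (a * b)"
    unfolding eq' .
  show "x * y \<in> S_sat" "rho_sat (x * y) = rho_sat x \<star>\<^bsub>q\<^esub> rho_sat y" by (rule rho_sat_eq[OF ab MS M])+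
next
  fix a x y assume a: "a \<noteq> 0" "\<iota> a * x \<in> S_sat" and r: "rho_sat (\<iota> a * x) = y \<star>\<^bsub>q\<^esub> \<Phi> a"
  obtain b where b: "b \<noteq> 0" "\<iota> b * (\<iota> a * x) \<in> S"
    "\<rho> (\<iota> b * (\<iota> a * x)) = rho_sat (\<iota> a * x) \<star>\<^bsub>q\<^esub> \<Phi> b" by (rule S_satE[OF a(2)])
  have ba: "a * b \<noteq> 0" using a b by simp
  have eq: "\<iota> b * (\<iota> a * x) = \<iota> (a * b) * x" by (simp add: iota_mult)
  have "\<rho> (\<iota> (a * b) * x) = y \<star>\<^bsub>q\<^esub> \<Phi> (a * b)"
    using b(3) unfolding eq r dmod_mult tm_assoc .
  thus "x \<in> S_sat" using rho_sat_eq(1)[OF ba _ , of x y] b(2) unfolding eq by blast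
qed

lemma fraction_field_sat: "fraction_field S_sat = fraction_field S"
proof
  interpret sat: saturated q \<kappa> \<theta> g \<pi> \<iota> S_sat rho_sat by (rule saturation)
  show "fraction_field S \<subseteq> fraction_field S_sat"
    unfolding fraction_field_def using sat_S by blast
  show "fraction_field S_sat \<subseteq> fraction_field S"
  proof
    fix x assume "x \<in> fraction_field S_sat"
    hence "x \<in> sat.K" by (simp add: sat.K_def)
    then obtain s a where s: "s \<in> S_sat" "a \<noteq> 0" "x = s / \<iota> a" by (rule sat.KE)
    obtain b where b: "b \<noteq> 0" "\<iota> b * s \<in> S" "\<rho> (\<iota> b * s) = rho_sat s \<star>\<^bsub>q\<^esub> \<Phi> b"
      by (rule S_satE[OF s(1)])
    have "x = (\<iota> b * s) / \<iota> (b * a)" using s b by (simp add: iota_mult iota_eq_0_iff)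
    thus "x \<in> fraction_field S" using KI[OF b(2), of "b * a"] b s by (simp add: K_def)
  qed
qed

end

section \<open>Supersingular reduction\<close>

context saturated
begin

text \<open>The order of vanishing of \<open>\<rho>\<close>, extended from \<open>S\<close> to its
  fraction field: a valuation above \<open>\<pi>\<close>.\<close>

definition val :: "'c \<Rightarrow> int"
  where "val x = (SOME v. \<exists>s a. s \<in> S \<and> a \<noteq> 0 \<and> x = s / \<iota> a \<and> v = int (tord (\<rho> s)) - int (tord (\<Phi> a)))"

lemma tord_iota_mult:
  assumes "s \<in> S" "s \<noteq> 0" "a \<noteq> 0"
  shows "tord (\<rho> (\<iota> a * s)) = tord (\<Phi> a) + tord (\<rho> s)"
proof -
  have "\<rho> s \<noteq> 0" using rho_eq_0_iff[OF assms(1)] assms(2) by simp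
  from tm_nonzero(4)[OF Phi_degree(1)[OF assms(3)] this] show ?thesis
    by (simp only: rho_iota_mult[OF assms(1)])
qed

lemma val_eq:
  assumes "s \<in> S" "s \<noteq> 0" "a \<noteq> 0"
  shows "val (s / \<iota> a) = int (tord (\<rho> s)) - int (tord (\<Phi> a))"
proof -
  let ?P = "\<lambda>v. \<exists>t b. t \<in> S \<and> b \<noteq> 0 \<and> s / \<iota> a = t / \<iota> b \<and> v = int (tord (\<rho> t)) - int (tord (\<Phi> b))"
  have "?P (int (tord (\<rho> s)) - int (tord (\<Phi> a)))"
    by (intro exI[of _ s] exI[of _ a]) (use assms in simp)
  hence "?P (val (s / \<iota> a))" unfolding val_def by (rule someI)
  then obtain t b where t: "t \<in> S" "b \<noteq> 0" "s / \<iota> a = t / \<iota> b"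
    and v: "val (s / \<iota> a) = int (tord (\<rho> t)) - int (tord (\<Phi> b))" by blast
  have nz: "\<iota> a \<noteq> 0" "\<iota> b \<noteq> 0" using assms(3) t(2) iota_eq_0 by blast+
  have t0: "t \<noteq> 0"
  proof
    assume "t = 0"
    hence "s / \<iota> a = 0" using t(3) by simp
    thus False using nz assms(2) by simp
  qed
  have "\<iota> b * s = \<iota> a * t" using t(3) nz by (simp add: frac_eq_eq mult.commute)
  hence "tord (\<rho> (\<iota> b * s)) = tord (\<rho> (\<iota> a * t))" by (rule arg_cong)
  hence "tord (\<Phi> b) + tord (\<rho> s) = tord (\<Phi> a) + tord (\<rho> t)"
    unfolding tord_iota_mult[OF assms(1,2) t(2)] tord_iota_mult[OF t(1) t0 assms(3)] .
  thus ?thesis unfolding v by linarith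
qed

definition val_ge :: "int \<Rightarrow> 'c \<Rightarrow> bool" where "val_ge m x \<longleftrightarrow> x = 0 \<or> m \<le> val x"

lemma low_iff_tord: "u \<noteq> 0 \<Longrightarrow> low k u \<longleftrightarrow> k \<le> tord u"
  using low_le_tord[of u k] low_mono[OF low_tord[of u], of k] by iprover

lemma val_ge_iff:
  assumes "s \<in> S" "a \<noteq> 0"
  shows "val_ge m (s / \<iota> a) \<longleftrightarrow> low (nat (m + int (tord (\<Phi> a)))) (\<rho> s)"
proof (cases "s = 0")
  case True
  thus ?thesis by (simp add: val_ge_def rho_0)
next
  case False
  have nz: "\<rho> s \<noteq> 0" using rho_eq_0_iff[OF assms(1)] False by simp
  have "s / \<iota> a \<noteq> 0" using False iota_eq_0[of a] assms(2) by auto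
  hence "val_ge m (s / \<iota> a) \<longleftrightarrow> m \<le> int (tord (\<rho> s)) - int (tord (\<Phi> a))"
    unfolding val_ge_def val_eq[OF assms(1) False assms(2)] by simp
  also have "\<dots> \<longleftrightarrow> nat (m + int (tord (\<Phi> a))) \<le> tord (\<rho> s)" by linarith
  finally show ?thesis unfolding low_iff_tord[OF nz] .
qed

lemma common_denominator:
  assumes "x \<in> K" "y \<in> K"
  obtains s t a where "s \<in> S" "t \<in> S" "a \<noteq> 0" "x = s / \<iota> a" "y = t / \<iota> a"
proof -
  obtain s a where s: "s \<in> S" "a \<noteq> 0" "x = s / \<iota> a" by (rule KE[OF assms(1)])
  obtain t b where t: "t \<in> S" "b \<noteq> 0" "y = t / \<iota> b" by (rule KE[OF assms(2)])
  have nz: "\<iota> a \<noteq> 0" "\<iota> b \<noteq> 0" using s t iota_eq_0 by blast+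
  show ?thesis
  proof (rule that[of "\<iota> b * s" "\<iota> a * t" "a * b"])
    show "\<iota> b * s \<in> S" "\<iota> a * t \<in> S" using s t by (simp_all add: S_mult S_iota)
    show "a * b \<noteq> 0" using s t by simp
    show "x = \<iota> b * s / \<iota> (a * b)" "y = \<iota> a * t / \<iota> (a * b)"
      unfolding s(3) t(3) iota_mult using nz by simp_all
  qed
qed

lemma val_ge_diff:
  assumes "x \<in> K" "y \<in> K" "val_ge m x" "val_ge m y"
  shows "val_ge m (x - y)"
proof -
  obtain s t a where st: "s \<in> S" "t \<in> S" "a \<noteq> 0" and x: "x = s / \<iota> a" and y: "y = t / \<iota> a"
    by (rule common_denominator[OF assms(1,2)])
  have "x - y = (s - t) / \<iota> a" by (simp add: x y diff_divide_distrib)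
  moreover have "low (nat (m + int (tord (\<Phi> a)))) (\<rho> s)" "low (nat (m + int (tord (\<Phi> a)))) (\<rho> t)"
    using assms(3,4) val_ge_iff[OF st(1,3)] val_ge_iff[OF st(2,3)] by (simp_all add: x y)
  ultimately show ?thesis
    using val_ge_iff[OF S_diff[OF st(1,2)] st(3)] by (simp add: rho_diff[OF st(1,2)] low_diff)
qed

lemma val_mult:
  assumes "x \<in> K" "y \<in> K" "x \<noteq> 0" "y \<noteq> 0"
  shows "val (x * y) = val x + val y"
proof -
  obtain s a where s: "s \<in> S" "a \<noteq> 0" "x = s / \<iota> a" by (rule KE[OF assms(1)])
  obtain t b where t: "t \<in> S" "b \<noteq> 0" "y = t / \<iota> b" by (rule KE[OF assms(2)])
  have s0: "s \<noteq> 0" "t \<noteq> 0" using assms(3,4) s(3) t(3) by auto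
  have r0: "\<rho> s \<noteq> 0" "\<rho> t \<noteq> 0" using rho_eq_0_iff s(1) t(1) s0 by simp_all
  have ab: "a * b \<noteq> 0" "s * t \<noteq> 0" using s t s0 by simp_all
  have "x * y = (s * t) / \<iota> (a * b)" by (simp add: s t iota_mult)
  hence "val (x * y) = int (tord (\<rho> (s * t))) - int (tord (\<Phi> (a * b)))"
    using val_eq[OF S_mult[OF s(1) t(1)] ab(2,1)] by simp
  also have "\<rho> (s * t) = \<rho> s \<star>\<^bsub>q\<^esub> \<rho> t" by (rule rho_mult[OF s(1) t(1)])
  also have "tord (\<rho> s \<star>\<^bsub>q\<^esub> \<rho> t) = tord (\<rho> s) + tord (\<rho> t)" by (rule tm_nonzero(4)[OF r0])
  also have "tord (\<Phi> (a * b)) = tord (\<Phi> a) + tord (\<Phi> b)"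
    unfolding dmod_mult by (rule tm_nonzero(4)[OF Phi_degree(1)[OF s(2)] Phi_degree(1)[OF t(2)]])
  finally show ?thesis
    using val_eq[OF s(1) s0(1) s(2)] val_eq[OF t(1) s0(2) t(2)] by (simp add: s(3) t(3))
qed

lemma iota_in_K: "\<iota> a \<in> K" using S_iota S_sub_K by blast

lemma val_iota: "a \<noteq> 0 \<Longrightarrow> val (\<iota> a) = int (tord (\<Phi> a))"
proof -
  assume a: "a \<noteq> 0"
  have "\<iota> a \<noteq> 0" using a iota_eq_0 by blast
  from val_eq[OF S_iota this, of 1] have "val (\<iota> a) = int (tord (\<Phi> a)) - int (tord (\<Phi> 1))"
    by (simp only: rho_iota iota_1 div_by_1 one_neq_zero simp_thms)
  moreover have "tord (\<Phi> 1) = 0" by (rule Phi_tord_0[OF not_pi_dvd_1])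
  ultimately show ?thesis by simp
qed

lemma d_dvd_val:
  assumes "x \<in> K" "x \<noteq> 0"
  shows "int d dvd val x"
proof -
  obtain s a where s: "s \<in> S" "a \<noteq> 0" "x = s / \<iota> a" by (rule KE[OF assms(1)])
  have s0: "s \<noteq> 0" using assms(2) s(3) by auto
  have "d dvd tord (\<rho> s)" "d dvd tord (\<Phi> a)"
    using End_tord_dvd[OF rho_End[OF s(1)]] End_tord_dvd[OF End_Phi Phi_degree(1)[OF s(2)]]
      rho_eq_0_iff[OF s(1)] s0 by simp_all
  thus ?thesis unfolding s(3) val_eq[OF s(1) s0 s(2)] by (intro dvd_diff) simp_all
qed

lemma tord_rho_power:
  assumes "s \<in> S" "s \<noteq> 0"
  shows "tord (\<rho> (s ^ n)) = n * tord (\<rho> s)"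
proof (induction n)
  case 0
  have "coeff (1 :: 'f poly) 0 \<noteq> 0" by simp
  thus ?case using tord_eqI[of 0 "1 :: 'f poly"] by (simp add: rho_1)
next
  case (Suc n)
  have "\<rho> s \<noteq> 0" "\<rho> (s ^ n) \<noteq> 0"
    using rho_eq_0_iff[OF assms(1)] rho_eq_0_iff[OF S_power[OF assms(1), of n]] assms(2) by simp_all
  from tm_nonzero(4)[OF this] show ?case
    using Suc by (simp add: rho_mult[OF assms(1) S_power[OF assms(1)]])
qed

text \<open>In an equation of integral dependence for an element of negative valuation, the top
  power would be the only term of least valuation.\<close>

lemma integral_val_ge:
  assumes x: "x \<in> K" and int: "integral_over_A \<iota> x"
  shows "val_ge 0 x"
proof -
  obtain s a where s: "s \<in> S" "a \<noteq> 0" "x = s / \<iota> a" by (rule KE[OF x])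
  define t where "t = tord (\<rho> s)"
  define A where "A = tord (\<Phi> a)"
  have a0: "\<iota> a \<noteq> 0" using s(2) iota_eq_0 by blast
  show ?thesis
  proof (rule ccontr)
    assume neg: "\<not> val_ge 0 x"
    hence s0: "s \<noteq> 0" using s(3) by (auto simp: val_ge_def)
    have "\<rho> s \<noteq> 0" using rho_eq_0_iff[OF s(1)] s0 by simp
    hence tA: "t < A" using neg unfolding s(3) val_ge_iff[OF s(1,2)] by (simp add: low_iff_tord t_def A_def)
    obtain p where p: "lead_coeff p = 1" "ev_A p x = 0" using int unfolding integral_over_A_iff by blast
    define n where "n = degree p"
    have n: "n > 0" "x ^ n = (\<Sum>i<n. \<iota> (- coeff p i) * x ^ i)"
      using integral_power_reduce[OF p] by (simp_all add: n_def)
    define c where "c i = - coeff p i * a ^ (n - i)" for i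
    have "s ^ n = \<iota> a ^ n * x ^ n" using a0 by (simp add: s(3) power_divide)
    also have "\<dots> = (\<Sum>i<n. \<iota> (c i) * s ^ i)"
      unfolding n(2) sum_distrib_left
    proof (rule sum.cong[OF refl])
      fix i assume "i \<in> {..<n}"
      hence "\<iota> a ^ n = \<iota> a ^ (n - i) * \<iota> a ^ i" by (simp flip: power_add)
      moreover have "\<iota> a ^ i * x ^ i = s ^ i" using a0 by (simp add: s(3) power_divide)
      ultimately show "\<iota> a ^ n * (\<iota> (- coeff p i) * x ^ i) = \<iota> (c i) * s ^ i"
        unfolding c_def iota_mult iota_power by (simp only: ac_simps) (metis mult.assoc mult.commute)
    qed
    finally have "\<rho> (s ^ n) = \<rho> (\<Sum>i<n. \<iota> (c i) * s ^ i)" by (rule arg_cong)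
    also have "\<dots> = (\<Sum>i<n. \<rho> (\<iota> (c i) * s ^ i))"
      by (rule rho_sum) (intro S_mult S_iota S_power s)
    finally have eq: "\<rho> (s ^ n) = (\<Sum>i<n. \<rho> (\<iota> (c i) * s ^ i))" .
    have lowi: "low (Suc (n * t)) (\<rho> (\<iota> (c i) * s ^ i))" if i: "i < n" for i
    proof -
      have "low (0 + (n - i) * A) (\<Phi> (- coeff p i) \<star>\<^bsub>q\<^esub> \<Phi> (a ^ (n - i)))"
      proof (rule coeff_tm_low(1)[OF low_0(1)])
        have "tord (\<Phi> (a ^ (n - i))) = (n - i) * A"
          using tord_rho_power[OF S_iota a0, of "n - i"] by (simp only: rho_iota A_def flip: iota_power)
        thus "low ((n - i) * A) (\<Phi> (a ^ (n - i)))" using low_tord[of "\<Phi> (a ^ (n - i))"] by (simp only:)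
      qed
      hence l1: "low ((n - i) * A) (\<Phi> (c i))" by (simp add: c_def dmod_mult del: mult_minus_left)
      have l2: "low (i * t) (\<rho> (s ^ i))"
        using low_tord[of "\<rho> (s ^ i)"] by (simp add: tord_rho_power[OF s(1) s0] t_def)
      have "(n - i) * (t + 1) \<le> (n - i) * A" using tA by (intro mult_le_mono2) simp
      moreover have "(n - i) * (t + 1) + i * t = n * t + (n - i)"
      proof -
        obtain j where "n = i + j" using le_Suc_ex[OF less_imp_le[OF i]] by blast
        thus ?thesis by (simp add: algebra_simps)
      qed
      ultimately have le: "Suc (n * t) \<le> (n - i) * A + i * t" using i by linarith
      show ?thesis
        unfolding rho_iota_mult[OF S_power[OF s(1)]] by (rule low_mono[OF coeff_tm_low(1)[OF l1 l2] le])
    qed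
    have low_sum: "low (Suc (n * t)) (sum h I)" if "\<And>i. i \<in> I \<Longrightarrow> low (Suc (n * t)) (h i)" for h :: "nat \<Rightarrow> 'f poly" and I
      using that by (induction I rule: infinite_finite_induct) (auto intro: low_add)
    have "low (Suc (n * t)) (\<rho> (s ^ n))" unfolding eq by (rule low_sum) (simp add: lowi)
    moreover have "\<rho> (s ^ n) \<noteq> 0" using rho_eq_0_iff[OF S_power[OF s(1), of n]] s0 by simp
    ultimately have "Suc (n * t) \<le> tord (\<rho> (s ^ n))" by (simp only: low_iff_tord simp_thms)
    thus False by (simp add: tord_rho_power[OF s(1) s0] t_def)
  qed
qed

definition \<O>\<^sub>K :: "'c set" where "\<O>\<^sub>K = integral_closure_in \<iota> K"

lemma OK_iff: "x \<in> \<O>\<^sub>K \<longleftrightarrow> x \<in> K \<and> integral_over_A \<iota> x"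
  by (simp add: \<O>\<^sub>K_def integral_closure_in_def)

lemma S_sub_OK: "x \<in> S \<Longrightarrow> x \<in> \<O>\<^sub>K"
  using S_sub_K integral_S by (auto simp: OK_iff)

lemma OK_diff: "x \<in> \<O>\<^sub>K \<Longrightarrow> y \<in> \<O>\<^sub>K \<Longrightarrow> x - y \<in> \<O>\<^sub>K"
  and OK_mult: "x \<in> \<O>\<^sub>K \<Longrightarrow> y \<in> \<O>\<^sub>K \<Longrightarrow> x * y \<in> \<O>\<^sub>K"
  by (simp_all add: OK_iff K_diff K_mult integral_closed)

lemma OK_iota: "\<iota> a \<in> \<O>\<^sub>K" using S_sub_OK[OF S_iota] .

lemma OK_add: "x \<in> \<O>\<^sub>K \<Longrightarrow> y \<in> \<O>\<^sub>K \<Longrightarrow> x + y \<in> \<O>\<^sub>K"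
  using OK_diff[of x "0 - y"] OK_diff[OF OK_iota[of 0], of y] by (simp add: iota_0)

lemma cring_OK: "cring (subring_on \<O>\<^sub>K)"
  by (rule cring_subring_on) (use OK_iota[of 1] in \<open>simp_all add: iota_1 OK_diff OK_mult\<close>)

lemma extended_ideal_eq: "extended_ideal \<iota> K {a. \<pi> dvd a} = {\<iota> \<pi> * x |x. x \<in> \<O>\<^sub>K}"
proof -
  let ?J = "{\<iota> \<pi> * x |x. x \<in> \<O>\<^sub>K}"
  have J: "ideal ?J (subring_on \<O>\<^sub>K)"
  proof (rule ideal_subring_onI[OF cring_OK])
    show "?J \<subseteq> \<O>\<^sub>K" using OK_mult[OF OK_iota] by blast
    have "\<iota> \<pi> * \<iota> 0 \<in> ?J" using OK_iota by blast
    thus "0 \<in> ?J" by (simp add: iota_0)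
    fix x y assume "y \<in> ?J"
    then obtain y' where y: "y = \<iota> \<pi> * y'" "y' \<in> \<O>\<^sub>K" by blast
    show "x * y \<in> ?J" if xO: "x \<in> \<O>\<^sub>K"
    proof -
      have "x * y = \<iota> \<pi> * (x * y')" unfolding y by (rule mult.left_commute)
      thus ?thesis using OK_mult[OF xO y(2)] by blast
    qed
    show "x - y \<in> ?J" if xJ: "x \<in> ?J"
    proof -
      obtain x' where x: "x = \<iota> \<pi> * x'" "x' \<in> \<O>\<^sub>K" using xJ by blast
      have "x - y = \<iota> \<pi> * (x' - y')" unfolding x y by (simp only: right_diff_distrib)
      thus ?thesis using OK_diff[OF x(2) y(2)] by blast
    qed
  qed
  have sub: "\<iota> ` {a. \<pi> dvd a} \<subseteq> ?J"
  proof (rule image_subsetI)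
    fix a assume "a \<in> {a. \<pi> dvd a}"
    then obtain b where a: "a = \<pi> * b" by (auto simp: dvd_def)
    have "\<iota> a = \<iota> \<pi> * \<iota> b" unfolding a by (rule iota_mult)
    thus "\<iota> a \<in> ?J" using OK_iota[of b] by blast
  qed
  show ?thesis
    unfolding extended_ideal_def genideal_def \<O>\<^sub>K_def[symmetric]
  proof (rule equalityI)
    show "\<Inter>{I. ideal I (subring_on \<O>\<^sub>K) \<and> \<iota> ` {a. \<pi> dvd a} \<subseteq> I} \<subseteq> ?J" using J sub by blast
    show "?J \<subseteq> \<Inter>{I. ideal I (subring_on \<O>\<^sub>K) \<and> \<iota> ` {a. \<pi> dvd a} \<subseteq> I}"
    proof clarify
      fix x I assume x: "x \<in> \<O>\<^sub>K" and I: "ideal I (subring_on \<O>\<^sub>K)" and PI: "\<iota> ` {a. \<pi> dvd a} \<subseteq> I"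
      have "\<iota> \<pi> \<in> I" by (rule subsetD[OF PI]) simp
      from ideal.I_r_closed[OF I this, of x] x show "\<iota> \<pi> * x \<in> I" by simp
    qed
  qed
qed

context
  assumes supersingular: "tord (\<Phi> \<pi>) = 2 * d"
begin

text \<open>In the supersingular case \<open>\<Phi> (\<pi> ^ h)\<close> is a monomial in
  \<open>\<tau>\<close>, so an order of vanishing is the same as divisibility by it. Up to
  denominators prime to \<open>\<pi>\<close>, the saturated order is therefore the whole valuation
  ring.\<close>

lemma val_nonneg_locally_integral:
  assumes x: "x \<in> K" "val_ge 0 x"
  obtains b where "\<not> \<pi> dvd b" "\<iota> b * x \<in> S"
proof -
  obtain s a where s: "s \<in> S" "a \<noteq> 0" "x = s / \<iota> a" by (rule KE[OF x(1)])
  obtain h b where hb: "a = \<pi> ^ h * b" "\<not> \<pi> dvd b" using pi_power_decomp[OF s(2)] by blast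
  have p: "\<pi> ^ h \<noteq> 0" and b0: "b \<noteq> 0" using pi_nz hb s(2) by auto
  define P where "P = \<Phi> (\<pi> ^ h)"
  have P: "P \<noteq> 0" "tord P = h * (2 * d)" "degree P = h * (2 * d)"
    using Phi_degree[OF p] Phi_pi_power[of h] supersingular
    by (simp_all add: P_def degree_power_eq pi_nz d_def)
  have "tord (\<Phi> a) = tord P"
    using tm_nonzero(4)[OF Phi_degree(1)[OF p] Phi_degree(1)[OF b0]] Phi_tord_0[OF hb(2)]
    by (simp add: hb(1) dmod_mult P_def)
  moreover have "low (tord (\<Phi> a)) (\<rho> s)"
    using x(2) unfolding s(3) val_ge_iff[OF s(1,2)] by simp
  ultimately have low: "low (h * (2 * d)) (\<rho> s)" by (simp only: P(2))
  have Pm: "P = monom (lead_coeff P) (h * (2 * d))"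
  proof (rule poly_eqI)
    fix i
    have "coeff P i = 0" if "i < h * (2 * d)" using low_tord[of P] that unfolding P(2) low_def by blast
    moreover have "coeff P i = 0" if "i > h * (2 * d)" using that P(3) by (simp add: coeff_eq_0)
    ultimately show "coeff P i = coeff (monom (lead_coeff P) (h * (2 * d))) i"
      using P(3) by (cases i "h * (2 * d)" rule: linorder_cases) simp_all
  qed
  have "lead_coeff P \<noteq> 0" using P(1) by simp
  then obtain y where "\<rho> s = y \<star>\<^bsub>q\<^esub> monom (lead_coeff P) (h * (2 * d))"
    by (rule tm_monom_divides[OF low])
  hence "\<rho> s = y \<star>\<^bsub>q\<^esub> P" by (subst Pm)
  hence y: "\<rho> s = y \<star>\<^bsub>q\<^esub> \<Phi> (\<pi> ^ h)" by (simp only: P_def)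
  have nz: "\<iota> (\<pi> ^ h) \<noteq> 0" "\<iota> b \<noteq> 0" using p b0 iota_eq_0 by blast+
  have eq: "\<iota> (\<pi> ^ h) * (\<iota> b * x) = s"
    unfolding s(3) hb(1) iota_mult using nz by simp
  have "\<iota> b * x \<in> S" by (rule saturated[OF p]) (simp_all only: eq s(1) y)
  thus ?thesis by (rule that[OF hb(2)])
qed

lemma val_ge_2d_divisible:
  assumes x: "x \<in> \<O>\<^sub>K" "val_ge (2 * int d) x"
  obtains y where "y \<in> \<O>\<^sub>K" "x = \<iota> \<pi> * y"
proof -
  have xK: "x \<in> K" using x(1) by (simp add: OK_iff)
  have p0: "\<iota> \<pi> \<noteq> 0" using pi_nz iota_eq_0 by blast
  have "val_ge 0 (x / \<iota> \<pi>)"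
  proof (cases "x = 0")
    case False
    define z where "z = x / \<iota> \<pi>"
    have z: "z \<in> K" "z \<noteq> 0" "x = \<iota> \<pi> * z"
      using False p0 K_divide[OF xK iota_in_K] by (simp_all add: z_def)
    have "val x = val (\<iota> \<pi>) + val z" unfolding z(3) by (rule val_mult[OF iota_in_K z(1) p0 z(2)])
    thus ?thesis using x(2) False val_iota[OF pi_nz] supersingular
      by (simp add: val_ge_def z_def)
  qed (simp add: val_ge_def)
  then obtain b where b: "\<not> \<pi> dvd b" "\<iota> b * (x / \<iota> \<pi>) \<in> S"
    by (rule val_nonneg_locally_integral[OF K_divide[OF xK iota_in_K]])
  obtain u v where uv: "u * b + v * \<pi> = 1" by (rule bezout[OF b(1)])
  define y where "y = \<iota> u * (\<iota> b * (x / \<iota> \<pi>)) + \<iota> v * x"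
  have "\<iota> \<pi> * y = (\<iota> u * \<iota> b + \<iota> v * \<iota> \<pi>) * x"
    using p0 by (simp add: y_def algebra_simps)
  also have "\<iota> u * \<iota> b + \<iota> v * \<iota> \<pi> = 1"
    using arg_cong[OF uv, of \<iota>] by (simp add: iota_add iota_mult iota_1)
  finally have "x = \<iota> \<pi> * y" by simp
  moreover have "y \<in> \<O>\<^sub>K"
    unfolding y_def by (intro OK_add OK_mult OK_iota S_sub_OK b x)
  ultimately show ?thesis by (intro that[of y])
qed

definition P_sing :: "'c set" where "P_sing = {x \<in> \<O>\<^sub>K. val_ge 1 x}"

lemma val_ge_pos: "x \<in> K \<Longrightarrow> val_ge 1 x \<Longrightarrow> val_ge (int d) x"
proof -
  assume x: "x \<in> K" and ge: "val_ge 1 x"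
  show ?thesis
  proof (cases "x = 0")
    case False
    hence "1 \<le> val x" using ge by (simp add: val_ge_def)
    hence "int d \<le> val x" using zdvd_imp_le[OF d_dvd_val[OF x False]] by simp
    thus ?thesis by (simp add: val_ge_def)
  qed (simp add: val_ge_def)
qed

lemma val_OK: "x \<in> \<O>\<^sub>K \<Longrightarrow> x \<noteq> 0 \<Longrightarrow> 0 \<le> val x"
  using integral_val_ge[of x] by (auto simp: OK_iff val_ge_def)

lemma P_sing_ideal: "ideal P_sing (subring_on \<O>\<^sub>K)"
proof (rule ideal_subring_onI[OF cring_OK])
  show "P_sing \<subseteq> \<O>\<^sub>K" by (auto simp: P_sing_def)
  show "0 \<in> P_sing" using OK_iota[of 0] by (simp add: P_sing_def val_ge_def iota_0)
  fix x y assume y: "y \<in> P_sing"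
  show "x - y \<in> P_sing" if "x \<in> P_sing"
    using that y OK_diff val_ge_diff unfolding P_sing_def OK_iff by simp
  show "x * y \<in> P_sing" if x: "x \<in> \<O>\<^sub>K"
  proof (cases "x = 0 \<or> y = 0")
    case True
    thus ?thesis using \<open>0 \<in> P_sing\<close> by auto
  next
    case False
    have "val (x * y) = val x + val y" using False x y by (intro val_mult) (auto simp: P_sing_def OK_iff)
    thus ?thesis using val_OK[OF x] False y OK_mult[OF x] by (auto simp: P_sing_def val_ge_def)
  qed
qed

lemma P_sing_prime: "primeideal P_sing (subring_on \<O>\<^sub>K)"
proof (rule primeidealI[OF P_sing_ideal cring_OK])
  have "val 1 = 0" using val_iota[of 1] Phi_tord_0[OF not_pi_dvd_1] by (simp add: iota_1)
  hence "1 \<notin> P_sing" by (simp add: P_sing_def val_ge_def)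
  moreover have "1 \<in> \<O>\<^sub>K" using OK_iota[of 1] by (simp add: iota_1)
  ultimately show "carrier (subring_on \<O>\<^sub>K) \<noteq> P_sing" by auto
  fix x y assume xy: "x \<in> carrier (subring_on \<O>\<^sub>K)" "y \<in> carrier (subring_on \<O>\<^sub>K)"
    "x \<otimes>\<^bsub>subring_on \<O>\<^sub>K\<^esub> y \<in> P_sing"
  hence x: "x \<in> \<O>\<^sub>K" and y: "y \<in> \<O>\<^sub>K" and P: "val_ge 1 (x * y)" by (simp_all add: P_sing_def)
  show "x \<in> P_sing \<or> y \<in> P_sing"
  proof (cases "x = 0 \<or> y = 0")
    case True
    thus ?thesis using x y by (auto simp: P_sing_def val_ge_def)
  next
    case False
    have "val (x * y) = val x + val y" using False x y by (intro val_mult) (auto simp: OK_iff)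
    hence "val x \<ge> 1 \<or> val y \<ge> 1" using P False by (auto simp: val_ge_def)
    thus ?thesis using x y by (auto simp: P_sing_def val_ge_def)
  qed
qed

lemma extended_ideal_val: "extended_ideal \<iota> K {a. \<pi> dvd a} = {x \<in> \<O>\<^sub>K. val_ge (2 * int d) x}"
  unfolding extended_ideal_eq
proof (intro equalityI subsetI)
  fix x assume "x \<in> {\<iota> \<pi> * x |x. x \<in> \<O>\<^sub>K}"
  then obtain y where y: "x = \<iota> \<pi> * y" "y \<in> \<O>\<^sub>K" by blast
  have p0: "\<iota> \<pi> \<noteq> 0" using pi_nz iota_eq_0 by blast
  have "val_ge (2 * int d) x"
  proof (cases "y = 0")
    case False
    have "val x = val (\<iota> \<pi>) + val y"
      unfolding y(1) by (rule val_mult) (use False y p0 iota_in_K in \<open>simp_all add: OK_iff\<close>)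
    thus ?thesis using val_iota[OF pi_nz] supersingular val_OK[OF y(2) False] by (simp add: val_ge_def)
  qed (simp add: val_ge_def y)
  thus "x \<in> {x \<in> \<O>\<^sub>K. val_ge (2 * int d) x}" using OK_mult[OF OK_iota y(2)] y(1) by simp
next
  fix x assume "x \<in> {x \<in> \<O>\<^sub>K. val_ge (2 * int d) x}"
  hence x: "x \<in> \<O>\<^sub>K" "val_ge (2 * int d) x" by auto
  obtain y where "y \<in> \<O>\<^sub>K" "x = \<iota> \<pi> * y" by (rule val_ge_2d_divisible[OF x])
  thus "x \<in> {\<iota> \<pi> * x |x. x \<in> \<O>\<^sub>K}" by blast
qed

lemma val_power: "x \<in> K \<Longrightarrow> x \<noteq> 0 \<Longrightarrow> x ^ n \<in> K \<and> val (x ^ n) = int n * val x"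
proof (induction n)
  case 0
  have "val 1 = 0" using val_iota[of 1] Phi_tord_0[OF not_pi_dvd_1] by (simp add: iota_1)
  moreover have "1 \<in> K" using iota_in_K[of 1] by (simp add: iota_1)
  ultimately show ?case by simp
next
  case (Suc n)
  hence IH: "x ^ n \<in> K" "val (x ^ n) = int n * val x" by simp_all
  have "val (x * x ^ n) = val x + val (x ^ n)" using Suc.prems IH by (intro val_mult) simp_all
  thus ?case using Suc.prems IH K_mult by (simp add: algebra_simps)
qed

text \<open>The valuation is the only place above \<open>\<pi>\<close>, and \<open>val (\<iota>
  \<pi>) = 2 d\<close> while all values are multiples of \<open>d\<close>. If all values are
  multiples of \<open>2 d\<close>, then \<open>\<pi>\<close> generates the prime ideal and is
  inert; an element whose value is an odd multiple of \<open>d\<close> makes it the square of the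
  prime ideal.\<close>

theorem supersingular_imp_nonsplit: "nonsplit_in \<iota> {a. \<pi> dvd a} K"
proof (cases "\<forall>x\<in>K. x \<noteq> 0 \<longrightarrow> 2 * int d dvd val x")
  case True
  have "P_sing = {x \<in> \<O>\<^sub>K. val_ge (2 * int d) x}"
  proof (intro equalityI subsetI)
    fix x assume x: "x \<in> P_sing"
    have "val_ge (2 * int d) x"
    proof (cases "x = 0")
      case False
      have "2 * int d dvd val x" "val x \<ge> 1" using True x False by (auto simp: P_sing_def OK_iff val_ge_def)
      hence "2 * int d \<le> val x" by (intro zdvd_imp_le) auto
      thus ?thesis by (simp add: val_ge_def)
    qed (simp add: val_ge_def)
    thus "x \<in> {x \<in> \<O>\<^sub>K. val_ge (2 * int d) x}" using x by (simp add: P_sing_def)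
  next
    fix x assume "x \<in> {x \<in> \<O>\<^sub>K. val_ge (2 * int d) x}"
    thus "x \<in> P_sing" using d_pos by (auto simp: P_sing_def val_ge_def)
  qed
  hence "inert_in \<iota> {a. \<pi> dvd a} K"
    unfolding inert_in_def extended_ideal_val \<O>\<^sub>K_def[symmetric] using P_sing_prime by simp
  thus ?thesis by (simp add: nonsplit_in_def)
next
  case False
  then obtain t where t: "t \<in> K" "t \<noteq> 0" "\<not> 2 * int d dvd val t" by blast
  obtain m where m: "val t = int d * m" using d_dvd_val[OF t(1,2)] by (auto simp: dvd_def)
  have "odd m"
  proof
    assume "even m"
    hence "2 * int d dvd int d * m" by (simp add: mult.commute[of 2] mult_dvd_mono)
    thus False using t(3) m by simp
  qed
  then obtain k where k: "m = 2 * k + 1" by (rule oddE)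
  have p0: "\<iota> \<pi> \<noteq> 0" using pi_nz iota_eq_0 by blast
  have vp: "val (\<iota> \<pi>) = 2 * int d" using val_iota[OF pi_nz] supersingular by simp
  have "\<exists>t'\<in>K. t' \<noteq> 0 \<and> val t' = int d"
  proof (cases "k \<ge> 0")
    case True
    define t' where "t' = t / \<iota> \<pi> ^ nat k"
    have pk: "\<iota> \<pi> ^ nat k \<in> K" "val (\<iota> \<pi> ^ nat k) = k * (2 * int d)"
      using val_power[OF iota_in_K p0, of "nat k"] True vp by simp_all
    have t': "t' \<in> K" "t' \<noteq> 0" "t = \<iota> \<pi> ^ nat k * t'"
      using K_divide[OF t(1) pk(1)] t(2) p0 by (simp_all add: t'_def)
    have "val t = val (\<iota> \<pi> ^ nat k) + val t'"
      unfolding t'(3) by (rule val_mult) (use pk t' p0 in simp_all)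
    hence "val t' = int d" using pk(2) m k by (simp add: algebra_simps)
    thus ?thesis using t' by blast
  next
    case False
    define t' where "t' = t * \<iota> \<pi> ^ nat (- k)"
    have pk: "\<iota> \<pi> ^ nat (- k) \<in> K" "val (\<iota> \<pi> ^ nat (- k)) = - k * (2 * int d)"
      using val_power[OF iota_in_K p0, of "nat (- k)"] False vp by simp_all
    have t': "t' \<in> K" "t' \<noteq> 0" using K_mult[OF t(1) pk(1)] t(2) p0 by (simp_all add: t'_def)
    have "val t' = val t + val (\<iota> \<pi> ^ nat (- k))"
      unfolding t'_def by (rule val_mult) (use pk t p0 in simp_all)
    hence "val t' = int d" using pk(2) m k by (simp add: algebra_simps)
    thus ?thesis using t' by blast
  qed
  then obtain t' where t': "t' \<in> K" "t' \<noteq> 0" "val t' = int d" by blast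
  have "val_ge 0 t'" using t'(3) by (simp add: val_ge_def)
  then obtain b where b: "\<not> \<pi> dvd b" "\<iota> b * t' \<in> S"
    by (rule val_nonneg_locally_integral[OF t'(1)])
  define u where "u = \<iota> b * t'"
  have b0: "b \<noteq> 0" using b(1) by auto
  have ib0: "\<iota> b \<noteq> 0" using b0 iota_eq_0 by blast
  have vb: "val (\<iota> b) = 0" using val_iota[OF b0] Phi_tord_0[OF b(1)] by simp
  have u: "u \<in> \<O>\<^sub>K" "u \<noteq> 0" "val u = int d"
    using S_sub_OK[OF b(2)] t' ib0 val_mult[OF iota_in_K t'(1) ib0 t'(2)] vb by (simp_all add: u_def)
  have uK: "u \<in> K" using u(1) by (simp add: OK_iff)
  have uP: "u \<in> P_sing" using u d_pos by (simp add: P_sing_def val_ge_def)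
  interpret R: cring "subring_on \<O>\<^sub>K" by (rule cring_OK)
  let ?Q = "ideal_prod (subring_on \<O>\<^sub>K) P_sing P_sing"
  have Q: "ideal ?Q (subring_on \<O>\<^sub>K)" by (rule R.ideal_prod_is_ideal[OF P_sing_ideal P_sing_ideal])
  have prod_in: "x * y \<in> ?Q" if "x \<in> P_sing" "y \<in> P_sing" for x y
    using ideal_prod.prod[OF that, of "subring_on \<O>\<^sub>K"] by simp
  have Q_mult: "x * y \<in> ?Q" if "x \<in> \<O>\<^sub>K" "y \<in> ?Q" for x y
    using ideal.I_l_closed[OF Q that(2), of x] that(1) by simp
  have Q_add: "x + y \<in> ?Q" if "x \<in> ?Q" "y \<in> ?Q" for x y
    using ideal_prod.sum[OF that] by simp
  have pP: "\<iota> \<pi> \<in> P_sing" using OK_iota vp d_pos by (simp add: P_sing_def val_ge_def)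
  have "\<iota> \<pi> \<in> ?Q"
  proof -
    define z where "z = \<iota> \<pi> / u ^ 2"
    have u2: "u ^ 2 \<in> K" "val (u ^ 2) = 2 * int d" using val_power[OF uK u(2), of 2] u(3) by simp_all
    have z: "z \<in> K" "z \<noteq> 0" "\<iota> \<pi> = u ^ 2 * z"
      using K_divide[OF iota_in_K u2(1)] p0 u(2) by (simp_all add: z_def)
    have "val (\<iota> \<pi>) = val (u ^ 2) + val z"
      unfolding z(3) by (rule val_mult) (use u2 u z in simp_all)
    hence "val_ge 0 z" using u2(2) vp by (simp add: val_ge_def)
    then obtain c where c: "\<not> \<pi> dvd c" "\<iota> c * z \<in> S"
      by (rule val_nonneg_locally_integral[OF z(1)])
    obtain v w where vw: "v * c + w * \<pi> = 1" by (rule bezout[OF c(1)])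
    have "\<iota> v * \<iota> c + \<iota> w * \<iota> \<pi> = 1"
      using arg_cong[OF vw, of \<iota>] by (simp add: iota_add iota_mult iota_1)
    hence "\<iota> \<pi> = (\<iota> v * \<iota> c + \<iota> w * \<iota> \<pi>) * \<iota> \<pi>" by simp
    also have "\<dots> = \<iota> v * (\<iota> c * \<iota> \<pi>) + \<iota> w * (\<iota> \<pi> * \<iota> \<pi>)" by (simp add: algebra_simps)
    also have "\<iota> c * \<iota> \<pi> = (\<iota> c * z) * (u * u)"
    proof -
      have "\<iota> c * \<iota> \<pi> = \<iota> c * (u ^ 2 * z)" using z(3) by (rule arg_cong)
      thus ?thesis by (simp add: power2_eq_square ac_simps)
    qed
    finally have eq: "\<iota> \<pi> = \<iota> v * ((\<iota> c * z) * (u * u)) + \<iota> w * (\<iota> \<pi> * \<iota> \<pi>)" .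
    have "\<iota> v * ((\<iota> c * z) * (u * u)) + \<iota> w * (\<iota> \<pi> * \<iota> \<pi>) \<in> ?Q"
      by (intro Q_add Q_mult OK_iota S_sub_OK[OF c(2)] prod_in uP pP)
    thus ?thesis using eq by (simp only:)
  qed
  have "extended_ideal \<iota> K {a. \<pi> dvd a} = ?Q"
  proof (intro equalityI subsetI)
    fix x assume "x \<in> extended_ideal \<iota> K {a. \<pi> dvd a}"
    then obtain y where "x = \<iota> \<pi> * y" "y \<in> \<O>\<^sub>K" unfolding extended_ideal_eq by blast
    thus "x \<in> ?Q" using Q_mult[OF _ \<open>\<iota> \<pi> \<in> ?Q\<close>, of y] by (simp add: mult.commute)
  next
    fix x assume "x \<in> ?Q"
    thus "x \<in> extended_ideal \<iota> K {a. \<pi> dvd a}"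
      unfolding extended_ideal_val
    proof induction
      case (prod i j)
      hence ij: "i \<in> \<O>\<^sub>K" "j \<in> \<O>\<^sub>K" "val_ge (int d) i" "val_ge (int d) j" "i \<in> K" "j \<in> K"
        using val_ge_pos by (auto simp: P_sing_def OK_iff)
      have "val_ge (2 * int d) (i * j)"
      proof (cases "i = 0 \<or> j = 0")
        case True
        thus ?thesis by (auto simp: val_ge_def)
      next
        case False
        thus ?thesis using val_mult[OF ij(5,6)] ij(3,4) by (simp add: val_ge_def)
      qed
      thus ?case using OK_mult[OF ij(1,2)] by simp
    next
      case (sum x y)
      hence xy: "x \<in> \<O>\<^sub>K" "y \<in> \<O>\<^sub>K" "val_ge (2 * int d) x" "val_ge (2 * int d) y" by auto
      have 0: "0 \<in> \<O>\<^sub>K" "val_ge (2 * int d) 0" using OK_iota[of 0] by (simp_all add: iota_0 val_ge_def)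
      have my: "0 - y \<in> \<O>\<^sub>K" "val_ge (2 * int d) (0 - y)"
        using OK_diff[OF 0(1) xy(2)] val_ge_diff[OF _ _ 0(2) xy(4)] 0(1) xy(2) by (simp_all add: OK_iff)
      have "val_ge (2 * int d) (x - (0 - y))"
        using val_ge_diff[OF _ _ xy(3) my(2)] xy(1) my(1) by (simp add: OK_iff)
      thus ?case using OK_add[OF xy(1,2)] by simp
    qed
  qed
  hence "ramified_in \<iota> {a. \<pi> dvd a} K"
    unfolding ramified_in_def \<O>\<^sub>K_def[symmetric]
    by (intro exI[of _ P_sing] conjI P_sing_prime)
  thus ?thesis by (simp add: nonsplit_in_def)
qed

end

end

section \<open>Lifting endomorphisms in the ordinary case\<close>

context represented
begin

text \<open>An order meets \<open>k\<close> only in \<open>A\<close>: by division with remainder,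
  the image of a proper fraction would have negative degree.\<close>

lemma S_inter_k:
  assumes x: "x \<in> S" and a: "a \<noteq> 0" and eq: "\<iota> a * x = \<iota> b"
  shows "x \<in> range \<iota>"
proof -
  define s where "s = b div a"
  define r where "r = b mod a"
  have b: "b = a * s + r" by (simp add: s_def r_def)
  define y where "y = x - \<iota> s"
  have y: "y \<in> S" unfolding y_def by (intro S_diff x S_iota)
  have ay: "\<iota> a * y = \<iota> r"
    unfolding y_def right_diff_distrib eq by (simp add: b iota_add iota_mult)
  have "y = 0"
  proof (rule ccontr)
    assume y0: "y \<noteq> 0"
    have ry: "\<rho> y \<noteq> 0" using rho_eq_0_iff[OF y] y0 by simp
    have "\<Phi> a \<star>\<^bsub>q\<^esub> \<rho> y = \<Phi> r" using arg_cong[OF ay, of \<rho>] by (simp only: rho_iota_mult[OF y] rho_iota)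
    moreover have "degree (\<Phi> a \<star>\<^bsub>q\<^esub> \<rho> y) = degree (\<Phi> a) + degree (\<rho> y)" "\<Phi> a \<star>\<^bsub>q\<^esub> \<rho> y \<noteq> 0"
      using tm_nonzero(1,2)[OF Phi_degree(1)[OF a] ry] by simp_all
    ultimately have D: "degree (\<Phi> r) \<ge> degree (\<Phi> a)" and "\<Phi> r \<noteq> 0" by simp_all
    hence r0: "r \<noteq> 0" by auto
    have "degree r \<ge> degree a" using D by (simp add: Phi_degree(2)[OF a] Phi_degree(2)[OF r0])
    moreover have "degree r < degree a" using degree_mod_less[OF a, of b] r0 by (simp add: r_def)
    ultimately show False by simp
  qed
  thus ?thesis by (simp add: y_def)
qed

end

context reduced_module
begin

lemma primitive_triple:
  assumes "(a, b, c) \<noteq> (0, 0, 0)"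
  shows "\<exists>n a' b' c'. n \<noteq> 0 \<and> a = n * a' \<and> b = n * b' \<and> c = n * c' \<and> \<not> (\<pi> dvd a' \<and> \<pi> dvd b' \<and> \<pi> dvd c')"
  using assms
proof (induction "degree a + degree b + degree c" arbitrary: a b c rule: less_induct)
  case (less a b c)
  show ?case
  proof (cases "\<pi> dvd a \<and> \<pi> dvd b \<and> \<pi> dvd c")
    case False
    thus ?thesis by (intro exI[of _ 1] exI[of _ a] exI[of _ b] exI[of _ c]) simp
  next
    case True
    then obtain a1 b1 c1 where e: "a = \<pi> * a1" "b = \<pi> * b1" "c = \<pi> * c1" by (auto simp: dvd_def)
    have nz: "(a1, b1, c1) \<noteq> (0, 0, 0)" using less.prems e by auto
    have deg: "degree (\<pi> * x) = (if x = 0 then 0 else d + degree x)" for x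
      using degree_mult_eq[OF pi_nz, of x] by (simp add: d_def)
    have "degree a1 + degree b1 + degree c1 < degree a + degree b + degree c"
      unfolding e deg using nz d_pos by auto
    from less.hyps[OF this nz] obtain n a' b' c' where
      n: "n \<noteq> 0" "a1 = n * a'" "b1 = n * b'" "c1 = n * c'" "\<not> (\<pi> dvd a' \<and> \<pi> dvd b' \<and> \<pi> dvd c')" by blast
    show ?thesis
      by (rule exI[of _ "\<pi> * n"], rule exI[of _ a'], rule exI[of _ b'], rule exI[of _ c'])
        (use n pi_nz in \<open>simp add: e mult.assoc\<close>)
  qed
qed

text \<open>A power of \<open>\<tau>\<close> whose exponent is a common period of
  \<open>\<theta>\<close> and \<open>g\<close> commutes with \<open>\<phi>\<close>.\<close>

lemma Frobenius_in_End: "\<exists>n>0. monom 1 n \<in> End"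
proof -
  obtain n1 where n1: "n1 > 0" "\<theta> ^ (q ^ n1) = \<theta>" using frob_periodic by blast
  obtain n2 where n2: "n2 > 0" "g ^ (q ^ n2) = g" using frob_periodic by blast
  have iter: "x ^ (q ^ (k * m)) = x" if "x ^ (q ^ k) = x" for x :: 'f and k m
  proof (induction m)
    case (Suc m)
    have "x ^ (q ^ (k * Suc m)) = (x ^ (q ^ k)) ^ (q ^ (k * m))"
      by (simp add: power_add flip: power_mult)
    thus ?case using Suc that by simp
  qed simp
  define n where "n = n1 * n2"
  have t: "\<theta> ^ (q ^ n) = \<theta>" unfolding n_def by (rule iter[OF n1(2)])
  have g: "g ^ (q ^ n) = g" unfolding n_def mult.commute[of n1] by (rule iter[OF n2(2)])
  have phi: "coeff \<phi> k ^ (q ^ n) = coeff \<phi> k" for k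
    by (auto simp: \<phi>_def coeff_pCons t g split: nat.splits)
  have left: "coeff (monom 1 n \<star>\<^bsub>q\<^esub> \<phi>) k = (if n \<le> k then coeff \<phi> (k - n) ^ (q ^ n) else 0)" for k
  proof -
    have "coeff (monom 1 n \<star>\<^bsub>q\<^esub> \<phi>) k = (\<Sum>i\<le>k. if i = n then coeff \<phi> (k - n) ^ (q ^ n) else 0)"
      unfolding coeff_tm by (intro sum.cong refl) auto
    thus ?thesis by (simp add: sum.delta)
  qed
  have "monom 1 n \<star>\<^bsub>q\<^esub> \<phi> = \<phi> \<star>\<^bsub>q\<^esub> monom 1 n"
    by (rule poly_eqI) (simp add: left coeff_tm_monom_right phi)
  thus ?thesis using n1(1) n2(1) by (intro exI[of _ n]) (simp add: End_def n_def)
qed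

end

context ordinary_module
begin

text \<open>By Bezout \<open>\<Phi> \<pi>\<close> would be a right factor of
  \<open>\<tau>\<^sup>N\<close>. The order and the degree of a factor of a monomial agree, but
  those of \<open>\<Phi> \<pi>\<close> are \<open>d\<close> and \<open>2 d\<close>.\<close>

lemma Frobenius_not_divisible:
  assumes m: "\<not> \<pi> dvd m" and F: "monom 1 N \<in> End" and eq: "\<Phi> m \<star>\<^bsub>q\<^esub> monom 1 N = y \<star>\<^bsub>q\<^esub> \<Phi> \<pi>"
  shows False
proof -
  let ?F = "monom 1 N :: 'f poly"
  obtain v w where vw: "v * m + w * \<pi> = 1" by (rule bezout[OF m])
  define z where "z = \<Phi> v \<star>\<^bsub>q\<^esub> y + ?F \<star>\<^bsub>q\<^esub> \<Phi> w"
  have "z \<star>\<^bsub>q\<^esub> \<Phi> \<pi> = \<Phi> v \<star>\<^bsub>q\<^esub> (\<Phi> m \<star>\<^bsub>q\<^esub> ?F) + ?F \<star>\<^bsub>q\<^esub> \<Phi> (w * \<pi>)"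
    unfolding z_def tm_add_left tm_assoc eq dmod_mult ..
  also have "\<dots> = \<Phi> v \<star>\<^bsub>q\<^esub> (\<Phi> m \<star>\<^bsub>q\<^esub> ?F) + \<Phi> (w * \<pi>) \<star>\<^bsub>q\<^esub> ?F"
    by (simp only: End_commute[OF F, of "w * \<pi>"])
  also have "\<dots> = \<Phi> (v * m) \<star>\<^bsub>q\<^esub> ?F + \<Phi> (w * \<pi>) \<star>\<^bsub>q\<^esub> ?F"
    by (simp only: dmod_mult tm_assoc)
  also have "\<dots> = \<Phi> (v * m + w * \<pi>) \<star>\<^bsub>q\<^esub> ?F" by (simp only: dmod_add tm_add_left)
  finally have zF: "z \<star>\<^bsub>q\<^esub> \<Phi> \<pi> = ?F" by (simp only: vw dmod_1 tm_1_left)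
  have F0: "?F \<noteq> 0" by (simp add: monom_eq_0_iff)
  have z0: "z \<noteq> 0" using zF F0 by auto
  have p0: "\<Phi> \<pi> \<noteq> 0" by (rule Phi_degree(1)[OF pi_nz])
  have "tord ?F = N" by (rule tord_eqI) (simp_all add: low_def)
  hence "N = tord z + d" using tm_nonzero(4)[OF z0 p0] by (simp add: zF ordinary)
  moreover have "N = degree z + 2 * d"
    using tm_nonzero(2)[OF z0 p0] by (simp add: zF degree_monom_eq Phi_degree(2)[OF pi_nz] d_def)
  ultimately show False using tord_le_degree[OF z0] d_pos by simp
qed

lemma dependent_primitive:
  assumes "x1 \<in> End" "x2 \<in> End" "x3 \<in> End"
  obtains a b c where "\<not> (\<pi> dvd a \<and> \<pi> dvd b \<and> \<pi> dvd c)"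
    "\<Phi> a \<star>\<^bsub>q\<^esub> x1 + \<Phi> b \<star>\<^bsub>q\<^esub> x2 + \<Phi> c \<star>\<^bsub>q\<^esub> x3 = 0"
proof -
  obtain a b c where abc: "(a, b, c) \<noteq> (0, 0, 0)"
    and rel: "\<Phi> a \<star>\<^bsub>q\<^esub> x1 + \<Phi> b \<star>\<^bsub>q\<^esub> x2 + \<Phi> c \<star>\<^bsub>q\<^esub> x3 = 0" by (rule End_dependent[OF assms])
  obtain n a' b' c' where n: "n \<noteq> 0" "a = n * a'" "b = n * b'" "c = n * c'"
    "\<not> (\<pi> dvd a' \<and> \<pi> dvd b' \<and> \<pi> dvd c')" using primitive_triple[OF abc] by blast
  have "\<Phi> n \<star>\<^bsub>q\<^esub> (\<Phi> a' \<star>\<^bsub>q\<^esub> x1 + \<Phi> b' \<star>\<^bsub>q\<^esub> x2 + \<Phi> c' \<star>\<^bsub>q\<^esub> x3) = 0"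
    using rel unfolding n(2-4) dmod_mult tm_assoc by (simp only: tm_add_right)
  hence "\<Phi> a' \<star>\<^bsub>q\<^esub> x1 + \<Phi> b' \<star>\<^bsub>q\<^esub> x2 + \<Phi> c' \<star>\<^bsub>q\<^esub> x3 = 0"
    using Phi_degree(1)[OF n(1)] by (simp add: tm_eq_0_iff)
  thus ?thesis by (rule that[OF n(5)])
qed

text \<open>A primitive relation between \<open>1\<close>, \<open>\<rho> \<alpha>\<close> and
  \<open>u\<close> presents \<open>u\<close> as the image of a fraction \<open>- (a + b \<alpha>)
  / c\<close>, and saturation puts this fraction into \<open>S\<close>.\<close>

lemma lift_surjective:
  assumes sat: "saturated q \<kappa> \<theta> g \<pi> \<iota> S \<rho>" and \<alpha>: "\<alpha> \<in> S" "\<alpha> \<notin> range \<iota>" and u: "u \<in> End"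
  obtains y where "y \<in> S" "\<rho> y = u"
proof -
  interpret S: saturated q \<kappa> \<theta> g \<pi> \<iota> S \<rho> by (rule sat)
  have one: "1 \<in> End" using End_Phi[of 1] by simp
  obtain a b c where prim: "\<not> (\<pi> dvd a \<and> \<pi> dvd b \<and> \<pi> dvd c)"
    and rel: "\<Phi> a \<star>\<^bsub>q\<^esub> 1 + \<Phi> b \<star>\<^bsub>q\<^esub> \<rho> \<alpha> + \<Phi> c \<star>\<^bsub>q\<^esub> u = 0"
    by (rule dependent_primitive[OF one S.rho_End[OF \<alpha>(1)] u])
  define w where "w = \<iota> a + \<iota> b * \<alpha>"
  have w: "w \<in> S" unfolding w_def by (intro S.S_add S.S_mult S.S_iota \<alpha>)
  have rw: "\<rho> w = \<Phi> a + \<Phi> b \<star>\<^bsub>q\<^esub> \<rho> \<alpha>"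
    unfolding w_def by (simp add: S.rho_add S.S_iota S.S_mult \<alpha> S.rho_iota S.rho_iota_mult)
  have rel': "\<rho> w + \<Phi> c \<star>\<^bsub>q\<^esub> u = 0" using rel unfolding rw tm_1_right .
  have c0: "c \<noteq> 0"
  proof
    assume c: "c = 0"
    hence "\<rho> w = 0" using rel' by simp
    hence w0: "\<iota> a + \<iota> b * \<alpha> = 0" using S.rho_eq_0[OF w] by (simp add: w_def)
    show False
    proof (cases "b = 0")
      case True
      hence "\<iota> a = 0" using w0 by (simp add: S.iota_0)
      hence "a = 0" by (rule S.iota_eq_0)
      thus False using prim c True by simp
    next
      case False
      have "\<iota> b * \<alpha> = - \<iota> a" using minus_unique[OF w0] by simp
      hence "\<iota> b * \<alpha> = \<iota> (- a)" by (simp add: S.iota_minus)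
      from S.S_inter_k[OF \<alpha>(1) False this] show False using \<alpha>(2) by simp
    qed
  qed
  have ic: "\<iota> c \<noteq> 0" using c0 S.iota_eq_0 by blast
  define y where "y = - w / \<iota> c"
  have cy: "\<iota> c * y = - w" using ic by (simp add: y_def)
  have cyS: "\<iota> c * y \<in> S" unfolding cy by (rule S.S_minus[OF w])
  have "\<rho> (\<iota> c * y) = - \<rho> w" unfolding cy by (rule S.rho_minus[OF w])
  also have "- \<rho> w = \<Phi> c \<star>\<^bsub>q\<^esub> u" by (rule minus_unique[OF rel'])
  also have "\<dots> = u \<star>\<^bsub>q\<^esub> \<Phi> c" by (rule End_commute[OF u, symmetric])
  finally show ?thesis using S.saturated_rho[OF c0 cyS] that by metis
qed

lemma lift_relation:
  assumes sat: "represented q \<kappa> \<theta> g \<pi> \<iota> S \<rho>" and y: "y \<in> S"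
    and rel: "\<Phi> a \<star>\<^bsub>q\<^esub> 1 + \<Phi> b \<star>\<^bsub>q\<^esub> \<rho> y + \<Phi> c \<star>\<^bsub>q\<^esub> (\<rho> y \<star>\<^bsub>q\<^esub> \<rho> y) = 0"
  shows "\<iota> a + \<iota> b * y + \<iota> c * (y * y) = 0"
proof -
  interpret S: represented q \<kappa> \<theta> g \<pi> \<iota> S \<rho> by (rule sat)
  have in_S: "\<iota> a \<in> S" "\<iota> b * y \<in> S" "\<iota> c * (y * y) \<in> S" "y * y \<in> S" "\<iota> a + \<iota> b * y \<in> S"
    using y by (simp_all add: S.S_add S.S_mult S.S_iota)
  have "\<rho> (\<iota> a + \<iota> b * y + \<iota> c * (y * y)) = \<Phi> a + \<Phi> b \<star>\<^bsub>q\<^esub> \<rho> y + \<Phi> c \<star>\<^bsub>q\<^esub> (\<rho> y \<star>\<^bsub>q\<^esub> \<rho> y)"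
    by (simp add: S.rho_add in_S S.rho_iota S.rho_iota_mult S.rho_mult y)
  also have "\<dots> = 0" using rel by simp
  finally show ?thesis using S.rho_eq_0 S.S_add in_S by blast
qed

text \<open>Both elements satisfy the quadratic relation of their common image, so they are its
  two roots when they differ. The sum and the product of the roots are read off from its
  coefficients.\<close>

lemma twins:
  assumes sat1: "represented q \<kappa> \<theta> g \<pi> \<iota> S1 \<rho>1" and sat2: "represented q \<kappa> \<theta> g \<pi> \<iota> S2 \<rho>2"
    and x: "x \<in> S1" and y: "y \<in> S2" and eq: "\<rho>1 x = \<rho>2 y" and neq: "x \<noteq> y"
  obtains a b c where "\<not> (\<pi> dvd a \<and> \<pi> dvd b \<and> \<pi> dvd c)" "c \<noteq> 0"
    "\<iota> c * (x + y) = - \<iota> b" "\<iota> c * (x * y) = \<iota> a"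
    "\<Phi> a + \<Phi> b \<star>\<^bsub>q\<^esub> \<rho>2 y + \<Phi> c \<star>\<^bsub>q\<^esub> (\<rho>2 y \<star>\<^bsub>q\<^esub> \<rho>2 y) = 0"
proof -
  interpret S2: represented q \<kappa> \<theta> g \<pi> \<iota> S2 \<rho>2 by (rule sat2)
  let ?u = "\<rho>2 y"
  have u: "?u \<in> End" by (rule S2.rho_End[OF y])
  have one: "1 \<in> End" using End_Phi[of 1] by simp
  obtain a b c where prim: "\<not> (\<pi> dvd a \<and> \<pi> dvd b \<and> \<pi> dvd c)"
    and rel: "\<Phi> a \<star>\<^bsub>q\<^esub> 1 + \<Phi> b \<star>\<^bsub>q\<^esub> ?u + \<Phi> c \<star>\<^bsub>q\<^esub> (?u \<star>\<^bsub>q\<^esub> ?u) = 0"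
    by (rule dependent_primitive[OF one u End_mult[OF u u]])
  have ry: "\<iota> a + \<iota> b * y + \<iota> c * (y * y) = 0" by (rule lift_relation[OF sat2 y rel])
  have rx: "\<iota> a + \<iota> b * x + \<iota> c * (x * x) = 0"
    by (rule lift_relation[OF sat1 x]) (simp only: eq rel)
  have "(x - y) * (\<iota> b + \<iota> c * (x + y)) =
      (\<iota> a + \<iota> b * x + \<iota> c * (x * x)) - (\<iota> a + \<iota> b * y + \<iota> c * (y * y))"
    by (simp add: algebra_simps)
  hence "(x - y) * (\<iota> b + \<iota> c * (x + y)) = 0" unfolding rx ry by simp
  hence s: "\<iota> b + \<iota> c * (x + y) = 0" using neq by simp
  have sum: "\<iota> c * (x + y) = - \<iota> b" using minus_unique[OF s] by (rule sym)
  have c0: "c \<noteq> 0"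
  proof
    assume c: "c = 0"
    hence "\<iota> b = 0" using s by (simp add: S2.iota_0)
    hence b: "b = 0" by (rule S2.iota_eq_0)
    hence "\<iota> a = 0" using ry c by (simp add: S2.iota_0)
    hence "a = 0" by (rule S2.iota_eq_0)
    thus False using prim b c by simp
  qed
  have "\<iota> c * (x * y) = \<iota> a"
  proof -
    have "\<iota> c * (x * y) = (\<iota> c * (x + y)) * y - \<iota> c * (y * y)" by (simp add: algebra_simps)
    also have "\<dots> = \<iota> a - (\<iota> a + \<iota> b * y + \<iota> c * (y * y))" unfolding sum by (simp add: algebra_simps)
    finally show ?thesis unfolding ry by simp
  qed
  thus ?thesis using that[OF prim c0 sum] rel by (simp only: tm_1_right)
qed

text \<open>Every element of \<open>S1\<close> has the image of some element of \<open>S2\<close>,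
  and either equals it or is the other root of the same quadratic equation.\<close>

lemma lift_field_subset:
  assumes sat1: "saturated q \<kappa> \<theta> g \<pi> \<iota> S1 \<rho>1" and sat2: "saturated q \<kappa> \<theta> g \<pi> \<iota> S2 \<rho>2"
    and \<alpha>: "\<alpha> \<in> S2" "\<alpha> \<notin> range \<iota>"
  shows "fraction_field S1 \<subseteq> fraction_field S2"
proof -
  interpret S1: saturated q \<kappa> \<theta> g \<pi> \<iota> S1 \<rho>1 by (rule sat1)
  interpret S2: saturated q \<kappa> \<theta> g \<pi> \<iota> S2 \<rho>2 by (rule sat2)
  have rep: "represented q \<kappa> \<theta> g \<pi> \<iota> S1 \<rho>1" "represented q \<kappa> \<theta> g \<pi> \<iota> S2 \<rho>2"
    by (rule S1.represented_axioms, rule S2.represented_axioms)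
  have sub: "x \<in> S2.K" if x: "x \<in> S1" for x
  proof -
    obtain y where y: "y \<in> S2" "\<rho>2 y = \<rho>1 x"
      by (rule lift_surjective[OF sat2 \<alpha> S1.rho_End[OF x]])
    have yK: "y \<in> S2.K" using y S2.S_sub_K by blast
    show ?thesis
    proof (cases "x = y")
      case True
      thus ?thesis using yK by simp
    next
      case False
      obtain a b c where c: "c \<noteq> 0" "\<iota> c * (x + y) = - \<iota> b"
        by (rule twins[OF rep x y(1) y(2)[symmetric] False])
      have ic: "\<iota> c \<noteq> 0" using c(1) S1.iota_eq_0 by blast
      have "x = (\<iota> c * (x + y)) / \<iota> c - y" using ic by simp
      also have "\<dots> = \<iota> (- b) / \<iota> c - y" unfolding c(2) by (simp add: S1.iota_minus)
      also have "\<dots> \<in> S2.K" using yK S2.iota_in_K S2.K_divide S2.K_diff by simp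
      finally show ?thesis .
    qed
  qed
  show ?thesis
  proof
    fix x assume "x \<in> fraction_field S1"
    then obtain s t where st: "s \<in> S1" "t \<in> S1" "x = s / t" by (auto simp: fraction_field_def)
    hence "x \<in> S2.K" using sub S2.K_divide by simp
    thus "x \<in> fraction_field S2" by (simp add: S2.K_def)
  qed
qed

end

section \<open>Reduction of Drinfeld modules at a place\<close>

context Fq_field
begin

lemma coeff_tm_monom_left:
  "coeff (monom c k \<star>\<^bsub>q\<^esub> (u :: 'f poly)) n = (if k \<le> n then c * coeff u (n - k) ^ (q ^ k) else 0)"
proof -
  have "coeff (monom c k \<star>\<^bsub>q\<^esub> u) n = (\<Sum>i\<le>n. if i = k then c * coeff u (n - k) ^ (q ^ k) else 0)"
    unfolding coeff_tm by (intro sum.cong refl) auto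
  thus ?thesis by (simp add: sum.delta)
qed

lemma smult_tm: "smult c (u \<star>\<^bsub>q\<^esub> v) = smult c u \<star>\<^bsub>q\<^esub> (v :: 'f poly)"
  by (simp only: tm_assoc flip: tm_const_left)

text \<open>The leading coefficient of an element commuting with \<open>t + \<tau>\<close> is in
  \<open>\<kappa>(F\<^sub>q)\<close>, so subtracting the image of a monomial lowers the degree: a
  rank one module has no further endomorphisms.\<close>

lemma centralizer_rank_one:
  assumes "v \<star>\<^bsub>q\<^esub> [:t, 1:] = [:t, 1:] \<star>\<^bsub>q\<^esub> v"
  shows "\<exists>a. v = dmod [:t, 1:] a"
  using assms
proof (induction "degree v" arbitrary: v rule: less_induct)
  case (less v)
  let ?\<psi> = "[:t, 1:] :: 'f poly"
  show ?case
  proof (cases "v = 0")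
    case True
    thus ?thesis by (intro exI[of _ 0]) simp
  next
    case False
    have psi: "?\<psi> \<noteq> 0" "degree ?\<psi> = 1" "lead_coeff ?\<psi> = 1" by simp_all
    have "lead_coeff (v \<star>\<^bsub>q\<^esub> ?\<psi>) = lead_coeff (?\<psi> \<star>\<^bsub>q\<^esub> v)" using less.prems by simp
    hence "lead_coeff v ^ q = lead_coeff v"
      using tm_nonzero(3)[OF False psi(1)] tm_nonzero(3)[OF psi(1) False] by simp
    hence "lead_coeff v \<in> range \<kappa>" using fixed_points_eq_range by blast
    then obtain e where e: "lead_coeff v = \<kappa> e" by blast
    have e0: "e \<noteq> 0" using e False kappa_0 by auto
    define n where "n = degree v"
    define M where "M = dmod ?\<psi> (monom e n)"
    have me: "monom e n \<noteq> 0" using e0 by (simp add: monom_eq_0_iff)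
    have pos: "degree ?\<psi> > 0" by simp
    note D = dmod_degree[OF pos psi(3) me]
    have "degree M = degree ?\<psi> * degree (monom e n)" unfolding M_def using D by (elim conjE)
    hence M1: "degree M = n" using e0 by (simp add: degree_monom_eq)
    have "lead_coeff M = \<kappa> (lead_coeff (monom e n))" unfolding M_def using D by (elim conjE)
    hence "lead_coeff M = \<kappa> e" using e0 by (simp add: degree_monom_eq)
    hence M: "degree M = n" "coeff M n = \<kappa> e" using M1 by simp_all
    define v' where "v' = v - M"
    have comm: "v' \<star>\<^bsub>q\<^esub> ?\<psi> = ?\<psi> \<star>\<^bsub>q\<^esub> v'"
      unfolding v'_def tm_diff_left tm_diff_right less.prems M_def dmod_commute_self ..
    have "\<exists>a. v' = dmod ?\<psi> a"
    proof (cases "v' = 0")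
      case True
      thus ?thesis by (intro exI[of _ 0]) simp
    next
      case v'0: False
      have "degree v' \<le> n" unfolding v'_def by (rule degree_diff_le) (simp_all add: M n_def)
      moreover have "coeff v' n = 0"
      proof -
        have "coeff v n = \<kappa> e" using e by (simp only: n_def)
        thus ?thesis by (simp add: v'_def M(2))
      qed
      ultimately have "degree v' < degree v"
        using v'0 unfolding n_def by (metis le_neq_implies_less leading_coeff_0_iff)
      thus ?thesis by (rule less.hyps[OF _ comm])
    qed
    then obtain a where a: "v' = dmod ?\<psi> a" by blast
    have "v = v' + M" by (simp add: v'_def)
    hence "v = dmod ?\<psi> (a + monom e n)" by (simp only: a M_def dmod_add)
    thus ?thesis by (rule exI)
  qed
qed

end

context place
begin

lemma V_total: "x \<in> V \<or> inverse x \<in> V"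
  using not_in_V by blast

lemma dominant_element:
  assumes "finite U" "U \<noteq> {}" "0 \<notin> U"
  shows "\<exists>y\<in>U. \<forall>x\<in>U. x / y \<in> V"
  using assms
proof (induction U rule: finite_ne_induct)
  case (singleton x)
  thus ?case using V_1 by simp
next
  case (insert z U)
  then obtain y where y: "y \<in> U" "\<And>x. x \<in> U \<Longrightarrow> x / y \<in> V" by auto
  have y0: "y \<noteq> 0" "z \<noteq> 0" using insert.prems y(1) by auto
  show ?case
  proof (cases "z / y \<in> V")
    case True
    thus ?thesis using y by (intro bexI[of _ y]) auto
  next
    case False
    hence "inverse (z / y) \<in> V" using V_total by blast
    hence yz: "y / z \<in> V" by simp
    have "x / z \<in> V" if "x \<in> U" for x
      using V_mult[OF y(2)[OF that] yz] y0 by simp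
    thus ?thesis using V_1 y0 by (intro bexI[of _ z]) auto
  qed
qed

text \<open>Dividing by a coefficient that is largest for the place keeps the reduction from
  vanishing.\<close>

lemma dominant_coeff:
  assumes "u \<noteq> 0"
  obtains m where "coeff u m \<noteq> 0" "smult (inverse (coeff u m)) u \<in> VX"
proof -
  define U where "U = coeff u ` {i. i \<le> degree u \<and> coeff u i \<noteq> 0}"
  have "finite U" "0 \<notin> U" by (auto simp: U_def)
  moreover have "lead_coeff u \<in> U" using assms by (auto simp: U_def)
  hence "U \<noteq> {}" by blast
  ultimately obtain y where y: "y \<in> U" "\<And>x. x \<in> U \<Longrightarrow> x / y \<in> V" using dominant_element[of U] by blast
  obtain m where m: "y = coeff u m" "coeff u m \<noteq> 0" using y(1) by (auto simp: U_def)
  have "inverse (coeff u m) * coeff u i \<in> V" for i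
  proof (cases "coeff u i = 0")
    case False
    hence "coeff u i \<in> U" using le_degree[OF False] by (auto simp: U_def)
    from y(2)[OF this] show ?thesis by (simp add: m divide_inverse mult.commute)
  qed (simp add: V_0)
  hence "smult (inverse (coeff u m)) u \<in> VX" by (simp add: VX_def)
  thus ?thesis by (rule that[OF m(2)])
qed

end

context A_algebra
begin

lemma iota_pCons: "\<iota> (pCons c a) = \<iota> [:c:] + \<iota> [:0, 1:] * \<iota> a"
proof -
  have "pCons c a = [:c:] + [:0, 1:] * a" by simp
  thus ?thesis by (simp only: iota_add iota_mult)
qed

end

text \<open>A place of the large field that induces reduction modulo \<open>\<pi>\<close> on
  \<open>A\<close>, with a residue field algebraic over \<open>F\<^sub>q\<close>.\<close>

locale reduction = A_algebra \<iota> + place V f + R: Fq_field q \<kappa>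
  for q :: nat and \<kappa> :: "'q::{field, finite} \<Rightarrow> 'r::field"
    and \<iota> :: "'q poly \<Rightarrow> 'c::field" and V :: "'c set" and f :: "'c \<Rightarrow> 'r" +
  fixes \<pi> :: "'q poly"
  assumes const_V: "\<iota> [:c:] \<in> V" and f_const: "f (\<iota> [:c:]) = \<kappa> c"
    and T_V: "\<iota> [:0, 1:] \<in> V"
    and pi_nz: "\<pi> \<noteq> 0" and f_iota_eq_0_iff: "f (\<iota> a) = 0 \<longleftrightarrow> \<pi> dvd a"
    and frob_periodic: "\<exists>n>0. (x :: 'r) ^ (q ^ n) = x"
begin

definition \<theta> :: 'r where "\<theta> = f (\<iota> [:0, 1:])"

lemma iota_V: "\<iota> a \<in> V" and f_iota: "f (\<iota> a) = poly (map_poly \<kappa> a) \<theta>"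
proof -
  have "\<iota> a \<in> V \<and> f (\<iota> a) = poly (map_poly \<kappa> a) \<theta>"
  proof (induction a)
    case 0
    show ?case by (simp add: iota_0 V_0 f_0)
  next
    case (pCons c a)
    have IH: "\<iota> a \<in> V" "f (\<iota> a) = poly (map_poly \<kappa> a) \<theta>" using pCons.IH by blast+
    have "\<iota> (pCons c a) \<in> V"
      unfolding iota_pCons[of c a] by (intro V_add V_mult const_V T_V IH)
    moreover have "f (\<iota> (pCons c a)) = \<kappa> c + \<theta> * f (\<iota> a)"
      unfolding iota_pCons[of c a] f_add[OF const_V V_mult[OF T_V IH(1)]] f_mult[OF T_V IH(1)] f_const \<theta>_def ..
    moreover have "poly (map_poly \<kappa> (pCons c a)) \<theta> = \<kappa> c + \<theta> * poly (map_poly \<kappa> a) \<theta>"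
      by (simp add: Polynomial.map_poly_pCons R.kappa_0)
    ultimately show ?case using IH by simp
  qed
  thus "\<iota> a \<in> V" "f (\<iota> a) = poly (map_poly \<kappa> a) \<theta>" by blast+
qed

sublocale C: Fq_field q "\<lambda>c. \<iota> [:c:]"
proof
  show "q = CARD('q)" by (rule R.q_eq)
  fix x y :: 'q
  have "[:x + y:] = [:x:] + [:y:]" "[:x * y:] = [:x:] * [:y:]" by simp_all
  thus "\<iota> [:x + y:] = \<iota> [:x:] + \<iota> [:y:]" "\<iota> [:x * y:] = \<iota> [:x:] * \<iota> [:y:]"
    by (simp_all only: iota_add iota_mult)
  show "\<iota> [:1:] = 1" unfolding pCons_one by (rule iota_1)
qed

lemma reduced_module: "reduced_module q \<kappa> \<theta> \<pi>"
proof (intro reduced_module.intro reduced_module_axioms.intro)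
  show "Fq_field q \<kappa>" by (rule R.Fq_field_axioms)
  show "\<pi> \<noteq> 0" by (rule pi_nz)
  show "poly (map_poly \<kappa> a) \<theta> = 0 \<longleftrightarrow> \<pi> dvd a" for a
    by (simp only: f_iota_eq_0_iff flip: f_iota)
  show "\<exists>n>0. x ^ (q ^ n) = x" for x :: 'r by (rule frob_periodic)
qed

lemma VX_smult: "c \<in> V \<Longrightarrow> u \<in> VX \<Longrightarrow> smult c u \<in> VX"
  by (simp add: VX_def V_mult)

lemma red_smult: "c \<in> V \<Longrightarrow> u \<in> VX \<Longrightarrow> red (smult c u) = smult (f c) (red u)"
  by (rule poly_eqI) (simp add: coeff_red VX_def f_mult)

lemma VX_tm: "u \<in> VX \<Longrightarrow> w \<in> VX \<Longrightarrow> u \<star>\<^bsub>q\<^esub> w \<in> VX"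
  by (simp add: VX_def C.coeff_tm V_sum V_mult V_power)

lemma red_tm: "u \<in> VX \<Longrightarrow> w \<in> VX \<Longrightarrow> red (u \<star>\<^bsub>q\<^esub> w) = red u \<star>\<^bsub>q\<^esub> red w"
  by (rule poly_eqI)
    (simp add: coeff_red VX_def C.coeff_tm R.coeff_tm f_sum f_mult f_power V_mult V_power)

lemma VX_dmod:
  assumes "\<phi> \<in> VX"
  shows "C.dmod \<phi> a \<in> VX" and "red (C.dmod \<phi> a) = R.dmod (red \<phi>) a"
proof -
  have "C.dmod \<phi> a \<in> VX \<and> red (C.dmod \<phi> a) = R.dmod (red \<phi>) a"
  proof (induction a)
    case 0
    show ?case by (simp add: VX_0)
  next
    case (pCons c a)
    have const: "[:\<iota> [:c:]:] \<in> VX" "red [:\<iota> [:c:]:] = [:\<kappa> c:]"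
      by (simp_all add: VX_pCons VX_0 const_V red_pCons f_const)
    show ?case
      unfolding C.dmod_pCons R.dmod_pCons
      using pCons.IH const VX_tm[OF assms, of "C.dmod \<phi> a"] red_tm[OF assms, of "C.dmod \<phi> a"]
      by (simp add: VX_add red_add)
  qed
  thus "C.dmod \<phi> a \<in> VX" "red (C.dmod \<phi> a) = R.dmod (red \<phi>) a" by blast+
qed

subsection \<open>Endomorphisms over the large field\<close>

abbreviation dT :: "'c \<Rightarrow> 'c \<Rightarrow> 'c poly" where "dT g \<Delta> \<equiv> drinfeld_T \<iota> g \<Delta>"

lemma mem_drinfeld_End: "u \<in> drinfeld_End \<iota> g \<Delta> \<longleftrightarrow> u \<star>\<^bsub>q\<^esub> dT g \<Delta> = dT g \<Delta> \<star>\<^bsub>q\<^esub> u"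
  by (simp add: drinfeld_End_def R.q_eq)

lemma dEnd_diff: "u \<in> drinfeld_End \<iota> g \<Delta> \<Longrightarrow> v \<in> drinfeld_End \<iota> g \<Delta> \<Longrightarrow> u - v \<in> drinfeld_End \<iota> g \<Delta>"
  by (simp add: mem_drinfeld_End C.tm_diff_left C.tm_diff_right)

lemma dEnd_mult: "u \<in> drinfeld_End \<iota> g \<Delta> \<Longrightarrow> v \<in> drinfeld_End \<iota> g \<Delta> \<Longrightarrow> u \<star>\<^bsub>q\<^esub> v \<in> drinfeld_End \<iota> g \<Delta>"
proof -
  assume u: "u \<in> drinfeld_End \<iota> g \<Delta>" and v: "v \<in> drinfeld_End \<iota> g \<Delta>"
  have "(u \<star>\<^bsub>q\<^esub> v) \<star>\<^bsub>q\<^esub> dT g \<Delta> = (u \<star>\<^bsub>q\<^esub> dT g \<Delta>) \<star>\<^bsub>q\<^esub> v"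
    using v by (simp only: mem_drinfeld_End C.tm_assoc)
  also have "\<dots> = dT g \<Delta> \<star>\<^bsub>q\<^esub> (u \<star>\<^bsub>q\<^esub> v)" using u by (simp only: mem_drinfeld_End C.tm_assoc)
  finally show ?thesis by (simp only: mem_drinfeld_End)
qed

lemma dEnd_dmod: "C.dmod (dT g \<Delta>) a \<in> drinfeld_End \<iota> g \<Delta>"
  by (simp add: mem_drinfeld_End C.dmod_commute_self)

lemma coeff_dT_0: "coeff (dT g \<Delta>) 0 = \<iota> [:0, 1:]"
  by (simp add: drinfeld_T_def)

lemma coeff_dmod_dT_0: "coeff (C.dmod (dT g \<Delta>) a) 0 = \<iota> a"
proof (induction a)
  case (pCons c a)
  have "coeff (C.dmod (dT g \<Delta>) (pCons c a)) 0 = \<iota> [:c:] + \<iota> [:0, 1:] * \<iota> a"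
    unfolding C.dmod_pCons by (simp add: C.coeff_tm_0 coeff_dT_0 pCons.IH)
  thus ?case unfolding iota_pCons[of c a] .
qed (simp add: iota_0)

lemma T_transcendental:
  assumes "\<iota> [:0, 1:] ^ (q ^ k) = \<iota> [:0, 1:]"
  shows "k = 0"
proof -
  have "\<iota> ([:0, 1:] ^ (q ^ k) - [:0, 1:]) = 0" using assms by (simp add: iota_diff iota_power)
  hence "[:0, 1:] ^ (q ^ k) - [:0, 1 :: 'q:] = 0" by (rule iota_eq_0)
  hence eq: "[:0, 1:] ^ (q ^ k) = [:0, 1 :: 'q:]" by simp
  have "degree ([:0, 1 :: 'q:] ^ (q ^ k)) = q ^ k" by (rule degree_linear_power)
  hence "q ^ k = 1" unfolding eq by simp
  thus ?thesis using R.q_ge_2 by simp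
qed

text \<open>In \<open>u \<Phi>\<^sub>T = \<Phi>\<^sub>T u\<close> the lowest coefficient of
  \<open>u\<close>, in degree \<open>k\<close>, gives \<open>T ^ (q ^ k) = T\<close>, and
  \<open>T\<close> is transcendental.\<close>

lemma dEnd_inj:
  assumes u: "u \<in> drinfeld_End \<iota> g \<Delta>" and u0: "coeff u 0 = 0"
  shows "u = 0"
proof (rule ccontr)
  assume nz: "u \<noteq> 0"
  define k where "k = C.tord u"
  have uk: "coeff u k \<noteq> 0" unfolding k_def by (rule C.coeff_tord[OF nz])
  have "coeff (u \<star>\<^bsub>q\<^esub> dT g \<Delta>) (k + 0) = coeff u k * \<iota> [:0, 1:] ^ (q ^ k)"
    using C.coeff_tm_low(2)[OF C.low_tord[of u] C.low_0(1)[of "dT g \<Delta>"]] by (simp add: k_def coeff_dT_0)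
  moreover have "coeff (dT g \<Delta> \<star>\<^bsub>q\<^esub> u) (0 + k) = \<iota> [:0, 1:] * coeff u k"
    using C.coeff_tm_low(2)[OF C.low_0(1)[of "dT g \<Delta>"] C.low_tord[of u]] by (simp add: k_def coeff_dT_0)
  moreover have "u \<star>\<^bsub>q\<^esub> dT g \<Delta> = dT g \<Delta> \<star>\<^bsub>q\<^esub> u" using u by (simp only: mem_drinfeld_End)
  ultimately have "coeff u k * \<iota> [:0, 1:] ^ (q ^ k) = coeff u k * \<iota> [:0, 1:]"
    by (simp only: add_0 add_0_right mult.commute)
  hence "\<iota> [:0, 1:] ^ (q ^ k) = \<iota> [:0, 1:]" by (rule mult_left_cancel[OF uk, THEN iffD1])
  hence "k = 0" by (rule T_transcendental)
  thus False using uk u0 by simp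
qed

lemma dT_VX: "g \<in> V \<Longrightarrow> \<Delta> \<in> V \<Longrightarrow> dT g \<Delta> \<in> VX"
  by (simp add: drinfeld_T_def VX_pCons VX_0 T_V)

lemma red_dT: "red (dT g \<Delta>) = [:\<theta>, f g, f \<Delta>:]"
  by (simp add: drinfeld_T_def red_pCons \<theta>_def)

lemma dT_const: "dT g \<Delta> \<star>\<^bsub>q\<^esub> [:c:] = [:\<iota> [:0, 1:] * c, g * c ^ q, \<Delta> * c ^ (q ^ 2):]"
  by (rule poly_eqI) (auto simp: C.tm_const_right drinfeld_T_def coeff_pCons power2_eq_square split: nat.splits)

text \<open>Otherwise the dominant coefficient \<open>c\<close> of \<open>u\<close> is outside
  \<open>V\<close>. In \<open>\<Phi>\<^sub>T c\<close> the constant coefficient is then negligible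
  against one of \<open>g c\<^sup>q\<close> and \<open>\<Delta> * c ^ (q ^ 2)\<close>. After
  normalisation the equation \<open>\<Phi>\<^sub>T u = u \<Phi>\<^sub>T\<close> reduces to a
  vanishing product of two nonzero twisted polynomials.\<close>

lemma dEnd_integral:
  assumes V: "g \<in> V" "\<Delta> \<in> V" and unit: "f g \<noteq> 0 \<or> f \<Delta> \<noteq> 0" and u: "u \<in> drinfeld_End \<iota> g \<Delta>"
  shows "u \<in> VX"
proof (cases "u = 0")
  case True
  thus ?thesis by (simp add: VX_0)
next
  case False
  obtain m where m: "coeff u m \<noteq> 0" "smult (inverse (coeff u m)) u \<in> VX" by (rule dominant_coeff[OF False])
  define c where "c = coeff u m"
  define U where "U = smult (inverse c) u"
  have c0: "c \<noteq> 0" and U: "U \<in> VX" using m by (simp_all add: c_def U_def)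
  have uX: "u = smult c U" using c0 by (simp add: U_def)
  have "coeff (red U) m = 1" using m(1) by (simp add: coeff_red U_def c_def f_1)
  hence rX: "red U \<noteq> 0" by auto
  show ?thesis
  proof (cases "c \<in> V")
    case True
    thus ?thesis unfolding uX by (rule VX_smult[OF _ U])
  next
    case cV: False
    have ic: "inverse c \<in> V" "f (inverse c) = 0" using not_in_V[OF cV] by simp_all
    have small: "c / (h * c ^ k) \<in> V \<and> f (c / (h * c ^ k)) = 0" if h: "h \<in> V" "f h \<noteq> 0" and k: "k \<ge> 2" for h k
    proof -
      have ih: "inverse h \<in> V" using inverse_unit h by blast
      define l where "l = k - 2"
      have l: "k = Suc (Suc l)" using k by (simp add: l_def)
      have "c / (h * c ^ k) = inverse h * (inverse c * inverse c ^ l)"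
        using c0 f_nonzero[OF h(2)] by (simp add: l divide_inverse power_inverse)
      moreover have "inverse h * (inverse c * inverse c ^ l) \<in> V" by (intro V_mult V_power ih ic)
      moreover have "f (inverse h * (inverse c * inverse c ^ l)) = 0"
        using ih ic by (simp add: f_mult V_mult V_power)
      ultimately show ?thesis by simp
    qed
    define h1 where "h1 = g * c ^ q"
    define h2 where "h2 = \<Delta> * c ^ (q ^ 2)"
    have q2: "q ^ 2 \<ge> 2" using R.q_ge_2 power_increasing[of 1 2 q] by simp
    \<comment> \<open>The coefficients of \<open>\<Phi>\<^sub>T c\<close> outside degree zero; the
      normalisation is by the larger one.\<close>
    define X' where "X' = {h1, h2} - {0}"
    have unit': "\<exists>h\<in>X'. c / h \<in> V \<and> f (c / h) = 0"
    proof (cases "f g \<noteq> 0")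
      case True
      hence h: "h1 \<in> X'" using f_nonzero[OF True] c0 by (simp add: X'_def h1_def)
      have "c / h1 \<in> V \<and> f (c / h1) = 0" unfolding h1_def by (rule small[OF V(1) True R.q_ge_2])
      thus ?thesis using h by (rule bexI)
    next
      case fg: False
      hence fD: "f \<Delta> \<noteq> 0" using unit by blast
      hence h: "h2 \<in> X'" using f_nonzero[OF fD] c0 by (simp add: X'_def h2_def)
      have "c / h2 \<in> V \<and> f (c / h2) = 0" unfolding h2_def by (rule small[OF V(2) fD q2])
      thus ?thesis using h by (rule bexI)
    qed
    have "finite X'" "X' \<noteq> {}" "0 \<notin> X'" using unit' by (auto simp: X'_def)
    then obtain N where N: "N \<in> X'" "\<And>x. x \<in> X' \<Longrightarrow> x / N \<in> V" using dominant_element[of X'] by blast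
    have N0: "N \<noteq> 0" using N(1) by (simp add: X'_def)
    have hV: "h1 / N \<in> V" "h2 / N \<in> V"
    proof -
      show "h1 / N \<in> V" using N(2)[of h1] V_0 by (cases "h1 = 0") (simp_all add: X'_def)
      show "h2 / N \<in> V" using N(2)[of h2] V_0 by (cases "h2 = 0") (simp_all add: X'_def)
    qed
    obtain h where h: "h \<in> X'" "c / h \<in> V" "f (c / h) = 0" using unit' by blast
    have h0: "h \<noteq> 0" using h(1) by (simp add: X'_def)
    have cN: "c / N \<in> V" "f (c / N) = 0"
    proof -
      have eq: "c / N = (c / h) * (h / N)" using h0 by simp
      show "c / N \<in> V" by (subst eq) (rule V_mult[OF h(2) N(2)[OF h(1)]])
      show "f (c / N) = 0" by (subst eq) (simp only: f_mult[OF h(2) N(2)[OF h(1)]] h(3) mult_zero_left)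
    qed
    define \<Psi> where "\<Psi> = [:(c / N) * \<iota> [:0, 1:], h1 / N, h2 / N:]"
    have \<Psi>: "\<Psi> \<in> VX" "red \<Psi> = [:0, f (h1 / N), f (h2 / N):]"
    proof -
      have t: "(c / N) * \<iota> [:0, 1:] \<in> V" by (rule V_mult[OF cN(1) T_V])
      have ft: "f ((c / N) * \<iota> [:0, 1:]) = 0" by (simp only: f_mult[OF cN(1) T_V] cN(2) mult_zero_left)
      show "\<Psi> \<in> VX" unfolding \<Psi>_def by (simp only: VX_pCons VX_0 t hV simp_thms)
      show "red \<Psi> = [:0, f (h1 / N), f (h2 / N):]" unfolding \<Psi>_def red_pCons ft by simp
    qed
    have "\<Psi> = smult (inverse N) (dT g \<Delta> \<star>\<^bsub>q\<^esub> [:c:])"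
      by (simp add: \<Psi>_def dT_const h1_def h2_def divide_inverse ac_simps)
    hence "\<Psi> \<star>\<^bsub>q\<^esub> U = smult (inverse N) (dT g \<Delta> \<star>\<^bsub>q\<^esub> u)"
      by (simp only: uX C.tm_const_left[symmetric] C.tm_assoc)
    also have "\<dots> = smult (inverse N) (u \<star>\<^bsub>q\<^esub> dT g \<Delta>)" using u by (simp only: mem_drinfeld_End)
    also have "\<dots> = smult (c / N) (U \<star>\<^bsub>q\<^esub> dT g \<Delta>)"
      by (simp only: uX C.smult_tm smult_smult divide_inverse mult.commute)
    finally have "red (\<Psi> \<star>\<^bsub>q\<^esub> U) = red (smult (c / N) (U \<star>\<^bsub>q\<^esub> dT g \<Delta>))" by (rule arg_cong)
    hence "red \<Psi> \<star>\<^bsub>q\<^esub> red U = 0"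
      using cN by (simp add: red_tm[OF \<Psi>(1) U] red_smult[OF cN(1) VX_tm[OF U dT_VX[OF V]]])
    hence "red \<Psi> = 0" using rX by (simp only: R.tm_eq_0_iff simp_thms)
    hence ab: "f (h1 / N) = 0" "f (h2 / N) = 0" unfolding \<Psi>(2) by simp_all
    have "N = h1 \<or> N = h2" using N(1) by (auto simp: X'_def)
    hence "f (N / N) = 0"
    proof
      assume N: "N = h1"
      show ?thesis using ab(1) by (simp only: N)
    next
      assume N: "N = h2"
      show ?thesis using ab(2) by (simp only: N)
    qed
    thus ?thesis using N0 f_1 by simp
  qed
qed

text \<open>Conjugation by the dominant coefficient \<open>c\<close>, which reduces to zero, turns
  \<open>\<Phi>\<^sub>T\<close> into something that reduces to the constant
  \<open>\<theta>\<close>, while \<open>\<Phi>\<^sub>T\<close> itself reduces to \<open>\<theta> +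
  \<tau>\<close>; the degrees do not match.\<close>

lemma bad_reduction_small_zero:
  assumes D: "\<Delta> \<in> V" "f \<Delta> = 0" and w: "w \<in> drinfeld_End \<iota> 1 \<Delta>" "w \<in> VX" and red0: "red w = 0"
  shows "w = 0"
proof (rule ccontr)
  assume nz: "w \<noteq> 0"
  obtain m where m: "coeff w m \<noteq> 0" "smult (inverse (coeff w m)) w \<in> VX" by (rule dominant_coeff[OF nz])
  define c where "c = coeff w m"
  define U where "U = smult (inverse c) w"
  have c0: "c \<noteq> 0" and U: "U \<in> VX" using m by (simp_all add: c_def U_def)
  have wU: "w = smult c U" using c0 by (simp add: U_def)
  have cV: "c \<in> V" using w(2) by (simp add: c_def VX_def)
  have fc: "f c = 0" using arg_cong[OF red0, of "\<lambda>p. coeff p m"] by (simp add: coeff_red c_def)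
  have "coeff (red U) m = 1" using m(1) by (simp add: coeff_red U_def c_def f_1)
  hence rX: "red U \<noteq> 0" by auto
  have pw: "inverse c * c ^ k = c ^ (k - 1)" if "k \<ge> 1" for k
    using c0 that by (cases k) simp_all
  define \<Psi> where "\<Psi> = [:\<iota> [:0, 1:], c ^ (q - 1), \<Delta> * c ^ (q ^ 2 - 1):]"
  have q1: "q \<ge> 1" "q - 1 > 0" "q ^ 2 \<ge> 1" using R.q_ge_2 by simp_all
  have \<Psi>: "\<Psi> \<in> VX" "red \<Psi> = [:\<theta>, 0, 0:]"
    using T_V cV D fc q1 by (simp_all add: \<Psi>_def VX_pCons VX_0 V_mult V_power red_pCons f_mult f_power \<theta>_def power_0_left)
  have "smult (inverse c) (dT 1 \<Delta> \<star>\<^bsub>q\<^esub> [:c:]) = [:inverse c * (\<iota> [:0, 1:] * c), inverse c * c ^ q, inverse c * (\<Delta> * c ^ (q ^ 2)):]"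
    by (simp add: dT_const)
  also have "\<dots> = \<Psi>"
    unfolding mult.left_commute[of "inverse c"] pw[OF q1(1)] pw[OF q1(3)] \<Psi>_def using c0 by simp
  finally have PsiEq: "smult (inverse c) (dT 1 \<Delta> \<star>\<^bsub>q\<^esub> [:c:]) = \<Psi>" .
  have "\<Psi> \<star>\<^bsub>q\<^esub> U = smult (inverse c) (dT 1 \<Delta> \<star>\<^bsub>q\<^esub> w)"
    by (simp only: PsiEq[symmetric] wU C.tm_const_left[symmetric] C.tm_assoc)
  also have "\<dots> = smult (inverse c) (w \<star>\<^bsub>q\<^esub> dT 1 \<Delta>)" using w(1) by (simp only: mem_drinfeld_End)
  also have "\<dots> = U \<star>\<^bsub>q\<^esub> dT 1 \<Delta>" by (simp only: U_def C.smult_tm)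
  finally have "red (\<Psi> \<star>\<^bsub>q\<^esub> U) = red (U \<star>\<^bsub>q\<^esub> dT 1 \<Delta>)" by (rule arg_cong)
  hence eq: "[:\<theta>:] \<star>\<^bsub>q\<^esub> red U = red U \<star>\<^bsub>q\<^esub> [:\<theta>, 1:]"
    unfolding red_tm[OF \<Psi>(1) U] red_tm[OF U dT_VX[OF V_1 D(1)]] \<Psi>(2) red_dT by (simp add: D f_1)
  have psi: "[:\<theta>, 1:] \<noteq> 0" by simp
  have "degree (red U \<star>\<^bsub>q\<^esub> [:\<theta>, 1:]) = degree (red U) + 1"
    using R.tm_nonzero(2)[OF rX psi] by simp
  moreover have "degree ([:\<theta>:] \<star>\<^bsub>q\<^esub> red U) \<le> degree (red U)"
    unfolding R.tm_const_left by (rule degree_smult_le)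
  ultimately show False unfolding eq by simp
qed

text \<open>Modules with complex multiplication have potentially good reduction. When
  \<open>\<Delta>\<close> reduces to zero, the reduction has rank one and only the endomorphisms
  given by \<open>A\<close>; subtracting one of these leaves an endomorphism that reduces to zero,
  hence is zero.\<close>

theorem bad_reduction_no_CM:
  assumes D: "\<Delta> \<in> V" "f \<Delta> = 0"
  shows "drinfeld_order \<iota> 1 \<Delta> = range \<iota>"
proof
  have vx: "dT 1 \<Delta> \<in> VX" by (rule dT_VX[OF V_1 D(1)])
  show "range \<iota> \<subseteq> drinfeld_order \<iota> 1 \<Delta>"
  proof clarify
    fix a
    show "\<iota> a \<in> drinfeld_order \<iota> 1 \<Delta>"
      unfolding drinfeld_order_def
      by (rule image_eqI[OF _ dEnd_dmod[of 1 \<Delta> a]]) (simp only: coeff_dmod_dT_0)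
  qed
  show "drinfeld_order \<iota> 1 \<Delta> \<subseteq> range \<iota>"
  proof
    fix x assume "x \<in> drinfeld_order \<iota> 1 \<Delta>"
    then obtain u where u: "u \<in> drinfeld_End \<iota> 1 \<Delta>" and x: "x = coeff u 0" by (auto simp: drinfeld_order_def)
    have fu: "f 1 \<noteq> 0 \<or> f \<Delta> \<noteq> 0" using f_1 by simp
    have uV: "u \<in> VX" by (rule dEnd_integral[OF V_1 D(1) fu u])
    have rT: "red (dT 1 \<Delta>) = [:\<theta>, 1:]" by (simp add: red_dT D f_1)
    have "red (u \<star>\<^bsub>q\<^esub> dT 1 \<Delta>) = red (dT 1 \<Delta> \<star>\<^bsub>q\<^esub> u)" using u by (simp only: mem_drinfeld_End)
    hence "red u \<star>\<^bsub>q\<^esub> [:\<theta>, 1:] = [:\<theta>, 1:] \<star>\<^bsub>q\<^esub> red u"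
      by (simp only: red_tm[OF uV vx] red_tm[OF vx uV] rT)
    from R.centralizer_rank_one[OF this] obtain a where a: "red u = R.dmod [:\<theta>, 1:] a" by (rule exE)
    define w where "w = u - C.dmod (dT 1 \<Delta>) a"
    have "w \<in> drinfeld_End \<iota> 1 \<Delta>" unfolding w_def by (rule dEnd_diff[OF u dEnd_dmod])
    moreover have "w \<in> VX" unfolding w_def by (rule VX_diff[OF uV VX_dmod(1)[OF vx]])
    moreover have "red w = 0"
      unfolding w_def red_diff[OF uV VX_dmod(1)[OF vx]] VX_dmod(2)[OF vx] rT a by simp
    ultimately have "w = 0" by (rule bad_reduction_small_zero[OF D])
    hence "u = C.dmod (dT 1 \<Delta>) a" by (simp add: w_def)
    hence "x = \<iota> a" by (simp only: x coeff_dmod_dT_0)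
    thus "x \<in> range \<iota>" by blast
  qed
qed

subsection \<open>Good reduction\<close>

definition lift_End :: "'c \<Rightarrow> 'c \<Rightarrow> 'c poly"
  where "lift_End g x = (THE u. u \<in> drinfeld_End \<iota> g 1 \<and> coeff u 0 = x)"

definition red_End :: "'c \<Rightarrow> 'c \<Rightarrow> 'r poly"
  where "red_End g x = red (lift_End g x)"

lemma lift_End_eq: "u \<in> drinfeld_End \<iota> g 1 \<Longrightarrow> lift_End g (coeff u 0) = u"
proof -
  assume u: "u \<in> drinfeld_End \<iota> g 1"
  show ?thesis
    unfolding lift_End_def
  proof (rule the_equality)
    show "u \<in> drinfeld_End \<iota> g 1 \<and> coeff u 0 = coeff u 0" using u by simp
    fix v assume "v \<in> drinfeld_End \<iota> g 1 \<and> coeff v 0 = coeff u 0"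
    hence "v - u = 0" using u by (intro dEnd_inj[OF dEnd_diff]) auto
    thus "v = u" by simp
  qed
qed

lemma drinfeld_orderE:
  assumes "x \<in> drinfeld_order \<iota> g 1"
  obtains u where "u \<in> drinfeld_End \<iota> g 1" "coeff u 0 = x" "lift_End g x = u"
proof -
  obtain u where u: "u \<in> drinfeld_End \<iota> g 1" and x: "x = coeff u 0"
    using assms by (auto simp: drinfeld_order_def)
  show ?thesis by (rule that[OF u x[symmetric]]) (simp only: x lift_End_eq[OF u])
qed

lemma dEnd_VX: "g \<in> V \<Longrightarrow> u \<in> drinfeld_End \<iota> g 1 \<Longrightarrow> u \<in> VX"
  by (rule dEnd_integral[of g 1]) (simp_all add: V_1 f_1)

text \<open>Reduction is injective on endomorphisms because their leading coefficients satisfy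
  \<open>c ^ (q ^ 2) = c\<close> and are therefore units.\<close>

lemma drinfeld_order_represented:
  assumes g: "g \<in> V"
  shows "represented q \<kappa> \<theta> (f g) \<pi> \<iota> (drinfeld_order \<iota> g 1) (red_End g)"
proof -
  interpret E: reduced_module q \<kappa> \<theta> "f g" \<pi> by (rule reduced_module)
  let ?O = "drinfeld_order \<iota> g 1"
  have phi: "red (dT g 1) = E.\<phi>" by (simp add: red_dT E.\<phi>_def f_1)
  have vx: "dT g 1 \<in> VX" by (rule dT_VX[OF g V_1])
  have O: "coeff u 0 \<in> ?O" "red_End g (coeff u 0) = red u" if "u \<in> drinfeld_End \<iota> g 1" for u
    using that by (simp_all add: drinfeld_order_def red_End_def lift_End_eq)
  show ?thesis
  proof (intro represented.intro represented_axioms.intro)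
    show "reduced_module q \<kappa> \<theta> \<pi>" by (rule reduced_module)
    show "A_algebra \<iota>" by (rule A_algebra_axioms)
    fix a
    show "\<iota> a \<in> ?O" "red_End g (\<iota> a) = E.\<Phi> a"
      using O[OF dEnd_dmod[of g 1 a]] by (simp_all add: coeff_dmod_dT_0 VX_dmod(2)[OF vx] phi)
  next
    fix x assume "x \<in> ?O"
    then obtain u where u: "u \<in> drinfeld_End \<iota> g 1" "coeff u 0 = x" "lift_End g x = u"
      by (rule drinfeld_orderE)
    have uV: "u \<in> VX" by (rule dEnd_VX[OF g u(1)])
    have rx: "red_End g x = red u" using O(2)[OF u(1)] u(2) by simp
    show "red_End g x \<in> E.End"
    proof -
      have "red (u \<star>\<^bsub>q\<^esub> dT g 1) = red (dT g 1 \<star>\<^bsub>q\<^esub> u)" using u(1) by (simp only: mem_drinfeld_End)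
      thus ?thesis by (simp only: red_tm[OF uV vx] red_tm[OF vx uV] phi rx E.End_def mem_Collect_eq)
    qed
    show "x = 0" if "red_End g x = 0"
    proof (rule ccontr)
      assume x0: "x \<noteq> 0"
      hence u0: "u \<noteq> 0" using u(2) by auto
      define c where "c = lead_coeff u"
      have c0: "c \<noteq> 0" using u0 by (simp add: c_def)
      have dT0: "dT g 1 \<noteq> 0" "degree (dT g 1) = 2" "lead_coeff (dT g 1) = 1" by (simp_all add: drinfeld_T_def)
      have "lead_coeff (u \<star>\<^bsub>q\<^esub> dT g 1) = lead_coeff (dT g 1 \<star>\<^bsub>q\<^esub> u)" using u(1) by (simp only: mem_drinfeld_End)
      hence "c ^ (q ^ 2) = c"
        using C.tm_nonzero(3)[OF u0 dT0(1)] C.tm_nonzero(3)[OF dT0(1) u0] dT0 by (simp add: c_def)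
      hence cq: "c ^ (q ^ 2) = c" .
      have pos: "Suc (q ^ 2 - 1) = q ^ 2" "q ^ 2 - 1 > 0"
        using R.q_ge_2 power_increasing[of 1 2 q] by simp_all
      have "c * c ^ (q ^ 2 - 1) = c ^ Suc (q ^ 2 - 1)" by (rule power_Suc[symmetric])
      also have "\<dots> = c" by (simp only: pos(1) cq)
      finally have "c ^ (q ^ 2 - 1) = 1" using c0 by simp
      hence "f c ^ (q ^ 2 - 1) = 1" using f_power[of c "q ^ 2 - 1"] uV f_1 by (simp add: c_def VX_def)
      hence "f c \<noteq> 0" using pos(2) by (auto simp: power_0_left)
      moreover have "f c = 0"
      proof -
        have "red u = 0" using that rx by simp
        hence "coeff (red u) (degree u) = 0" by simp
        thus ?thesis by (simp add: coeff_red c_def)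
      qed
      ultimately show False by simp
    qed
    fix y assume "y \<in> ?O"
    then obtain v where v: "v \<in> drinfeld_End \<iota> g 1" "coeff v 0 = y" "lift_End g y = v"
      by (rule drinfeld_orderE)
    have vV: "v \<in> VX" by (rule dEnd_VX[OF g v(1)])
    have ry: "red_End g y = red v" using O(2)[OF v(1)] v(2) by simp
    show "x - y \<in> ?O" "red_End g (x - y) = red_End g x - red_End g y"
      "x * y \<in> ?O" "red_End g (x * y) = red_End g x \<star>\<^bsub>q\<^esub> red_End g y"
      using O[OF dEnd_diff[OF u(1) v(1)]] O[OF dEnd_mult[OF u(1) v(1)]]
      by (simp_all add: rx ry red_diff[OF uV vV] red_tm[OF uV vV] u(2) v(2) C.coeff_tm_0)
  qed
qed

end

section \<open>Deformations in the ordinary case\<close>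

context reduction
begin

definition diff_quot :: "'c \<Rightarrow> 'c poly \<Rightarrow> 'c poly \<Rightarrow> 'c poly"
  where "diff_quot c u1 u2 = smult (inverse c) (u2 - u1)"

lemma coeff_diff_quot: "coeff (diff_quot c u1 u2) i = inverse c * (coeff u2 i - coeff u1 i)"
  by (simp add: diff_quot_def)

text \<open>A twisted Leibniz rule. Moving \<open>c\<close> past \<open>\<tau>\<^sup>i\<close>
  multiplies the \<open>i\<close>-th coefficient of \<open>u1\<close> by \<open>c\<close> to the
  power \<open>q\<^sup>i - 1\<close>, so only its constant coefficient survives reduction.\<close>

lemma diff_quot_mult:
  assumes c: "c \<noteq> 0" "c \<in> V" "f c = 0"
    and V: "u1 \<in> VX" "w2 \<in> VX" "diff_quot c u1 u2 \<in> VX" "diff_quot c w1 w2 \<in> VX"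
  shows "diff_quot c (u1 \<star>\<^bsub>q\<^esub> w1) (u2 \<star>\<^bsub>q\<^esub> w2) \<in> VX"
    and "red (diff_quot c (u1 \<star>\<^bsub>q\<^esub> w1) (u2 \<star>\<^bsub>q\<^esub> w2)) =
      red (diff_quot c u1 u2) \<star>\<^bsub>q\<^esub> red w2 + smult (f (coeff u1 0)) (red (diff_quot c w1 w2))"
proof -
  define u' where "u' = twisted_conj q c u1"
  have cf: "coeff u' i = coeff u1 i * c ^ (q ^ i - 1)" for i by (simp add: u'_def coeff_twisted_conj)
  have uV: "u' \<in> VX" using V(1) c(2) by (simp add: VX_def cf V_mult V_power)
  have ru: "red u' = [:f (coeff u1 0):]"
  proof (rule poly_eqI)
    fix i
    show "coeff (red u') i = coeff [:f (coeff u1 0):] i"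
    proof (cases i)
      case (Suc j)
      have "q ^ i > 1" by (rule one_less_power) (use R.q_ge_2 Suc in simp_all)
      hence "q ^ i - 1 > 0" by simp
      hence "f (c ^ (q ^ i - 1)) = 0" by (simp add: f_power[OF c(2)] c(3) power_0_left)
      moreover have "f (coeff u1 i * c ^ (q ^ i - 1)) = f (coeff u1 i) * f (c ^ (q ^ i - 1))"
        by (rule f_mult[OF VX_coeff[OF V(1)] V_power[OF c(2)]])
      ultimately have "f (coeff u' i) = 0" by (simp only: cf mult_zero_right)
      thus ?thesis by (simp add: coeff_red Suc)
    qed (simp add: coeff_red cf)
  qed
  have W: "w2 - w1 = smult c (diff_quot c w1 w2)" using c(1) by (simp add: diff_quot_def)
  have pow: "inverse c * (a * (c * b) ^ Suc k) = a * c ^ k * b ^ Suc k" for a b k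
  proof -
    have eq: "a * (c * b) ^ Suc k = c * (a * c ^ k * b ^ Suc k)" by (simp add: power_mult_distrib)
    show ?thesis unfolding eq mult.assoc[symmetric] left_inverse[OF c(1)] mult_1_left ..
  qed
  have conj: "smult (inverse c) (u1 \<star>\<^bsub>q\<^esub> smult c B) = u' \<star>\<^bsub>q\<^esub> B" for B
  proof (rule poly_eqI)
    fix n
    have "inverse c * (coeff u1 i * (c * coeff B (n - i)) ^ (q ^ i)) = coeff u' i * coeff B (n - i) ^ (q ^ i)" for i
    proof -
      have "Suc (q ^ i - 1) = q ^ i" using R.q_pos by simp
      thus ?thesis using pow[of "coeff u1 i" "coeff B (n - i)" "q ^ i - 1"] by (simp only: cf)
    qed
    thus "coeff (smult (inverse c) (u1 \<star>\<^bsub>q\<^esub> smult c B)) n = coeff (u' \<star>\<^bsub>q\<^esub> B) n"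
      by (simp add: C.coeff_tm sum_distrib_left)
  qed
  have "u2 \<star>\<^bsub>q\<^esub> w2 - u1 \<star>\<^bsub>q\<^esub> w1 = (u2 - u1) \<star>\<^bsub>q\<^esub> w2 + u1 \<star>\<^bsub>q\<^esub> (w2 - w1)"
    by (simp add: C.tm_diff_left C.tm_diff_right)
  hence "diff_quot c (u1 \<star>\<^bsub>q\<^esub> w1) (u2 \<star>\<^bsub>q\<^esub> w2)
      = smult (inverse c) ((u2 - u1) \<star>\<^bsub>q\<^esub> w2) + smult (inverse c) (u1 \<star>\<^bsub>q\<^esub> (w2 - w1))"
    by (simp only: diff_quot_def smult_add_right)
  also have "smult (inverse c) ((u2 - u1) \<star>\<^bsub>q\<^esub> w2) = diff_quot c u1 u2 \<star>\<^bsub>q\<^esub> w2"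
    by (simp only: C.smult_tm diff_quot_def)
  also have "smult (inverse c) (u1 \<star>\<^bsub>q\<^esub> (w2 - w1)) = u' \<star>\<^bsub>q\<^esub> diff_quot c w1 w2"
    unfolding W by (rule conj)
  finally have eq: "diff_quot c (u1 \<star>\<^bsub>q\<^esub> w1) (u2 \<star>\<^bsub>q\<^esub> w2)
      = diff_quot c u1 u2 \<star>\<^bsub>q\<^esub> w2 + u' \<star>\<^bsub>q\<^esub> diff_quot c w1 w2" .
  note vx = VX_tm[OF V(3) V(2)] VX_tm[OF uV V(4)]
  show "diff_quot c (u1 \<star>\<^bsub>q\<^esub> w1) (u2 \<star>\<^bsub>q\<^esub> w2) \<in> VX" unfolding eq by (rule VX_add[OF vx])
  show "red (diff_quot c (u1 \<star>\<^bsub>q\<^esub> w1) (u2 \<star>\<^bsub>q\<^esub> w2)) =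
      red (diff_quot c u1 u2) \<star>\<^bsub>q\<^esub> red w2 + smult (f (coeff u1 0)) (red (diff_quot c w1 w2))"
    unfolding eq red_add[OF vx] red_tm[OF V(3) V(2)] red_tm[OF uV V(4)] ru R.tm_const_left ..
qed

lemma diff_quot_dmod:
  assumes c: "c \<noteq> 0" "c \<in> V" "f c = 0"
    and V: "\<phi>1 \<in> VX" "\<phi>2 \<in> VX" "diff_quot c \<phi>1 \<phi>2 \<in> VX"
  shows "diff_quot c (C.dmod \<phi>1 a) (C.dmod \<phi>2 a) \<in> VX"
proof (induction a)
  case 0
  show ?case by (simp add: diff_quot_def VX_0)
next
  case (pCons b a)
  have "diff_quot c (C.dmod \<phi>1 (pCons b a)) (C.dmod \<phi>2 (pCons b a))
      = diff_quot c (\<phi>1 \<star>\<^bsub>q\<^esub> C.dmod \<phi>1 a) (\<phi>2 \<star>\<^bsub>q\<^esub> C.dmod \<phi>2 a)"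
    unfolding C.dmod_pCons diff_quot_def by simp
  thus ?case using diff_quot_mult(1)[OF c V(1) VX_dmod(1)[OF V(2)] V(3) pCons.IH] by simp
qed

end

context reduced_module
begin

lemma tm_phi_degree: "u \<noteq> 0 \<Longrightarrow> degree (u \<star>\<^bsub>q\<^esub> \<phi>) = degree u + 2"
  using tm_nonzero(2)[of u "\<phi>"] phi_degree by simp

lemma theta_commute_0:
  assumes "u \<star>\<^bsub>q\<^esub> \<phi> = smult \<theta> u"
  shows "u = 0"
proof (rule ccontr)
  assume "u \<noteq> 0"
  hence "degree (smult \<theta> u) = degree u + 2" using tm_phi_degree[of u] assms by simp
  thus False using degree_smult_le[of \<theta> u] by simp
qed

end

context ordinary_module
begin

text \<open>Here \<open>U\<close>, \<open>W\<close>, \<open>Y\<pi>\<close> and \<open>Ym\<close>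
  are the first order variations of \<open>\<Phi>\<^sub>T\<close>, of a lift of
  \<open>\<Phi>\<^sub>m \<tau>\<^sup>n\<close>, of \<open>\<Phi>\<^sub>\<pi>\<close> and of
  \<open>\<Phi>\<^sub>m\<close>. The lowest terms of the first two equations show that
  \<open>\<tau>\<^sup>n\<close> divides \<open>W\<close>. After cancellation \<open>W'\<close> and
  \<open>Ym\<close> satisfy nearly the same equation, and comparing degrees shows that they agree
  and that the variation of \<open>\<Phi>\<^sub>T\<close> vanishes.\<close>

lemma no_first_order_deformation:
  assumes n: "n > 0" "monom 1 n \<in> End" and m: "\<not> \<pi> dvd m"
    and X: "degree U \<le> 1" "coeff U 0 = 0" and Y0: "coeff Y\<pi> 0 = 0"
    and e1: "W \<star>\<^bsub>q\<^esub> \<phi> = U \<star>\<^bsub>q\<^esub> (\<Phi> m \<star>\<^bsub>q\<^esub> monom 1 n) + smult \<theta> W"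
    and e2: "W \<star>\<^bsub>q\<^esub> \<Phi> \<pi> = Y\<pi> \<star>\<^bsub>q\<^esub> (\<Phi> m \<star>\<^bsub>q\<^esub> monom 1 n)"
    and e3: "Ym \<star>\<^bsub>q\<^esub> \<phi> + smult (ev m) U = U \<star>\<^bsub>q\<^esub> \<Phi> m + smult \<theta> Ym"
  shows "U = 0 \<and> W = 0"
proof -
  have pi_ord: "tord (\<Phi> \<pi>) = d" by (rule ordinary)
  have lowt: "low n (\<Phi> m \<star>\<^bsub>q\<^esub> monom 1 n)"
    using coeff_tm_low(1)[of 0 "\<Phi> m" n "monom 1 n"] by (simp add: low_def)
  have low1: "low (Suc n) (w \<star>\<^bsub>q\<^esub> (\<Phi> m \<star>\<^bsub>q\<^esub> monom 1 n))" if "coeff w 0 = 0" for w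
    using coeff_tm_low(1)[of 1 w n, OF _ lowt] that by (simp add: low_def)
  have m0: "monom (1 :: 'f) n \<noteq> 0" by (simp add: monom_eq_0_iff)
  have tn: "tord (monom (1 :: 'f) n) = n" by (rule tord_eqI) (simp_all add: low_def)
  have dn: "d dvd n" using End_tord_dvd[OF n(2) m0] by (simp only: tn)
  have "low n W"
  proof (cases "W = 0")
    case False
    define k where "k = tord W"
    have Wk: "coeff W k \<noteq> 0" "low k W" by (simp_all add: k_def coeff_tord[OF False] low_tord)
    show ?thesis
    proof (cases "k \<le> n")
      case True
      have "coeff (W \<star>\<^bsub>q\<^esub> \<phi>) (k + 0) = coeff W k * \<theta> ^ (q ^ k)"
        using coeff_tm_low(2)[OF Wk(2) low_0(1)[of "\<phi>"]] by (simp add: phi_degree)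
      moreover have "coeff (U \<star>\<^bsub>q\<^esub> (\<Phi> m \<star>\<^bsub>q\<^esub> monom 1 n)) k = 0"
        using low1[OF X(2)] True by (simp add: low_def)
      hence "coeff (W \<star>\<^bsub>q\<^esub> \<phi>) k = \<theta> * coeff W k" unfolding e1 by simp
      ultimately have "coeff W k * \<theta> ^ (q ^ k) = \<theta> * coeff W k" by (simp only: add_0_right)
      hence "coeff W k * \<theta> ^ (q ^ k) = coeff W k * \<theta>" by (simp only: mult.commute)
      hence "\<theta> ^ (q ^ k) = \<theta>" by (rule mult_left_cancel[OF Wk(1), THEN iffD1])
      hence dk: "d dvd k" by (rule theta_period)
      have pz: "\<Phi> \<pi> \<noteq> 0" using pi_nz by (simp add: Phi_eq_0_iff)
      have "coeff (W \<star>\<^bsub>q\<^esub> \<Phi> \<pi>) (k + d) = coeff W k * coeff (\<Phi> \<pi>) d ^ (q ^ k)"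
        using coeff_tm_low(2)[OF Wk(2) low_tord[of "\<Phi> \<pi>"]] by (simp only: pi_ord)
      hence "coeff (W \<star>\<^bsub>q\<^esub> \<Phi> \<pi>) (k + d) \<noteq> 0"
        using Wk(1) coeff_tord[OF pz] by (simp add: pi_ord)
      hence "\<not> k + d < Suc n" using low1[OF Y0] unfolding e2 low_def by blast
      moreover have "d dvd n - k" using dn dk by (rule dvd_diff_nat)
      ultimately have "n - k = 0" using True by (auto dest: dvd_imp_le)
      thus ?thesis using Wk(2) low_mono by simp
    next
      case False
      thus ?thesis using Wk(2) low_mono by simp
    qed
  qed simp
  then obtain W' where W': "W = W' \<star>\<^bsub>q\<^esub> monom 1 n"
    by (rule tm_monom_divides[OF _ one_neq_zero])
  have "(W' \<star>\<^bsub>q\<^esub> \<phi>) \<star>\<^bsub>q\<^esub> monom 1 n = W \<star>\<^bsub>q\<^esub> \<phi>"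
    using n(2) by (simp add: W' tm_assoc End_def)
  also have "\<dots> = (U \<star>\<^bsub>q\<^esub> \<Phi> m + smult \<theta> W') \<star>\<^bsub>q\<^esub> monom 1 n"
    unfolding e1 by (simp only: W' tm_add_left tm_assoc flip: tm_const_left)
  finally have e1': "W' \<star>\<^bsub>q\<^esub> \<phi> = U \<star>\<^bsub>q\<^esub> \<Phi> m + smult \<theta> W'" by (rule tm_right_cancel[OF _ m0])
  define Z where "Z = W' - Ym"
  have eZ: "Z \<star>\<^bsub>q\<^esub> \<phi> = smult \<theta> Z + smult (ev m) U"
  proof -
    have "Z \<star>\<^bsub>q\<^esub> \<phi> = (W' \<star>\<^bsub>q\<^esub> \<phi>) - (Ym \<star>\<^bsub>q\<^esub> \<phi> + smult (ev m) U) + smult (ev m) U"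
      unfolding Z_def tm_diff_left by simp
    thus ?thesis unfolding e1' e3 by (simp add: Z_def smult_diff_right)
  qed
  have Z0: "Z = 0"
  proof (rule ccontr)
    assume "Z \<noteq> 0"
    hence "degree (smult \<theta> Z + smult (ev m) U) = degree Z + 2" using tm_phi_degree[of Z] eZ by simp
    moreover have "degree (smult \<theta> Z + smult (ev m) U) \<le> degree Z + 1"
      using degree_smult_le[of \<theta> Z] degree_smult_le[of "ev m" U] X(1) by (intro degree_add_le) simp_all
    ultimately show False by simp
  qed
  have "ev m \<noteq> 0" using m eval_eq_0_iff by blast
  hence U0: "U = 0" using eZ by (simp add: Z0)
  hence "W' = 0" using e1' theta_commute_0[of W'] by simp
  thus ?thesis using U0 W' by simp
qed

end

context reduction
begin

text \<open>An ordinary module has at most one lift to which a multiple of Frobenius lifts with a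
  given constant coefficient. If there were two, the quotients of \<open>g2 - g1\<close> and
  \<open>w2 - w1\<close> by the dominant one among all these differences would reduce to a
  nontrivial first order deformation.\<close>

theorem ordinary_lift_unique:
  assumes g: "g1 \<in> V" "g2 \<in> V" "f g1 = f g2"
    and ord: "ordinary_module q \<kappa> \<theta> (f g1) \<pi>"
    and w: "w1 \<in> drinfeld_End \<iota> g1 1" "w2 \<in> drinfeld_End \<iota> g2 1" "coeff w1 0 = coeff w2 0"
    and n: "n > 0" "monom 1 n \<in> reduced_module.End q \<theta> (f g1)" and m: "\<not> \<pi> dvd m"
    and r: "red w1 = R.dmod [:\<theta>, f g1, 1:] m \<star>\<^bsub>q\<^esub> monom 1 n" "red w2 = red w1"
  shows "g1 = g2"
proof (rule ccontr)
  assume neq: "g1 \<noteq> g2"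
  interpret E: ordinary_module q \<kappa> \<theta> "f g1" \<pi> by (rule ord)
  let ?\<phi> = "E.\<phi>" and ?d1 = "dT g1 1" and ?d2 = "dT g2 1"
  define P where "P = pCons (g2 - g1) (w2 - w1)"
  have wV: "w1 \<in> VX" "w2 \<in> VX" using dEnd_VX g w by blast+
  have dV: "?d1 \<in> VX" "?d2 \<in> VX" using dT_VX V_1 g by blast+
  have rd: "red ?d1 = ?\<phi>" "red ?d2 = ?\<phi>" unfolding red_dT f_1 g(3)[symmetric] E.\<phi>_def by (rule refl)+
  have PV: "P \<in> VX" unfolding P_def using VX_pCons V_diff[OF g(2,1)] VX_diff[OF wV(2,1)] by blast
  have "P \<noteq> 0" using neq by (simp add: P_def)
  then obtain k where k: "coeff P k \<noteq> 0" "smult (inverse (coeff P k)) P \<in> VX" by (rule dominant_coeff)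
  define c where "c = coeff P k"
  have "red P = 0"
    unfolding P_def red_pCons red_diff[OF wV(2,1)] r(2) using f_diff[OF g(2,1)] g(3) by simp
  hence "f c = 0" using coeff_red[of P k] by (simp add: c_def)
  hence c: "c \<noteq> 0" "c \<in> V" "f c = 0" using k(1) VX_coeff[OF PV] by (simp_all add: c_def)
  have pc: "smult (inverse c) P = pCons (inverse c * (g2 - g1)) (diff_quot c w1 w2)"
    by (simp add: P_def diff_quot_def)
  hence quot: "inverse c * (g2 - g1) \<in> V" "diff_quot c w1 w2 \<in> VX" using k(2) VX_pCons by (simp_all add: c_def)
  have dd: "diff_quot c ?d1 ?d2 = monom (inverse c * (g2 - g1)) 1"
    by (rule poly_eqI) (simp add: coeff_diff_quot drinfeld_T_def coeff_pCons split: nat.splits)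
  have dq: "diff_quot c ?d1 ?d2 \<in> VX" unfolding dd by (rule VX_monom[OF quot(1)])
  define U where "U = red (diff_quot c ?d1 ?d2)"
  define W where "W = red (diff_quot c w1 w2)"
  define Y where "Y a = red (diff_quot c (C.dmod ?d1 a) (C.dmod ?d2 a))" for a
  note YV = diff_quot_dmod[OF c dV dq]
  note dm = VX_dmod(1)[OF dV(1)] VX_dmod(1)[OF dV(2)]
  have rdm: "red (C.dmod ?d2 a) = R.dmod ?\<phi> a" for a by (simp only: VX_dmod(2)[OF dV(2)] rd)
  have fT: "f (coeff ?d1 0) = \<theta>" by (simp only: coeff_dT_0 \<theta>_def)
  have fw: "f (coeff w1 0) = 0"
  proof -
    have "coeff (red w1) 0 = 0" unfolding r(1) R.coeff_tm_0 using n(1) by simp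
    thus ?thesis by (simp only: coeff_red)
  qed
  have rw: "red w2 = R.dmod ?\<phi> m \<star>\<^bsub>q\<^esub> monom 1 n" by (simp only: r E.\<phi>_def)
  have fdm: "f (coeff (C.dmod ?d1 a) 0) = E.ev a" for a by (simp only: coeff_dmod_dT_0 f_iota)
  have comm: "w1 \<star>\<^bsub>q\<^esub> ?d1 = ?d1 \<star>\<^bsub>q\<^esub> w1" "w2 \<star>\<^bsub>q\<^esub> ?d2 = ?d2 \<star>\<^bsub>q\<^esub> w2" using w by (simp_all only: mem_drinfeld_End)
  have "U = 0 \<and> W = 0"
  proof (rule E.no_first_order_deformation[OF n m])
    show "degree U \<le> 1" unfolding U_def dd red_monom by (rule degree_monom_le)
    show "coeff U 0 = 0" unfolding U_def dd red_monom by simp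
    show "coeff (Y \<pi>) 0 = 0" unfolding Y_def coeff_red coeff_diff_quot coeff_dmod_dT_0 by (simp add: f_0)
    show "W \<star>\<^bsub>q\<^esub> ?\<phi> = U \<star>\<^bsub>q\<^esub> (R.dmod ?\<phi> m \<star>\<^bsub>q\<^esub> monom 1 n) + smult \<theta> W"
    proof -
      have "red (diff_quot c (w1 \<star>\<^bsub>q\<^esub> ?d1) (w2 \<star>\<^bsub>q\<^esub> ?d2)) = W \<star>\<^bsub>q\<^esub> ?\<phi> + smult 0 U"
        by (simp only: diff_quot_mult(2)[OF c wV(1) dV(2) quot(2) dq] rd fw W_def U_def)
      moreover have "red (diff_quot c (?d1 \<star>\<^bsub>q\<^esub> w1) (?d2 \<star>\<^bsub>q\<^esub> w2)) = U \<star>\<^bsub>q\<^esub> red w2 + smult \<theta> W"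
        by (simp only: diff_quot_mult(2)[OF c dV(1) wV(2) dq quot(2)] fT W_def U_def)
      ultimately show ?thesis unfolding comm rw by simp
    qed
    show "W \<star>\<^bsub>q\<^esub> R.dmod ?\<phi> \<pi> = Y \<pi> \<star>\<^bsub>q\<^esub> (R.dmod ?\<phi> m \<star>\<^bsub>q\<^esub> monom 1 n)"
    proof -
      have "red (diff_quot c (w1 \<star>\<^bsub>q\<^esub> C.dmod ?d1 \<pi>) (w2 \<star>\<^bsub>q\<^esub> C.dmod ?d2 \<pi>))
          = W \<star>\<^bsub>q\<^esub> R.dmod ?\<phi> \<pi> + smult 0 (Y \<pi>)"
        by (simp only: diff_quot_mult(2)[OF c wV(1) dm(2) quot(2) YV] rdm fw W_def Y_def)
      moreover have "red (diff_quot c (C.dmod ?d1 \<pi> \<star>\<^bsub>q\<^esub> w1) (C.dmod ?d2 \<pi> \<star>\<^bsub>q\<^esub> w2))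
          = Y \<pi> \<star>\<^bsub>q\<^esub> red w2 + smult (E.ev \<pi>) W"
        by (simp only: diff_quot_mult(2)[OF c dm(1) wV(2) YV quot(2)] fdm W_def Y_def)
      moreover have "E.ev \<pi> = 0" by (simp add: E.eval_eq_0_iff)
      ultimately show ?thesis unfolding C.dmod_commute[OF comm(1)] C.dmod_commute[OF comm(2)] rw by simp
    qed
    show "Y m \<star>\<^bsub>q\<^esub> ?\<phi> + smult (E.ev m) U = U \<star>\<^bsub>q\<^esub> R.dmod ?\<phi> m + smult \<theta> (Y m)"
    proof -
      have "red (diff_quot c (C.dmod ?d1 m \<star>\<^bsub>q\<^esub> ?d1) (C.dmod ?d2 m \<star>\<^bsub>q\<^esub> ?d2))
          = Y m \<star>\<^bsub>q\<^esub> ?\<phi> + smult (E.ev m) U"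
        by (simp only: diff_quot_mult(2)[OF c dm(1) dV(2) YV dq] rd fdm U_def Y_def)
      moreover have "red (diff_quot c (?d1 \<star>\<^bsub>q\<^esub> C.dmod ?d1 m) (?d2 \<star>\<^bsub>q\<^esub> C.dmod ?d2 m))
          = U \<star>\<^bsub>q\<^esub> R.dmod ?\<phi> m + smult \<theta> (Y m)"
        by (simp only: diff_quot_mult(2)[OF c dV(1) dm(2) dq YV] rdm fT U_def Y_def)
      ultimately show ?thesis by (simp only: C.dmod_commute_self)
    qed
  qed
  moreover have "red (smult (inverse c) P) = pCons (f (inverse c * (g2 - g1))) W"
    unfolding pc red_pCons W_def ..
  moreover have "f (inverse c * (g2 - g1)) = coeff U 1" unfolding U_def dd red_monom by simp
  ultimately have "red (smult (inverse c) P) = 0" by simp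
  hence "f (inverse c * coeff P k) = 0" using coeff_red[of "smult (inverse c) P" k] by simp
  thus False using c(1) f_1 by (simp add: c_def)
qed

end

section \<open>Ideals of polynomial rings\<close>

lemma ring_of_type_algebra_simps [simp]:
  "carrier ring_of_type_algebra = UNIV"
  "x \<otimes>\<^bsub>ring_of_type_algebra\<^esub> y = x * y"
  "x \<oplus>\<^bsub>ring_of_type_algebra\<^esub> y = x + y"
  "\<one>\<^bsub>ring_of_type_algebra\<^esub> = 1"
  "\<zero>\<^bsub>ring_of_type_algebra\<^esub> = 0"
  by (simp_all add: ring_of_type_algebra_def)

lemma ideal_type_algebra:
  assumes "ideal I (ring_of_type_algebra :: 'a::comm_ring_1 ring)"
  shows "0 \<in> I" "x \<in> I \<Longrightarrow> y \<in> I \<Longrightarrow> x + y \<in> I" "x \<in> I \<Longrightarrow> r * x \<in> I" "x \<in> I \<Longrightarrow> y \<in> I \<Longrightarrow> x - y \<in> I"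
proof -
  note sub = ideal.axioms(1)[OF assms]
  show "0 \<in> I" using additive_subgroup.zero_closed[OF sub] by simp
  show add: "x \<in> I \<Longrightarrow> y \<in> I \<Longrightarrow> x + y \<in> I" for x y using additive_subgroup.a_closed[OF sub, of x y] by simp
  show mult: "x \<in> I \<Longrightarrow> r * x \<in> I" for x r using ideal.I_l_closed[OF assms, of x r] by simp
  show "x \<in> I \<Longrightarrow> y \<in> I \<Longrightarrow> x - y \<in> I" using add[of x "- 1 * y"] mult[of y "- 1"] by simp
qed

lemma poly_ideal_principal:
  fixes I :: "'q::field poly set"
  assumes diff: "\<And>x y. x \<in> I \<Longrightarrow> y \<in> I \<Longrightarrow> x - y \<in> I" and mult: "\<And>r x. x \<in> I \<Longrightarrow> r * x \<in> I"
    and nz: "p \<in> I" "p \<noteq> 0"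
  obtains \<pi> where "\<pi> \<noteq> 0" "I = {a. \<pi> dvd a}"
proof -
  have "p \<in> I - {0}" using nz by blast
  from ex_has_least_nat[of "\<lambda>e. e \<in> I - {0}", OF this, of degree] obtain e where
    e: "e \<in> I" "e \<noteq> 0" and min: "\<And>e'. e' \<in> I - {0} \<Longrightarrow> degree e \<le> degree e'" by blast
  have dvd: "e dvd a" if a: "a \<in> I" for a
  proof (rule ccontr)
    assume "\<not> e dvd a"
    hence r0: "a mod e \<noteq> 0" by (simp add: dvd_eq_mod_eq_0)
    have "a mod e = a - a div e * e" by (rule minus_div_mult_eq_mod[symmetric])
    hence "a mod e \<in> I - {0}" using diff[OF a mult[OF e(1), of "a div e"]] r0 by simp
    hence "degree e \<le> degree (a mod e)" by (rule min)
    thus False using degree_mod_less[OF e(2), of a] r0 by simp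
  qed
  have multiple: "a \<in> I" if ea: "e dvd a" for a
  proof -
    obtain b where "a = e * b" using ea by (rule dvdE)
    thus ?thesis using mult[OF e(1), of b] by (simp add: mult.commute)
  qed
  have "I = {a. e dvd a}"
  proof (intro equalityI subsetI CollectI)
    show "e dvd a" if "a \<in> I" for a using that by (rule dvd)
    show "a \<in> I" if "a \<in> {a. e dvd a}" for a using that by (simp add: multiple)
  qed
  thus ?thesis by (rule that[OF e(2)])
qed

lemma ideal_type_algebraI:
  fixes I :: "'a::comm_ring_1 set"
  assumes "0 \<in> I" and diff: "\<And>x y. x \<in> I \<Longrightarrow> y \<in> I \<Longrightarrow> x - y \<in> I"
    and mult: "\<And>x r. x \<in> I \<Longrightarrow> r * x \<in> I"
  shows "ideal I ring_of_type_algebra"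
proof -
  let ?R = "ring_of_type_algebra :: 'a ring"
  interpret R: cring ?R by (rule cring_from_type_algebra)
  have neg: "- x \<in> I" if "x \<in> I" for x using mult[OF that, of "- 1"] by simp
  have add: "x + y \<in> I" if "x \<in> I" "y \<in> I" for x y using diff[OF that(1) neg[OF that(2)]] by simp
  show ?thesis
  proof (rule idealI)
    show "ring ?R" by (rule R.ring_axioms)
    show "subgroup I (add_monoid ?R)"
    proof (rule R.add.subgroupI)
      show "I \<noteq> {}" using assms(1) by blast
      fix a assume a: "a \<in> I"
      have "\<ominus>\<^bsub>?R\<^esub> a = - a" by (rule R.minus_equality) simp_all
      thus "\<ominus>\<^bsub>?R\<^esub> a \<in> I" using neg[OF a] by simp
      fix b assume "b \<in> I"
      thus "a \<oplus>\<^bsub>?R\<^esub> b \<in> I" using add[OF a] by simp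
    qed simp
    fix a x assume "a \<in> I"
    thus "x \<otimes>\<^bsub>?R\<^esub> a \<in> I" "a \<otimes>\<^bsub>?R\<^esub> x \<in> I" using mult[of a x] by (simp_all add: mult.commute)
  qed
qed

section \<open>The algebraic closure of a finite field\<close>

lemma Fq_field_to_ac: "Fq_field CARD('q) (to_ac :: 'q::{field, finite} \<Rightarrow> 'q alg_closure)"
  by unfold_locales simp_all

text \<open>The powers of an algebraic element lie in a finite set, namely in the
  \<open>F\<^sub>q\<close>-span of finitely many of them. The sequence of Frobenius iterates thus
  repeats a value, and it is purely periodic because Frobenius is injective.\<close>

lemma alg_closure_frobenius_periodic:
  fixes x :: "'q::{field, finite} alg_closure"
  shows "\<exists>n>0. x ^ (CARD('q) ^ n) = x"
proof -
  interpret F: Fq_field "CARD('q)" "to_ac :: 'q \<Rightarrow> 'q alg_closure" by (rule Fq_field_to_ac)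
  obtain p :: "'q poly" where p: "p \<noteq> 0" "poly (map_poly to_ac p) x = 0" by (rule alg_closure_algebraic)
  define E where "E a = coeff (F.dmod [:x:] a) 0" for a
  have Ep: "E a = poly (map_poly to_ac a) x" for a by (simp add: E_def F.coeff_dmod_0)
  have add: "E (a + b) = E a + E b" and mult: "E (a * b) = E a * E b" for a b
    by (simp_all add: E_def F.dmod_add F.dmod_mult F.coeff_tm_0)
  define t :: "'q poly" where "t = [:0, 1:]"
  have Et: "E t = x" by (simp add: Ep t_def map_poly_pCons)
  have X: "E (t ^ i) = x ^ i" for i
  proof (induction i)
    case 0
    show ?case by (simp add: E_def)
  next
    case (Suc i)
    thus ?case by (simp add: mult Et)
  qed
  define B where "B = {a :: 'q poly. \<forall>i\<ge>degree p. coeff a i = 0}"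
  have finB: "finite (E ` B)" unfolding B_def by (rule finite_imageI, rule card_polys_bounded(1))
  have "x ^ i \<in> E ` B" for i
  proof
    let ?a = "t ^ i"
    have "E ?a = E (?a div p) * E p + E (?a mod p)"
      unfolding mult[symmetric] add[symmetric] by simp
    thus "x ^ i = E (?a mod p)" using p(2) by (simp add: X Ep[of p])
    show "?a mod p \<in> B"
      unfolding B_def using degree_mod_less[OF p(1), of ?a] by (auto intro: coeff_eq_0)
  qed
  hence "range (\<lambda>i. x ^ (CARD('q) ^ i)) \<subseteq> E ` B" by blast
  hence "finite (range (\<lambda>i. x ^ (CARD('q) ^ i)))" using finB by (rule finite_subset)
  hence "\<not> inj (\<lambda>i. x ^ (CARD('q) ^ i))" using finite_imageD by blast
  then obtain i' j' where ij': "i' \<noteq> j'" "x ^ (CARD('q) ^ i') = x ^ (CARD('q) ^ j')"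
    unfolding inj_on_def by blast
  have "\<exists>i j. i < j \<and> x ^ (CARD('q) ^ i) = x ^ (CARD('q) ^ j)"
  proof (cases "i' < j'")
    case True
    thus ?thesis using ij'(2) by blast
  next
    case False
    hence "j' < i'" using ij'(1) by simp
    thus ?thesis using ij'(2)[symmetric] by blast
  qed
  then obtain i j where ij: "i < j" "x ^ (CARD('q) ^ i) = x ^ (CARD('q) ^ j)" by blast
  have "(x ^ (CARD('q) ^ (j - i))) ^ (CARD('q) ^ i) = x ^ (CARD('q) ^ i)"
    unfolding power_mult[symmetric] power_add[symmetric] using ij by simp
  hence "x ^ (CARD('q) ^ (j - i)) = x" by (rule F.frob_pow_inj)
  thus ?thesis using ij(1) by (intro exI[of _ "j - i"]) simp
qed

lemma alg_closure_root_of_unity: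
  fixes a :: "'q::{field, finite} alg_closure"
  assumes "a \<noteq> 0"
  shows "\<exists>N>0. a ^ N = 1"
proof -
  obtain n where n: "n > 0" "a ^ (CARD('q) ^ n) = a" using alg_closure_frobenius_periodic[of a] by blast
  have "1 < CARD('q) ^ n" by (rule one_less_power) (use card_field_ge_2[where 'q = 'q] n(1) in simp_all)
  then obtain N where N: "CARD('q) ^ n = Suc N" "N > 0" by (cases "CARD('q) ^ n") auto
  have "a * a ^ N = a" using n(2) unfolding N(1) by simp
  hence "a ^ N = 1" using assms by simp
  thus ?thesis using N(2) by blast
qed

section \<open>Reduction at a prime\<close>

context A_algebra
begin

text \<open>Chevalley's theorem is applied to the map from \<open>F\<^sub>q + M\<close> to
  \<open>F\<^sub>q\<close> with kernel \<open>M\<close>. The resulting place contains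
  \<open>T\<close>: otherwise dividing \<open>\<pi>\<close> by the power of \<open>T\<close> of
  its degree would show that its leading coefficient reduces to zero. On \<open>A\<close> the
  kernel is a proper ideal that contains the maximal ideal generated by
  \<open>\<pi>\<close>.\<close>

theorem exists_reduction:
  fixes M :: "'c set" and \<pi> :: "'q poly"
  assumes M: "0 \<in> M" "\<And>x y. x \<in> M \<Longrightarrow> y \<in> M \<Longrightarrow> x - y \<in> M" "\<And>x y. x \<in> M \<Longrightarrow> y \<in> M \<Longrightarrow> x * y \<in> M"
    and M_const: "\<And>c x. x \<in> M \<Longrightarrow> \<iota> [:c:] * x \<in> M"
    and M_iota: "\<And>a. \<iota> a \<in> M \<longleftrightarrow> \<pi> dvd a"
    and pi: "\<pi> \<noteq> 0" "\<not> \<pi> dvd 1" "\<And>a b. \<pi> dvd a * b \<Longrightarrow> \<pi> dvd a \<or> \<pi> dvd b"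
  obtains V and f :: "'c \<Rightarrow> 'q alg_closure"
    where "reduction CARD('q) to_ac \<iota> V f \<pi>" "\<And>x. x \<in> M \<Longrightarrow> x \<in> V \<and> f x = 0"
proof -
  define G0 where "G0 = {(\<iota> [:c:] + x, to_ac c :: 'q alg_closure) |c x. x \<in> M}"
  have M_add: "x + y \<in> M" if "x \<in> M" "y \<in> M" for x y
    using M(2)[OF that(1) M(2)[OF M(1) that(2)]] by simp
  have cdiff: "\<iota> [:a - b:] = \<iota> [:a:] - \<iota> [:b:]" and cmult: "\<iota> [:a * b:] = \<iota> [:a:] * \<iota> [:b:]" for a b
    using iota_diff[of "[:a:]" "[:b:]"] iota_mult[of "[:a:]" "[:b:]"] by (simp_all add: mult.commute)
  have c1: "\<iota> [:1:] = 1" unfolding pCons_one by (rule iota_1)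
  have GI: "(\<iota> [:c:] + x, to_ac c) \<in> G0" if "x \<in> M" for c x using that by (auto simp: G0_def)
  have hg: "hom_graph G0"
    unfolding hom_graph_def
  proof (intro conjI allI impI)
    show "(1, 1) \<in> G0" using GI[OF M(1), of 1] by (simp add: c1)
    fix x a y b assume "(x, a) \<in> G0" "(y, b) \<in> G0"
    then obtain c r e s where x: "x = \<iota> [:c:] + r" "a = to_ac c" "r \<in> M"
      and y: "y = \<iota> [:e:] + s" "b = to_ac e" "s \<in> M" unfolding G0_def by blast
    have "x - y = \<iota> [:c - e:] + (r - s)" by (simp add: x y cdiff)
    thus "(x - y, a - b) \<in> G0" using GI[OF M(2)[OF x(3) y(3)], of "c - e"] by (simp add: x(2) y(2))
    have "x * y = \<iota> [:c * e:] + (\<iota> [:c:] * s + \<iota> [:e:] * r + r * s)" by (simp add: x y cmult algebra_simps)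
    thus "(x * y, a * b) \<in> G0"
      using GI[OF M_add[OF M_add[OF M_const[OF y(3)] M_const[OF x(3)]] M(3)[OF x(3) y(3)]], of "c * e" c e]
      by (simp add: x(2) y(2))
  next
    fix a assume "(0, a) \<in> G0"
    then obtain c x where x: "0 = \<iota> [:c:] + x" "a = to_ac c" "x \<in> M" unfolding G0_def by blast
    have "\<iota> [:c:] = 0 - x" using x(1) by (simp add: eq_neg_iff_add_eq_0)
    hence "\<iota> [:c:] \<in> M" using M(2)[OF M(1) x(3)] by simp
    hence dvd: "\<pi> dvd [:c:]" by (simp only: M_iota)
    have "c = 0"
    proof (rule ccontr)
      assume "c \<noteq> 0"
      hence "[:c:] * [:inverse c:] = 1" by (simp add: pCons_one)
      hence "\<pi> dvd 1" using dvd_mult2[OF dvd, of "[:inverse c:]"] by simp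
      thus False using pi(2) by contradiction
    qed
    thus "a = 0" by (simp add: x(2))
  qed
  have "\<exists>V (f :: 'c \<Rightarrow> 'q alg_closure). place V f \<and> (\<forall>x a. (x, a) \<in> G0 \<longrightarrow> x \<in> V \<and> f x = a)"
  proof (rule place_extension[OF hg alg_closure_root_of_unity])
    fix V and f :: "'c \<Rightarrow> 'q alg_closure"
    assume "place V f" "\<And>x a. (x, a) \<in> G0 \<Longrightarrow> x \<in> V \<and> f x = a"
    thus ?thesis by (intro exI[of _ V] exI[of _ f]) simp
  qed
  then obtain V :: "'c set" and f :: "'c \<Rightarrow> 'q alg_closure" where pl: "place V f"
    and ext': "\<forall>x a. (x, a) \<in> G0 \<longrightarrow> x \<in> V \<and> f x = a" by (elim exE conjE)
  have ext: "x \<in> V \<and> f x = a" if "(x, a) \<in> G0" for x a using ext' that by simp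
  interpret place V f by (rule pl)
  have VM: "x \<in> V \<and> f x = 0" if "x \<in> M" for x
    using ext[OF GI[OF that, of 0]] by (simp add: iota_0)
  have Vc: "\<iota> [:c:] \<in> V \<and> f (\<iota> [:c:]) = to_ac c" for c
    using ext[OF GI[OF M(1), of c]] by simp
  have T_V: "\<iota> [:0, 1:] \<in> V"
  proof (rule ccontr)
    define t where "t = \<iota> [:0, 1:]"
    define s where "s = inverse t"
    assume "\<iota> [:0, 1:] \<notin> V"
    hence s: "s \<in> V" "f s = 0" using not_in_V by (simp_all add: s_def t_def)
    have t0: "t \<noteq> 0" using iota_eq_0[of "[:0, 1:]"] by (auto simp: t_def)
    have key: "\<forall>n\<ge>degree a. \<iota> a * s ^ n \<in> V \<and> f (\<iota> a * s ^ n) = to_ac (coeff a n)" for a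
    proof (induction a)
      case 0
      show ?case by (simp add: iota_0 V_0 f_0)
    next
      case (pCons c a)
      show ?case
      proof (intro allI impI)
        fix n assume n: "degree (pCons c a) \<le> n"
        show "\<iota> (pCons c a) * s ^ n \<in> V \<and> f (\<iota> (pCons c a) * s ^ n) = to_ac (coeff (pCons c a) n)"
        proof (cases n)
          case 0
          hence "a = 0" using n by (simp split: if_splits)
          thus ?thesis using Vc[of c] 0 by simp
        next
          case (Suc m)
          have m: "degree a \<le> m" using n Suc by (simp split: if_splits)
          have IH: "\<iota> a * s ^ m \<in> V" "f (\<iota> a * s ^ m) = to_ac (coeff a m)" using pCons.IH m by blast+
          have "t * s = 1" using t0 by (simp add: s_def)
          moreover have "\<iota> (pCons c a) * s ^ n = \<iota> [:c:] * s ^ n + t * s * (\<iota> a * s ^ m)"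
            unfolding iota_pCons[of c a] t_def[symmetric] Suc power_Suc by (simp add: algebra_simps)
          ultimately have eq: "\<iota> (pCons c a) * s ^ n = \<iota> [:c:] * s ^ n + \<iota> a * s ^ m" by simp
          have cs: "\<iota> [:c:] * s ^ n \<in> V" "f (\<iota> [:c:] * s ^ n) = 0"
            using Vc[of c] s Suc by (simp_all add: V_mult V_power f_mult f_power)
          show ?thesis unfolding eq f_add[OF cs(1) IH(1)] cs(2) IH(2)
            using V_add[OF cs(1) IH(1)] Suc by simp
        qed
      qed
    qed
    have p: "\<iota> \<pi> \<in> V" "f (\<iota> \<pi>) = 0" using VM[of "\<iota> \<pi>"] M_iota[of \<pi>] by simp_all
    have "f (\<iota> \<pi> * s ^ degree \<pi>) = 0" by (simp add: f_mult[OF p(1) V_power[OF s(1)]] p(2))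
    hence "to_ac (lead_coeff \<pi>) = (0 :: 'q alg_closure)" using key[of \<pi>] by simp
    thus False using pi(1) by simp
  qed
  have iV: "\<iota> a \<in> V" for a
  proof (induction a)
    case (pCons c a)
    show ?case unfolding iota_pCons[of c a] using Vc[of c] by (intro V_add V_mult T_V pCons.IH) simp
  qed (simp add: iota_0 V_0)
  define I where "I = {a. f (\<iota> a) = 0}"
  have pI: "\<pi> \<in> I" using VM[of "\<iota> \<pi>"] M_iota[of \<pi>] by (simp add: I_def)
  have Id: "x - y \<in> I" if "x \<in> I" "y \<in> I" for x y
    using that by (simp add: I_def iota_diff f_diff[OF iV iV])
  have Im: "r * x \<in> I" if "x \<in> I" for r x
    using that by (simp add: I_def iota_mult f_mult[OF iV iV])
  obtain \<pi>' where p': "\<pi>' \<noteq> 0" "I = {a. \<pi>' dvd a}" by (rule poly_ideal_principal[OF Id Im pI pi(1)])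
  have "\<pi>' dvd \<pi>" using pI p'(2) by blast
  then obtain z where z: "\<pi> = \<pi>' * z" by (rule dvdE)
  have nd: "\<not> \<pi> dvd z"
  proof
    assume "\<pi> dvd z"
    then obtain y where "z = \<pi> * y" by (rule dvdE)
    hence "\<pi> * 1 = \<pi> * (\<pi>' * y)" using z by (simp add: mult.left_commute)
    hence "1 = \<pi>' * y" using pi(1) by (simp only: mult_left_cancel simp_thms)
    hence "1 \<in> I" unfolding p'(2) mem_Collect_eq by (rule dvdI)
    thus False by (simp add: I_def iota_1 f_1)
  qed
  have "\<pi> dvd \<pi>' * z" unfolding z[symmetric] by (rule dvd_refl)
  hence pp': "\<pi> dvd \<pi>'" using pi(3) nd by blast
  have ker: "f (\<iota> a) = 0 \<longleftrightarrow> \<pi> dvd a" for a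
  proof
    assume "f (\<iota> a) = 0"
    hence "\<pi>' dvd a" using p'(2) by (auto simp: I_def)
    thus "\<pi> dvd a" by (rule dvd_trans[OF pp'])
  next
    assume "\<pi> dvd a"
    thus "f (\<iota> a) = 0" using VM[of "\<iota> a"] M_iota[of a] by simp
  qed
  have "reduction CARD('q) to_ac \<iota> V f \<pi>"
  proof (intro reduction.intro reduction_axioms.intro)
    show "A_algebra \<iota>" by (rule A_algebra_axioms)
    show "place V f" by (rule pl)
    show "Fq_field CARD('q) (to_ac :: 'q \<Rightarrow> 'q alg_closure)" by (rule Fq_field_to_ac)
    show "\<iota> [:c:] \<in> V" "f (\<iota> [:c:]) = to_ac c" for c using Vc[of c] by simp_all
    show "\<iota> [:0, 1:] \<in> V" by (rule T_V)
    show "\<pi> \<noteq> 0" by (rule pi(1))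
    show "f (\<iota> a) = 0 \<longleftrightarrow> \<pi> dvd a" for a by (rule ker)
    show "\<exists>n>0. x ^ (CARD('q) ^ n) = x" for x :: "'q alg_closure" by (rule alg_closure_frobenius_periodic)
  qed
  thus ?thesis using VM by (rule that)
qed

end

context C_infinity
begin

text \<open>Injectivity: since \<open>T\<close> is the inverse of the series variable, the leading
  coefficient of a polynomial is a coefficient of its value.\<close>

lemma A_algebra_A_incl: "A_algebra (A_incl emb)"
proof -
  interpret F: Fq_field "CARD('q)" "fls_const :: 'q \<Rightarrow> 'q fls"
    by unfold_locales (simp_all only: fls_plus_const fls_const_mult_const fls_const_1)
  have E: "A_incl emb a = emb (to_ac (coeff (F.dmod [:fls_X_inv:] a) 0))" for a
    by (simp add: A_incl_def F.coeff_dmod_0)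
  show ?thesis
  proof
    fix a b :: "'q poly"
    show "A_incl emb (a + b) = A_incl emb a + A_incl emb b"
      by (simp add: E F.dmod_add emb_add)
    show "A_incl emb (a * b) = A_incl emb a * A_incl emb b"
      by (simp add: E F.dmod_mult F.coeff_tm_0 emb_mult)
    show "A_incl emb 1 = 1" by (simp add: E emb_1)
    assume 0: "A_incl emb a = 0"
    have emb_nz: "x = 0" if "emb x = 0" for x
    proof (rule ccontr)
      assume "x \<noteq> 0"
      hence "emb x * emb (inverse x) = 1" by (simp add: emb_1 flip: emb_mult)
      thus False using that by simp
    qed
    have "to_ac (poly (map_poly fls_const a) (fls_X_inv :: 'q fls)) = 0"
      using 0 unfolding A_incl_def by (rule emb_nz)
    hence z: "poly (map_poly fls_const a) (fls_X_inv :: 'q fls) = 0" by simp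
    have "fls_nth (poly (map_poly fls_const a) (fls_X_inv :: 'q fls)) (- int (degree a)) = lead_coeff a"
    proof -
      have nth: "fls_nth (fls_const c * fls_X_inv ^ i) (- int n) = (if i = n then c else 0)" for c :: 'q and i n by simp
      have eq: "poly (map_poly fls_const a) (fls_X_inv :: 'q fls) = (\<Sum>i\<le>degree a. fls_const (coeff a i) * fls_X_inv ^ i)"
        unfolding poly_altdef by (simp add: degree_map_poly coeff_map_poly)
      show ?thesis unfolding eq fls_nth_sum nth by simp
    qed
    thus "a = 0" using z by simp
  qed
qed

end

section \<open>Conductors and congruent roots\<close>

text \<open>To contain is to divide: the quotient consists of all \<open>x\<close> for which
  \<open>\<pi> x\<close> is in the product.\<close>

lemma ideal_prime_divides_product:
  fixes \<cc>1 \<cc>2 :: "'q::field poly set"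
  assumes c: "ideal \<cc>1 ring_of_type_algebra" "ideal \<cc>2 ring_of_type_algebra"
    and sub: "\<cc>1 \<subseteq> {a. \<pi> dvd a} \<or> \<cc>2 \<subseteq> {a. \<pi> dvd a}"
  shows "{a. \<pi> dvd a} divides\<^bsub>ideals_set ring_of_type_algebra\<^esub> (\<cc>1 \<otimes>\<^bsub>ideals_set ring_of_type_algebra\<^esub> \<cc>2)"
proof -
  let ?R = "ring_of_type_algebra :: 'q poly ring"
  interpret R: cring ?R by (rule cring_from_type_algebra)
  define C where "C = ideal_prod ?R \<cc>1 \<cc>2"
  have C: "ideal C ?R" unfolding C_def by (rule R.ideal_prod_is_ideal[OF c])
  note CI = ideal_type_algebra[OF C]
  have "C \<subseteq> \<cc>1 \<inter> \<cc>2" unfolding C_def by (rule R.ideal_prod_inter[OF c])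
  hence dvd: "\<pi> dvd x" if "x \<in> C" for x using that sub by blast
  define J where "J = {x. \<pi> * x \<in> C}"
  have J: "ideal J ?R"
    by (rule ideal_type_algebraI) (simp_all add: J_def CI(1) CI(4) right_diff_distrib CI(3) mult.left_commute[of \<pi>])
  have "C = ideal_prod ?R {a. \<pi> dvd a} J"
  proof (intro equalityI subsetI)
    fix x assume x: "x \<in> C"
    then obtain y where y: "x = \<pi> * y" using dvd[OF x] by (elim dvdE)
    have "\<pi> \<otimes>\<^bsub>?R\<^esub> y \<in> ideal_prod ?R {a. \<pi> dvd a} J"
      by (rule ideal_prod.prod) (use x in \<open>simp_all add: J_def y\<close>)
    thus "x \<in> ideal_prod ?R {a. \<pi> dvd a} J" by (simp add: y)
  next
    fix x assume "x \<in> ideal_prod ?R {a. \<pi> dvd a} J"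
    thus "x \<in> C"
    proof induction
      case (prod i j)
      have "\<pi> dvd i" using prod(1) by simp
      then obtain z where z: "i = \<pi> * z" by (rule dvdE)
      have "z * (\<pi> * j) \<in> C" by (rule CI(3)) (use prod in \<open>simp add: J_def\<close>)
      thus ?case by (simp add: z ac_simps)
    next
      case (sum s1 s2)
      thus ?case using CI(2)[of s1 s2] by simp
    qed
  qed
  thus ?thesis unfolding factor_def ideals_set_def C_def using J by auto
qed

context represented
begin

text \<open>The saturation is contained in the maximal order because its elements are integral and
  fractions of \<open>S\<close>.\<close>

lemma conductor_absorbs:
  assumes cond: "is_conductor \<iota> S \<cc>" and \<gamma>: "\<gamma> \<in> \<cc>" and x: "x \<in> S_sat"
  shows "\<iota> \<gamma> * x \<in> S"
proof -
  interpret T: saturated q \<kappa> \<theta> g \<pi> \<iota> S_sat rho_sat by (rule saturation)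
  have TK: "T.\<O>\<^sub>K = integral_closure_in \<iota> (fraction_field S)"
    unfolding T.\<O>\<^sub>K_def T.K_def fraction_field_sat ..
  have xO: "x \<in> carrier (subring_on T.\<O>\<^sub>K)" using T.S_sub_OK[OF x] by simp
  have "\<iota> \<gamma> * x \<in> extended_ideal \<iota> (fraction_field S) \<cc>"
    unfolding extended_ideal_def genideal_def TK[symmetric]
  proof clarify
    fix I assume I: "ideal I (subring_on T.\<O>\<^sub>K)" and sub: "\<iota> ` \<cc> \<subseteq> I"
    have "\<iota> \<gamma> \<in> I" using sub \<gamma> by blast
    from ideal.I_r_closed[OF I this xO] show "\<iota> \<gamma> * x \<in> I" by simp
  qed
  moreover have "0 \<in> range \<iota>" using iota_0 by (metis rangeI)
  ultimately have "0 + \<iota> \<gamma> * x \<in> set_add ring_of_type_algebra (range \<iota>) (extended_ideal \<iota> (fraction_field S) \<cc>)"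
    unfolding set_add_defs set_mult_def by (simp only: monoid.simps ring_of_type_algebra_simps) blast
  thus ?thesis using cond by (simp add: is_conductor_def)
qed

end

context place
begin

lemma root_in_V:
  assumes "x ^ n \<in> V" "n > 0"
  shows "x \<in> V"
proof (rule ccontr)
  assume "x \<notin> V"
  hence s: "inverse x \<in> V" "f (inverse x) = 0" using not_in_V by blast+
  have x0: "x \<noteq> 0" using \<open>x \<notin> V\<close> V_0 by blast
  have "f (inverse x ^ n * x ^ n) = f (inverse x) ^ n * f (x ^ n)"
    by (simp only: f_mult[OF V_power[OF s(1)] assms(1)] f_power[OF s(1)])
  also have "inverse x ^ n * x ^ n = 1" using x0 by (simp flip: power_mult_distrib)
  finally show False using s(2) assms(2) by (simp add: f_1 power_0_left)
qed

lemma f_prod_mset: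
  assumes "\<And>r. r \<in># A \<Longrightarrow> h r \<in> V"
  shows "prod_mset (image_mset h A) \<in> V" "f (prod_mset (image_mset h A)) = prod_mset (image_mset (\<lambda>r. f (h r)) A)"
proof -
  have "prod_mset (image_mset h A) \<in> V \<and> f (prod_mset (image_mset h A)) = prod_mset (image_mset (\<lambda>r. f (h r)) A)"
    using assms
  proof (induction A)
    case (add r A)
    have "h r \<in> V" using add.prems by simp
    moreover have IH: "prod_mset (image_mset h A) \<in> V" "f (prod_mset (image_mset h A)) = prod_mset (image_mset (\<lambda>r. f (h r)) A)"
      using add.IH add.prems by simp_all
    ultimately show ?case by (simp add: V_mult f_mult)
  qed (simp add: V_1 f_1)
  thus "prod_mset (image_mset h A) \<in> V" "f (prod_mset (image_mset h A)) = prod_mset (image_mset (\<lambda>r. f (h r)) A)"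
    by blast+
qed

text \<open>The difference of the \<open>n\<close>-th powers is a product of factors \<open>g1 - r
  g2\<close> with \<open>r\<close> an \<open>n\<close>-th root of unity, and one of them reduces
  to zero.\<close>

lemma congruent_root:
  fixes A :: "'a multiset"
  assumes n: "n > 0" and g: "g1 \<in> V" "g2 \<in> V" and eq: "f (g1 ^ n) = f (g2 ^ n)"
    and A: "size A = n" "\<And>x. x ^ n - 1 = prod_mset (image_mset (\<lambda>r. x - r) A)"
  obtains h where "h \<in> V" "h ^ n = g2 ^ n" "f g1 = f h"
proof (cases "g2 = 0")
  case True
  hence "f g1 ^ n = 0" using eq n by (simp add: f_power[OF g(1)] power_0_left f_0)
  hence "f g1 = f g2" using True by (simp add: f_0)
  thus ?thesis using g(2) by (intro that[of g2]) simp_all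
next
  case False
  have root: "r ^ n = 1" if "r \<in># A" for r
  proof -
    have z: "prod_mset (image_mset (\<lambda>s. r - s) A) = 0" using that by (auto simp: prod_mset_zero_iff)
    have "r ^ n - 1 = 0" by (simp only: A(2) z)
    thus ?thesis by simp
  qed
  have rV: "r \<in> V" if "r \<in># A" for r using root_in_V[of r n] root[OF that] n V_1 by simp
  have scale: "g2 ^ size B * prod_mset (image_mset (\<lambda>r. g1 / g2 - r) B) = prod_mset (image_mset (\<lambda>r. g1 - r * g2) B)" for B
  proof (induction B)
    case (add r B)
    have "g2 * (g1 / g2 - r) = g1 - r * g2" using False by (simp add: right_diff_distrib mult.commute)
    moreover have "g2 ^ size (add_mset r B) * prod_mset (image_mset (\<lambda>r. g1 / g2 - r) (add_mset r B))
        = (g2 * (g1 / g2 - r)) * (g2 ^ size B * prod_mset (image_mset (\<lambda>r. g1 / g2 - r) B))" by simp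
    ultimately show ?case unfolding add.IH by simp
  qed simp
  have "g1 ^ n - g2 ^ n = g2 ^ n * ((g1 / g2) ^ n - 1)" using False by (simp add: power_divide right_diff_distrib)
  also have "\<dots> = prod_mset (image_mset (\<lambda>r. g1 - r * g2) A)" unfolding A(2) using scale[of A] by (simp only: A(1))
  finally have fac: "g1 ^ n - g2 ^ n = prod_mset (image_mset (\<lambda>r. g1 - r * g2) A)" .
  have hV: "g1 - r * g2 \<in> V" if "r \<in># A" for r by (rule V_diff[OF g(1) V_mult[OF rV[OF that] g(2)]])
  have "f (g1 ^ n - g2 ^ n) = 0" using eq by (simp add: f_diff[OF V_power[OF g(1)] V_power[OF g(2)]])
  hence "prod_mset (image_mset (\<lambda>r. f (g1 - r * g2)) A) = 0"
    unfolding fac using f_prod_mset(2)[of A "\<lambda>r. g1 - r * g2"] hV by simp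
  hence "0 \<in># image_mset (\<lambda>r. f (g1 - r * g2)) A" by (simp only: prod_mset_zero_iff)
  then obtain r where r: "r \<in># A" "f (g1 - r * g2) = 0" by auto
  have "f g1 = f (r * g2)" using r(2) f_diff[OF g(1) V_mult[OF rV[OF r(1)] g(2)]] by simp
  moreover have "(r * g2) ^ n = g2 ^ n" using root[OF r(1)] by (simp add: power_mult_distrib)
  ultimately show ?thesis using that[of "r * g2"] V_mult[OF rV[OF r(1)] g(2)] by simp
qed

end

context C_infinity
begin

text \<open>The factorisation over the algebraic closure is transported along
  \<open>emb\<close>.\<close>

lemma roots_of_unity_split:
  assumes n: "n > 0"
  shows "\<exists>A :: 'c multiset. size A = n \<and> (\<forall>x. x ^ n - 1 = prod_mset (image_mset (\<lambda>r. x - r) A))"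
proof -
  define p :: "'q fls alg_closure poly" where "p = monom 1 n + [:- 1:]"
  have p: "degree p = n" unfolding p_def by (subst degree_add_eq_left) (simp_all add: degree_monom_eq n)
  have lc: "lead_coeff p = 1" unfolding p by (cases n) (use n in \<open>simp_all add: p_def\<close>)
  have p0: "p \<noteq> 0" using lc by auto
  from alg_closed_imp_factorization[OF p0] obtain B where
    B: "size B = n" "p = prod_mset (image_mset (\<lambda>x. [:- x, 1:]) B)" using lc p by auto
  have em: "emb (- 1) = - 1" using emb_diff[of 0 1] by (simp add: emb_0 emb_1)
  have lin: "poly (map_poly emb ([:- r, 1:] * u)) x = (x - emb r) * poly (map_poly emb u) x" for r u and x :: 'c
  proof -
    have er: "emb (- r) = - emb r" using emb_diff[of 0 r] by (simp add: emb_0)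
    have "map_poly emb ([:- r, 1:] * u) = smult (- emb r) (map_poly emb u) + pCons 0 (map_poly emb u)"
      by (rule poly_eqI)
        (simp add: coeff_map_poly emb_0 emb_add emb_mult emb_diff coeff_pCons split: nat.splits)
    thus ?thesis by (simp add: left_diff_distrib)
  qed
  have prod: "poly (map_poly emb (prod_mset (image_mset (\<lambda>x. [:- x, 1:]) D))) x = prod_mset (image_mset (\<lambda>r. x - r) (image_mset emb D))" for D and x :: 'c
  proof (induction D)
    case empty
    have "map_poly emb 1 = 1" by (rule poly_eqI) (simp add: coeff_map_poly emb_0 emb_1)
    thus ?case by simp
  next
    case (add r D)
    have "poly (map_poly emb (prod_mset (image_mset (\<lambda>x. [:- x, 1:]) (add_mset r D)))) x
        = (x - emb r) * poly (map_poly emb (prod_mset (image_mset (\<lambda>x. [:- x, 1:]) D))) x"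
      using lin by (simp only: image_mset_add_mset prod_mset.add_mset)
    thus ?case unfolding add.IH by simp
  qed
  have "map_poly emb p = monom 1 n + [:- 1:]"
    unfolding p_def by (rule poly_eqI) (simp add: coeff_map_poly emb_0 emb_add emb_1 em coeff_pCons split: nat.splits)
  hence val: "poly (map_poly emb p) x = x ^ n - 1" for x by (simp add: poly_monom)
  show ?thesis
  proof (intro exI[of _ "image_mset emb B"] conjI allI)
    show "size (image_mset emb B) = n" by (simp add: B(1))
    show "x ^ n - 1 = prod_mset (image_mset (\<lambda>r. x - r) (image_mset emb B))" for x
      unfolding val[symmetric] prod[symmetric] B(2)[symmetric] ..
  qed
qed

end

context reduction
begin

lemma supersingular_nonsplit:
  assumes g: "g \<in> V" and ss: "R.tord (R.dmod [:\<theta>, f g, 1:] \<pi>) = 2 * degree \<pi>"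
  shows "nonsplit_in \<iota> {a. \<pi> dvd a} (fraction_field (drinfeld_order \<iota> g 1))"
proof -
  interpret S: represented q \<kappa> \<theta> "f g" \<pi> \<iota> "drinfeld_order \<iota> g 1" "red_End g"
    by (rule drinfeld_order_represented[OF g])
  interpret T: saturated q \<kappa> \<theta> "f g" \<pi> \<iota> S.S_sat S.rho_sat by (rule S.saturation)
  have "R.tord (R.dmod S.\<phi> \<pi>) = 2 * S.d" using ss by (simp only: S.\<phi>_def S.d_def)
  from T.supersingular_imp_nonsplit[OF this] show ?thesis
    by (simp only: T.K_def S.fraction_field_sat)
qed

lemma ordinary_field_subset:
  assumes g: "g1 \<in> V" "g2 \<in> V" "f g1 = f g2"
    and ord: "ordinary_module q \<kappa> \<theta> (f g1) \<pi>" and CM: "drinfeld_order \<iota> g2 1 \<noteq> range \<iota>"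
  shows "fraction_field (drinfeld_order \<iota> g1 1) \<subseteq> fraction_field (drinfeld_order \<iota> g2 1)"
proof -
  interpret E: ordinary_module q \<kappa> \<theta> "f g1" \<pi> by (rule ord)
  interpret S1: represented q \<kappa> \<theta> "f g1" \<pi> \<iota> "drinfeld_order \<iota> g1 1" "red_End g1"
    by (rule drinfeld_order_represented[OF g(1)])
  interpret S2: represented q \<kappa> \<theta> "f g1" \<pi> \<iota> "drinfeld_order \<iota> g2 1" "red_End g2"
    unfolding g(3) by (rule drinfeld_order_represented[OF g(2)])
  obtain \<alpha> where \<alpha>: "\<alpha> \<in> drinfeld_order \<iota> g2 1" "\<alpha> \<notin> range \<iota>" using CM S2.S_iota by blast
  have "\<alpha> \<in> S2.S_sat" using S2.sat_S[OF \<alpha>(1)] by simp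
  from E.lift_field_subset[OF S1.saturation S2.saturation this \<alpha>(2)] show ?thesis
    by (simp only: S1.fraction_field_sat S2.fraction_field_sat)
qed

text \<open>Frobenius itself lifts to the saturation of the order, and multiplication by an
  element of the conductor brings the lift into the order.\<close>

lemma Frobenius_multiple_lifts:
  assumes g: "g \<in> V" and ord: "ordinary_module q \<kappa> \<theta> (f g) \<pi>" and CM: "drinfeld_order \<iota> g 1 \<noteq> range \<iota>"
    and cond: "is_conductor \<iota> (drinfeld_order \<iota> g 1) \<cc>" and \<gamma>: "\<gamma> \<in> \<cc>" "\<gamma> dvd m"
    and F: "monom 1 n \<in> reduced_module.End q \<theta> (f g)"
  obtains w where "w \<in> drinfeld_End \<iota> g 1" "red w = R.dmod [:\<theta>, f g, 1:] m \<star>\<^bsub>q\<^esub> monom 1 n"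
proof -
  interpret E: ordinary_module q \<kappa> \<theta> "f g" \<pi> by (rule ord)
  interpret S: represented q \<kappa> \<theta> "f g" \<pi> \<iota> "drinfeld_order \<iota> g 1" "red_End g"
    by (rule drinfeld_order_represented[OF g])
  interpret T: saturated q \<kappa> \<theta> "f g" \<pi> \<iota> S.S_sat S.rho_sat by (rule S.saturation)
  obtain \<alpha> where \<alpha>: "\<alpha> \<in> drinfeld_order \<iota> g 1" "\<alpha> \<notin> range \<iota>" using CM S.S_iota by blast
  have \<alpha>': "\<alpha> \<in> S.S_sat" using S.sat_S[OF \<alpha>(1)] by simp
  obtain x where x: "x \<in> S.S_sat" "S.rho_sat x = monom 1 n"
    by (rule E.lift_surjective[OF S.saturation \<alpha>' \<alpha>(2) F])
  obtain e where e: "m = \<gamma> * e" using \<gamma>(2) by (rule dvdE)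
  have "\<iota> e * (\<iota> \<gamma> * x) \<in> drinfeld_order \<iota> g 1"
    by (rule S.S_mult[OF S.S_iota S.conductor_absorbs[OF cond \<gamma>(1) x(1)]])
  hence mx: "\<iota> m * x \<in> drinfeld_order \<iota> g 1" by (simp add: e iota_mult ac_simps)
  then obtain w where w: "w \<in> drinfeld_End \<iota> g 1" "coeff w 0 = \<iota> m * x" "lift_End g (\<iota> m * x) = w"
    by (rule drinfeld_orderE)
  have "red w = red_End g (\<iota> m * x)" by (simp only: red_End_def w(3))
  also have "\<dots> = S.rho_sat (\<iota> m * x)" using S.sat_S[OF mx] by simp
  also have "\<dots> = R.dmod E.\<phi> m \<star>\<^bsub>q\<^esub> monom 1 n" by (simp only: T.rho_iota_mult[OF x(1)] x(2))
  finally have "red w = R.dmod [:\<theta>, f g, 1:] m \<star>\<^bsub>q\<^esub> monom 1 n" by (simp only: E.\<phi>_def)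
  thus ?thesis by (rule that[OF w(1)])
qed

text \<open>Both orders contain a lift of the same \<open>\<Phi>\<^sub>m \<tau>\<^sup>n\<close>,
  where \<open>m\<close> is prime to \<open>\<pi>\<close>. If the lifts have the same constant
  coefficient, then \<open>ordinary_lift_unique\<close> applies. Otherwise these coefficients are
  the two roots of one quadratic equation, and both reduce to zero; so \<open>\<pi>\<close>
  divides trace and norm, and \<open>\<Phi>\<^sub>\<pi>\<close> would divide \<open>\<Phi>\<^sub>m
  \<tau>\<^sup>n\<close> squared, contradicting \<open>Frobenius_not_divisible\<close>.\<close>

theorem ordinary_prime_to_conductors:
  assumes g: "g1 \<in> V" "g2 \<in> V" "f g1 = f g2"
    and ord: "ordinary_module q \<kappa> \<theta> (f g1) \<pi>"
    and CM: "drinfeld_order \<iota> g1 1 \<noteq> range \<iota>" "drinfeld_order \<iota> g2 1 \<noteq> range \<iota>"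
    and c1: "is_conductor \<iota> (drinfeld_order \<iota> g1 1) \<cc>1" "\<gamma>1 \<in> \<cc>1" "\<not> \<pi> dvd \<gamma>1"
    and c2: "is_conductor \<iota> (drinfeld_order \<iota> g2 1) \<cc>2" "\<gamma>2 \<in> \<cc>2" "\<not> \<pi> dvd \<gamma>2"
  shows "g1 = g2"
proof -
  interpret E: ordinary_module q \<kappa> \<theta> "f g1" \<pi> by (rule ord)
  have S1: "represented q \<kappa> \<theta> (f g1) \<pi> \<iota> (drinfeld_order \<iota> g1 1) (red_End g1)"
    by (rule drinfeld_order_represented[OF g(1)])
  have S2: "represented q \<kappa> \<theta> (f g1) \<pi> \<iota> (drinfeld_order \<iota> g2 1) (red_End g2)"
    unfolding g(3) by (rule drinfeld_order_represented[OF g(2)])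
  obtain n where n: "n > 0" "monom 1 n \<in> E.End" using E.Frobenius_in_End by blast
  define m where "m = \<gamma>1 * \<gamma>2"
  have m: "\<not> \<pi> dvd m" using c1(3) c2(3) by (simp add: m_def E.pi_prime)
  have dv: "\<gamma>1 dvd m" "\<gamma>2 dvd m" by (simp_all add: m_def)
  define u where "u = E.\<Phi> m \<star>\<^bsub>q\<^esub> monom 1 n"
  obtain w1 where w1: "w1 \<in> drinfeld_End \<iota> g1 1" "red w1 = R.dmod [:\<theta>, f g1, 1:] m \<star>\<^bsub>q\<^esub> monom 1 n"
    by (rule Frobenius_multiple_lifts[OF g(1) ord CM(1) c1(1,2) dv(1) n(2)])
  obtain w2 where w2: "w2 \<in> drinfeld_End \<iota> g2 1" "red w2 = R.dmod [:\<theta>, f g2, 1:] m \<star>\<^bsub>q\<^esub> monom 1 n"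
    by (rule Frobenius_multiple_lifts[OF g(2) ord[unfolded g(3)] CM(2) c2(1,2) dv(2) n(2)[unfolded g(3)]])
  have ru: "red w1 = u" "red w2 = u" using w1(2) w2(2) by (simp_all only: u_def E.\<phi>_def g(3)[symmetric])
  show ?thesis
  proof (cases "coeff w1 0 = coeff w2 0")
    case True
    show ?thesis
      by (rule ordinary_lift_unique[OF g ord w1(1) w2(1) True n m w1(2)]) (simp only: ru)
  next
    case neq: False
    define \<beta>1 where "\<beta>1 = coeff w1 0"
    define \<beta>2 where "\<beta>2 = coeff w2 0"
    have \<beta>: "\<beta>1 \<in> drinfeld_order \<iota> g1 1" "\<beta>2 \<in> drinfeld_order \<iota> g2 1"
      using w1(1) w2(1) by (auto simp: drinfeld_order_def \<beta>1_def \<beta>2_def)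
    have rE: "red_End g1 \<beta>1 = u" "red_End g2 \<beta>2 = u"
      using ru lift_End_eq[OF w1(1)] lift_End_eq[OF w2(1)] by (simp_all add: red_End_def \<beta>1_def \<beta>2_def)
    have eq: "red_End g1 \<beta>1 = red_End g2 \<beta>2" by (simp only: rE)
    have ne: "\<beta>1 \<noteq> \<beta>2" using neq by (simp only: \<beta>1_def \<beta>2_def simp_thms)
    obtain a b c where prim: "\<not> (\<pi> dvd a \<and> \<pi> dvd b \<and> \<pi> dvd c)" "c \<noteq> 0"
      and tr: "\<iota> c * (\<beta>1 + \<beta>2) = - \<iota> b" and nm: "\<iota> c * (\<beta>1 * \<beta>2) = \<iota> a"
      and rel: "E.\<Phi> a + E.\<Phi> b \<star>\<^bsub>q\<^esub> red_End g2 \<beta>2 + E.\<Phi> c \<star>\<^bsub>q\<^esub> (red_End g2 \<beta>2 \<star>\<^bsub>q\<^esub> red_End g2 \<beta>2) = 0"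
      by (rule E.twins[OF S1 S2 \<beta> eq ne])
    have u0: "coeff u 0 = 0" unfolding u_def R.coeff_tm_0 using n(1) by simp
    have wV: "w1 \<in> VX" "w2 \<in> VX" using dEnd_VX[OF g(1) w1(1)] dEnd_VX[OF g(2) w2(1)] .
    have bV: "\<beta>1 \<in> V" "\<beta>2 \<in> V" using VX_coeff wV by (simp_all add: \<beta>1_def \<beta>2_def)
    have fb: "f \<beta>1 = 0" "f \<beta>2 = 0"
      using coeff_red[of w1 0] coeff_red[of w2 0] u0 by (simp_all add: ru \<beta>1_def \<beta>2_def)
    have "f (\<iota> c * (\<beta>1 + \<beta>2)) = 0"
      by (simp add: f_mult[OF iota_V V_add[OF bV]] f_add[OF bV] fb)
    hence "f (\<iota> b) = 0" unfolding tr f_minus[OF iota_V] by simp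
    hence pb: "\<pi> dvd b" by (simp only: f_iota_eq_0_iff)
    have "f (\<iota> c * (\<beta>1 * \<beta>2)) = 0"
      by (simp add: f_mult[OF iota_V V_mult[OF bV]] f_mult[OF bV] fb)
    hence pa: "\<pi> dvd a" unfolding nm by (simp only: f_iota_eq_0_iff)
    have pc: "\<not> \<pi> dvd c" using prim(1) pa pb by blast
    obtain a' where a': "a = a' * \<pi>" using pa by (auto simp: dvd_def mult.commute)
    obtain b' where b': "b = b' * \<pi>" using pb by (auto simp: dvd_def mult.commute)
    have uE: "u \<in> E.End" unfolding u_def by (rule E.End_mult[OF E.End_Phi n(2)])
    have F2: "monom 1 n \<star>\<^bsub>q\<^esub> monom 1 n = (monom 1 (n + n) :: 'r poly)"
      by (rule poly_eqI) (auto simp: R.coeff_tm_monom_left R.q_pos)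
    have "u \<star>\<^bsub>q\<^esub> u = E.\<Phi> m \<star>\<^bsub>q\<^esub> ((monom 1 n \<star>\<^bsub>q\<^esub> E.\<Phi> m) \<star>\<^bsub>q\<^esub> monom 1 n)"
      by (simp only: u_def R.tm_assoc)
    also have "\<dots> = E.\<Phi> (m * m) \<star>\<^bsub>q\<^esub> monom 1 (n + n)"
      by (simp only: E.End_commute[OF n(2)] R.dmod_mult R.tm_assoc F2)
    finally have uu: "u \<star>\<^bsub>q\<^esub> u = E.\<Phi> (m * m) \<star>\<^bsub>q\<^esub> monom 1 (n + n)" .
    have "E.\<Phi> b \<star>\<^bsub>q\<^esub> u = (E.\<Phi> b' \<star>\<^bsub>q\<^esub> u) \<star>\<^bsub>q\<^esub> E.\<Phi> \<pi>"
      by (simp only: b' R.dmod_mult R.tm_assoc E.End_commute[OF uE])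
    hence "E.\<Phi> a + E.\<Phi> b \<star>\<^bsub>q\<^esub> u = (E.\<Phi> a' + E.\<Phi> b' \<star>\<^bsub>q\<^esub> u) \<star>\<^bsub>q\<^esub> E.\<Phi> \<pi>"
      by (simp only: a' R.dmod_mult R.tm_add_left)
    moreover have "E.\<Phi> c \<star>\<^bsub>q\<^esub> (u \<star>\<^bsub>q\<^esub> u) = - (E.\<Phi> a + E.\<Phi> b \<star>\<^bsub>q\<^esub> u)"
      using rel unfolding rE(2) by (rule minus_unique[symmetric])
    ultimately have "E.\<Phi> (c * (m * m)) \<star>\<^bsub>q\<^esub> monom 1 (n + n) = (- (E.\<Phi> a' + E.\<Phi> b' \<star>\<^bsub>q\<^esub> u)) \<star>\<^bsub>q\<^esub> E.\<Phi> \<pi>"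
      by (simp only: uu R.dmod_mult R.tm_assoc R.tm_minus_left)
    moreover have "\<not> \<pi> dvd c * (m * m)" using pc m by (simp add: E.pi_prime)
    moreover have "monom 1 (n + n) \<in> E.End" using E.End_mult[OF n(2) n(2)] by (simp only: F2)
    ultimately have False using E.Frobenius_not_divisible by blast
    thus ?thesis ..
  qed
qed

end

section \<open>Congruent singular moduli\<close>

theorem theorem3:
  fixes emb :: "('q :: {field, finite}) fls alg_closure \<Rightarrow> 'c :: field"
    and absv :: "'c \<Rightarrow> real"
    and \<iota> :: "'q poly \<Rightarrow> 'c"
    and j\<^sub>1 j\<^sub>2 :: 'c and L \<PP> :: "'c set" and \<pp> \<cc>\<^sub>1 \<cc>\<^sub>2 :: "'q poly set"
  assumes "C_infinity emb absv" and "\<iota> = A_incl emb"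
    and "singular_modulus \<iota> j\<^sub>1" and "singular_modulus \<iota> j\<^sub>2" and "j\<^sub>1 \<noteq> j\<^sub>2"
    and "is_conductor \<iota> (modulus_order \<iota> j\<^sub>1) \<cc>\<^sub>1"
    and "is_conductor \<iota> (modulus_order \<iota> j\<^sub>2) \<cc>\<^sub>2"
    and "subfield L ring_of_type_algebra"
    and "ring.finite_dimension ring_of_type_algebra (fraction_field (range \<iota>)) L"
    and "j\<^sub>1 \<in> L" and "j\<^sub>2 \<in> L"
    and "primeideal \<PP> (subring_on (integral_closure_in \<iota> L))" and "\<PP> \<noteq> {0}"
    and "primeideal \<pp> ring_of_type_algebra" and "\<pp> \<noteq> {0}"
    and "\<iota> -` \<PP> = \<pp>"
    and "j\<^sub>1 - j\<^sub>2 \<in> \<PP>"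
  shows "(modulus_field \<iota> j\<^sub>1 = modulus_field \<iota> j\<^sub>2 \<and>
            \<pp> divides\<^bsub>ideals_set ring_of_type_algebra\<^esub> (\<cc>\<^sub>1 \<otimes>\<^bsub>ideals_set ring_of_type_algebra\<^esub> \<cc>\<^sub>2)) \<or>
         (nonsplit_in \<iota> \<pp> (modulus_field \<iota> j\<^sub>1) \<and> nonsplit_in \<iota> \<pp> (modulus_field \<iota> j\<^sub>2))"
proof -
  interpret C: C_infinity emb absv by (rule assms(1))
  interpret A: A_algebra \<iota> unfolding assms(2) by (rule C.A_algebra_A_incl)
  let ?n = "CARD('q) + 1"
  note \<pp>_ideal = ideal_type_algebra[OF primeideal.axioms(1)[OF assms(14)]]
  have \<pp>_iff: "\<iota> a \<in> \<PP> \<longleftrightarrow> a \<in> \<pp>" for a using assms(16) by auto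
  obtain p\<^sub>0 where p\<^sub>0: "p\<^sub>0 \<in> \<pp>" "p\<^sub>0 \<noteq> 0" using assms(15) \<pp>_ideal(1) by blast
  obtain \<pi> where \<pi>: "\<pi> \<noteq> 0" "\<pp> = {a. \<pi> dvd a}"
    by (rule poly_ideal_principal[OF \<pp>_ideal(4) \<pp>_ideal(3) p\<^sub>0])
  have \<pi>_unit: "\<not> \<pi> dvd 1"
  proof
    assume "\<pi> dvd 1"
    hence "\<pi> dvd a" for a using dvd_mult2[of \<pi> 1 a] by simp
    hence "\<pp> = UNIV" by (auto simp: \<pi>(2))
    thus False using primeideal.I_notcarr[OF assms(14)] by simp
  qed
  have \<pi>_prime: "\<pi> dvd a \<or> \<pi> dvd b" if "\<pi> dvd a * b" for a b
    using primeideal.I_prime[OF assms(14), of a b] that by (simp add: \<pi>(2))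

  define OL where "OL = integral_closure_in \<iota> L"
  have P: "ideal \<PP> (subring_on OL)" using primeideal.axioms(1)[OF assms(12)] by (simp only: OL_def)
  note P' = ideal.axioms(1)[OF P]
  have P_sub: "\<PP> \<subseteq> OL" using additive_subgroup.a_subset[OF P'] by simp
  have P_0: "0 \<in> \<PP>" using additive_subgroup.zero_closed[OF P'] by simp
  have P_add: "x + y \<in> \<PP>" if "x \<in> \<PP>" "y \<in> \<PP>" for x y
    using additive_subgroup.a_closed[OF P' that] by simp
  have P_mult: "r * x \<in> \<PP>" if "r \<in> OL" "x \<in> \<PP>" for r x
    using ideal.I_l_closed[OF P that(2), of r] that(1) by simp
  \<comment> \<open>A constant is the quotient of two elements of \<open>\<PP>\<close>, so it is
    in \<open>L\<close>.\<close>
  have const_OL: "\<iota> [:c:] \<in> OL" for c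
  proof -
    interpret R: ring "ring_of_type_algebra :: 'c ring" by (rule ring_from_type_algebra)
    have inL: "\<iota> a \<in> L" if "a \<in> \<pp>" for a
      using P_sub that \<pp>_iff[of a] by (auto simp: OL_def integral_closure_in_def)
    have "[:c:] * p\<^sub>0 \<in> \<pp>" by (rule \<pp>_ideal(3)[OF p\<^sub>0(1)])
    hence "\<iota> p\<^sub>0 * \<iota> [:c:] \<in> L" using inL[of "[:c:] * p\<^sub>0"] by (simp only: A.iota_mult mult.commute)
    moreover have "\<iota> p\<^sub>0 \<in> L - {0}" using inL[OF p\<^sub>0(1)] p\<^sub>0(2) by (simp add: A.iota_eq_0_iff)
    ultimately have "\<iota> [:c:] \<in> L"
      using R.subfield_m_inv_simprule[OF assms(8), of "\<iota> p\<^sub>0" "\<iota> [:c:]"] by simp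
    thus ?thesis by (simp add: OL_def integral_closure_in_def A.integral_iota)
  qed
  have P_diff: "x - y \<in> \<PP>" if "x \<in> \<PP>" "y \<in> \<PP>" for x y
  proof -
    have "[:- 1 :: 'q:] = - 1" by (simp only: pCons_one[symmetric] minus_pCons minus_zero)
    hence "\<iota> [:- 1:] = - 1" by (simp only: A.iota_minus A.iota_1)
    thus ?thesis using P_add[OF that(1) P_mult[OF const_OL that(2), of "- 1"]] by simp
  qed
  have "\<exists>V (f :: 'c \<Rightarrow> 'q alg_closure). reduction CARD('q) to_ac \<iota> V f \<pi> \<and> (\<forall>x\<in>\<PP>. x \<in> V \<and> f x = 0)"
  proof (rule A.exists_reduction[of \<PP> \<pi>])
    show "x * y \<in> \<PP>" if "x \<in> \<PP>" "y \<in> \<PP>" for x y by (rule P_mult[OF subsetD[OF P_sub that(1)] that(2)])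
    show "\<iota> [:c:] * x \<in> \<PP>" if "x \<in> \<PP>" for c x by (rule P_mult[OF const_OL that])
    show "\<iota> a \<in> \<PP> \<longleftrightarrow> \<pi> dvd a" for a by (simp add: \<pp>_iff \<pi>(2))
    show "0 \<in> \<PP>" "\<pi> \<noteq> 0" "\<not> \<pi> dvd 1" by (rule P_0 \<pi>(1) \<pi>_unit)+
    show "x - y \<in> \<PP>" if "x \<in> \<PP>" "y \<in> \<PP>" for x y by (rule P_diff[OF that])
    show "\<pi> dvd a \<or> \<pi> dvd b" if "\<pi> dvd a * b" for a b by (rule \<pi>_prime[OF that])
    show ?thesis if "reduction CARD('q) to_ac \<iota> V f \<pi>" "\<And>x. x \<in> \<PP> \<Longrightarrow> x \<in> V \<and> f x = 0"
      for V and f :: "'c \<Rightarrow> 'q alg_closure"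
      using that by (intro exI[of _ V] exI[of _ f]) simp
  qed
  then obtain V and f :: "'c \<Rightarrow> 'q alg_closure"
    where red: "reduction CARD('q) to_ac \<iota> V f \<pi>" and VP': "\<forall>x\<in>\<PP>. x \<in> V \<and> f x = 0" by (elim exE conjE)
  have VP: "x \<in> V \<and> f x = 0" if "x \<in> \<PP>" for x using VP' that by (rule bspec)
  interpret reduction "CARD('q)" to_ac \<iota> V f \<pi> by (rule red)

  \<comment> \<open>A module with complex multiplication and \<open>j \<notin> V\<close> would
    have the model with coefficients \<open>1\<close> and \<open>1/j\<close>, whose reduction is
    bad. Hence \<open>j \<in> V\<close>, and there is a model with \<open>\<Delta> = 1\<close> and
    \<open>g \<in> V\<close>.\<close>
  have model: "\<exists>g. g ^ ?n = j \<and> g \<in> V \<and> drinfeld_order \<iota> g 1 \<noteq> range \<iota>" if "singular_modulus \<iota> j" for j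
  proof -
    obtain g \<Delta> where g: "\<Delta> \<noteq> 0" "drinfeld_order \<iota> g \<Delta> \<noteq> range \<iota>" "j = drinfeld_j \<iota> g \<Delta>"
      using \<open>singular_modulus \<iota> j\<close> unfolding singular_modulus_def has_CM_def by blast
    have jV: "j \<in> V"
    proof (rule ccontr)
      assume j: "j \<notin> V"
      hence D: "inverse j \<in> V" "f (inverse j) = 0" and j0: "inverse j \<noteq> 0" using not_in_V V_0 by auto
      have "drinfeld_j \<iota> 1 (inverse j) = j" by (simp add: drinfeld_j_def divide_inverse)
      hence "drinfeld_j \<iota> g \<Delta> = drinfeld_j \<iota> 1 (inverse j)" by (simp only: g(3)[symmetric])
      from C.drinfeld_order_eq[OF g(1) j0 this] bad_reduction_no_CM[OF D] g(2) show False by simp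
    qed
    obtain h where h: "h ^ ?n = j" using C.nth_root_exists_C[of ?n j] by auto
    have "drinfeld_j \<iota> h 1 = j" using h by (simp add: drinfeld_j_def)
    hence "drinfeld_j \<iota> g \<Delta> = drinfeld_j \<iota> h 1" by (simp only: g(3)[symmetric])
    from C.drinfeld_order_eq[OF g(1) one_neq_zero this] g(2) have "drinfeld_order \<iota> h 1 \<noteq> range \<iota>" by simp
    moreover have "h ^ ?n \<in> V" unfolding h by (rule jV)
    hence "h \<in> V" by (rule root_in_V) simp
    ultimately show ?thesis using h by blast
  qed
  have order: "modulus_order \<iota> (g ^ ?n) = drinfeld_order \<iota> g 1" for g
    using C.modulus_order_eq[of 1 \<iota> g] by (simp add: drinfeld_j_def)
  obtain g\<^sub>1 where g\<^sub>1: "g\<^sub>1 ^ ?n = j\<^sub>1" "g\<^sub>1 \<in> V" "drinfeld_order \<iota> g\<^sub>1 1 \<noteq> range \<iota>"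
    using model[OF assms(3)] by blast
  obtain h where h: "h ^ ?n = j\<^sub>2" "h \<in> V" "drinfeld_order \<iota> h 1 \<noteq> range \<iota>"
    using model[OF assms(4)] by blast
  have jV: "j\<^sub>1 \<in> V" "j\<^sub>2 \<in> V" using V_power[OF g\<^sub>1(2), of ?n] V_power[OF h(2), of ?n] by (simp_all only: g\<^sub>1(1) h(1))
  have "f j\<^sub>1 = f j\<^sub>2" using VP[OF assms(17)] f_diff[OF jV] by simp
  hence fj: "f (g\<^sub>1 ^ ?n) = f (h ^ ?n)" by (simp only: g\<^sub>1(1) h(1))
  have n0: "?n > 0" by simp
  obtain B :: "'c multiset" where B: "size B = ?n" "\<forall>x. x ^ ?n - 1 = prod_mset (image_mset (\<lambda>r. x - r) B)"
    using C.roots_of_unity_split[OF n0] by (elim exE conjE)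
  \<comment> \<open>Passing to another root changes neither \<open>j\<^sub>2\<close> nor its
    order, and gives both modules the same reduction.\<close>
  obtain g\<^sub>2 where g\<^sub>2: "g\<^sub>2 \<in> V" "g\<^sub>2 ^ ?n = h ^ ?n" "f g\<^sub>1 = f g\<^sub>2"
    by (rule congruent_root[OF n0 g\<^sub>1(2) h(2) fj B(1) B(2)[THEN spec]])
  have O1: "modulus_order \<iota> j\<^sub>1 = drinfeld_order \<iota> g\<^sub>1 1" using order[of g\<^sub>1] by (simp only: g\<^sub>1(1))
  have O2: "modulus_order \<iota> j\<^sub>2 = drinfeld_order \<iota> g\<^sub>2 1" using order[of g\<^sub>2] by (simp only: g\<^sub>2(2) h(1))
  have "drinfeld_order \<iota> g\<^sub>2 1 = drinfeld_order \<iota> h 1" using order[of h] by (simp only: h(1) O2)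
  hence CM2: "drinfeld_order \<iota> g\<^sub>2 1 \<noteq> range \<iota>" using h(3) by simp
  note K = modulus_field_def[of \<iota> j\<^sub>1, unfolded O1] modulus_field_def[of \<iota> j\<^sub>2, unfolded O2]

  interpret E: reduced_module "CARD('q)" to_ac \<theta> "f g\<^sub>1" \<pi> by (rule reduced_module)
  consider (ss) "R.tord (E.\<Phi> \<pi>) = 2 * E.d" | (ord) "R.tord (E.\<Phi> \<pi>) = E.d"
    using E.Phi_pi_tord by (elim disjE)
  thus ?thesis
  proof cases
    case ss
    hence ss1: "R.tord (R.dmod [:\<theta>, f g\<^sub>1, 1:] \<pi>) = 2 * degree \<pi>" by (simp only: E.\<phi>_def E.d_def)
    have "nonsplit_in \<iota> \<pp> (modulus_field \<iota> j\<^sub>1)" "nonsplit_in \<iota> \<pp> (modulus_field \<iota> j\<^sub>2)"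
      unfolding K \<pi>(2) using supersingular_nonsplit[OF g\<^sub>1(2) ss1] supersingular_nonsplit[OF g\<^sub>2(1) ss1[unfolded g\<^sub>2(3)]] .
    thus ?thesis by (intro disjI2 conjI)
  next
    case ord
    have ord1: "ordinary_module CARD('q) to_ac \<theta> (f g\<^sub>1) \<pi>"
      by (intro ordinary_module.intro ordinary_module_axioms.intro reduced_module ord)
    note ord2 = ord1[unfolded g\<^sub>2(3)]
    have fields: "modulus_field \<iota> j\<^sub>1 = modulus_field \<iota> j\<^sub>2"
      unfolding K
      using ordinary_field_subset[OF g\<^sub>1(2) g\<^sub>2(1) g\<^sub>2(3) ord1 CM2]
        ordinary_field_subset[OF g\<^sub>2(1) g\<^sub>1(2) g\<^sub>2(3)[symmetric] ord2 g\<^sub>1(3)] by (rule equalityI)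
    have sub: "\<cc>\<^sub>1 \<subseteq> \<pp> \<or> \<cc>\<^sub>2 \<subseteq> \<pp>"
    proof (rule ccontr)
      assume "\<not> (\<cc>\<^sub>1 \<subseteq> \<pp> \<or> \<cc>\<^sub>2 \<subseteq> \<pp>)"
      then obtain \<gamma>\<^sub>1 \<gamma>\<^sub>2 where \<gamma>: "\<gamma>\<^sub>1 \<in> \<cc>\<^sub>1" "\<not> \<pi> dvd \<gamma>\<^sub>1" "\<gamma>\<^sub>2 \<in> \<cc>\<^sub>2" "\<not> \<pi> dvd \<gamma>\<^sub>2" unfolding \<pi>(2) by blast
      have "g\<^sub>1 = g\<^sub>2"
        by (rule ordinary_prime_to_conductors[OF g\<^sub>1(2) g\<^sub>2(1) g\<^sub>2(3) ord1 g\<^sub>1(3) CM2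
            assms(6)[unfolded O1] \<gamma>(1,2) assms(7)[unfolded O2] \<gamma>(3,4)])
      thus False using g\<^sub>1(1) g\<^sub>2(2) h(1) assms(5) by simp
    qed
    have ideals: "ideal \<cc>\<^sub>1 ring_of_type_algebra" "ideal \<cc>\<^sub>2 ring_of_type_algebra"
      by (rule assms(6,7)[unfolded is_conductor_def, THEN conjunct1])+
    have "\<pp> divides\<^bsub>ideals_set ring_of_type_algebra\<^esub> (\<cc>\<^sub>1 \<otimes>\<^bsub>ideals_set ring_of_type_algebra\<^esub> \<cc>\<^sub>2)"
      using sub unfolding \<pi>(2) by (rule ideal_prime_divides_product[OF ideals])
    with fields show ?thesis by (intro disjI1 conjI)
  qed
qed

end
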